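(* Let $m\ge2$ be an even integer and let $\Gamma\subset SL_2(\mathbb R)$ be a Fuchsian group of the first kind with $g(\Gamma)\ge1$. Let $t=\dim S^H_m(\Gamma)=\dim H^{m/2}(\mathfrak R_\Gamma)$. Fix a basis $f_1,\ldots,f_t$ of $S^H_m(\Gamma)$, and let $\omega_1,\ldots,\omega_t$ be the corresponding basis of $H^{m/2}(\mathfrak R_\Gamma)$ (i.e. $\omega_i=\omega_{f_i}$). Consider the Wronskian $W(\omega_1,\ldots,\omega_t)\in H^{\frac t2(m-1+t)}(\mathfrak R_\Gamma)$ of the differentials and the Wronskian $W(f_1,\ldots,f_t)\in S_{t(m+t-1)}(\Gamma)$ of the modular forms. Then $$\omega_{W(f_1,\ldots,f_t)}=W(\omega_1,\ldots,\omega_t).$$ In particular, $W(f_1,\ldots,f_t)\in S^H_{t(m+t-1)}(\Gamma)$. Moreover, assume that $\mathfrak a_\infty$ is a $\Gamma$-cusp. Then $\mathfrak a_\infty$ is an $\frac m2$-Weierstrass point if and only if $$\mathfrak c'_{W(f_1,\ldots,f_t)}(\mathfrak a_\infty)\ge1+\frac t2(m-1+t),\quad\text{i.e.,}\quad \mathfrak c_{W(f_1,\ldots,f_t)}(\mathfrak a_\infty)\ge\frac t2(m-1+t).$$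
   Context: A Fuchsian group of the first kind is a discrete subgroup $\Gamma\subset SL_2(\mathbb R)$ with $\iint_{\Gamma\backslash\mathbb H} dx\,dy/y^2<\infty$. For $g=\begin{pmatrix}a&b\\c&d\end{pmatrix}\in SL_2(\mathbb R)$ put $j(g,z)=cz+d$ and $(f|_m g)(z)=j(g,z)^{-m}f(g.z)$. $\mathfrak R_\Gamma$ is the compact Riemann surface obtained from $\Gamma\backslash\mathbb H$ by adding the finitely many $\Gamma$-orbits of cusps; $g(\Gamma)$ is its genus. "$\mathfrak a_\infty$ is a $\Gamma$-cusp" means that $\infty$ is a cusp of $\Gamma$ and $\mathfrak a_\infty\in\mathfrak R_\Gamma$ is the corresponding point. $M_m(\Gamma)$ (resp. $S_m(\Gamma)$) is the space of holomorphic $f:\mathbb H\to\mathbb C$ with $f(\gamma.z)=j(\gamma,z)^m f(z)$ for all $\gamma\in\Gamma$ that are holomorphic (resp. holomorphic and vanishing) at every cusp of $\Gamma$. The Wronskian of modular forms is $W(f_1,\ldots,f_t)=\det\left(\frac{d^{i-1}f_j}{dz^{i-1}}\right)_{1\le i,j\le t}$. $H^l(\mathfrak R_\Gamma)$ is the space of holomorphic differentials of degree $l$ on $\mathfrak R_\Gamma$ (locally $\varphi(z)(dz)^l$ with $\varphi$ holomorphic). If $t=\dim H^l(\mathfrak R_\Gamma)\ge 1$ and $\omega_1,\ldots,\omega_t$ is a basis of $H^l(\mathfrak R_\Gamma)$, written in a local coordinate $z$ as $\omega_i=\varphi_i(dz)^l$, the local expressions $\det\left(\frac{d^{i-1}\varphi_j}{dz^{i-1}}\right)_{1\le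 i,j\le t}(dz)^{\frac t2(2l-1+t)}$ glue to a non-zero holomorphic differential $W(\omega_1,\ldots,\omega_t)\in H^{\frac t2(2l-1+t)}(\mathfrak R_\Gamma)$. For an integer $l\ge1$, a point $\mathfrak a\in\mathfrak R_\Gamma$ is an $l$-Weierstrass point if there is a non-zero $\omega\in H^l(\mathfrak R_\Gamma)$ with $\nu_{\mathfrak a}(\omega)\ge\dim H^l(\mathfrak R_\Gamma)$, where $\nu_{\mathfrak a}(\omega)$ is the order of vanishing of $\omega$ at $\mathfrak a$; equivalently, $\nu_{\mathfrak a}(W(\omega_1,\ldots,\omega_t))\ge1$. For even $m$ and $f$ of weight $m$, $\omega_f$ is the unique meromorphic differential of degree $m/2$ on $\mathfrak R_\Gamma$ whose pull-back to $\mathbb H$ is $f(z)(dz)^{m/2}$; $f\mapsto\omega_f$ maps the space $S^H_m(\Gamma)$ defined below isomorphically onto $H^{m/2}(\mathfrak R_\Gamma)$. Orders. For $\xi\in\mathbb H$ let $e_\xi=\#(\Gamma_\xi/(\Gamma\cap\{\pm1\}))$; $\xi$ is elliptic if $e_\xi>1$. For the image $\mathfrak a_\xi\in\mathfrak R_\Gamma$ of $\xi$ put $e_{\mathfrak a_\xi}=e_\xi$, and for $0\ne f\in M_m(\Gamma)$ put $\nu_{\mathfrak a_\xi}(f)=\nu_{z-\xi}(f)/e_\xi$, where $\nu_{z-\xi}(f)$ is the order of vanishing of $f$ at $\xi$. If $x$ is a cusp, choose $\sigma\in SL_2(\mathbb R)$ with $\sigma.x=\infty$ and $h'>0$ with $\{\pm1\}\sigma\Gamma_x\sigma^{-1}=\{\pm1\}\{\begin{pmatrix}1&lh'\\0&1\end{pmatrix}: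 l\in\mathbb Z\}$; for $m$ even write $(f|_m\sigma^{-1})(z)=\sum_{n\ge0}a_ne^{2\pi\sqrt{-1}nz/h'}$ and let $\nu_{\mathfrak b}(f)$ be the least $n$ with $a_n\ne0$, where $\mathfrak b$ is the point of $\mathfrak R_\Gamma$ corresponding to $x$. Put $\mathrm{div}(f)=\sum_{\mathfrak a}\nu_{\mathfrak a}(f)\mathfrak a\in\mathbb Q\otimes\mathrm{Div}(\mathfrak R_\Gamma)$. For divisors, $\mathfrak d_1\ge\mathfrak d_2$ means $\mathfrak d_1-\mathfrak d_2$ is an integral divisor with non-negative coefficients; $\mathfrak d(\mathfrak a)$ denotes the coefficient of $\mathfrak a$ in $\mathfrak d$. For even $m\ge2$ and $0\ne f\in M_m(\Gamma)$ the divisor $$\mathfrak c'_f=\mathrm{div}(f)-\sum_{\mathfrak a\ \text{elliptic}}\left(\tfrac m2(1-1/e_{\mathfrak a})-\left[\tfrac m2(1-1/e_{\mathfrak a})\right]\right)\mathfrak a$$ ($[x]$ is the largest integer $\le x$) is integral and $\ge0$. If $f\in S_m(\Gamma)$, put $\mathfrak c_f=\mathfrak c'_f-\sum_{\mathfrak b\ \text{cusp}}\mathfrak b\ \ (\ge0)$. Define $S^H_m(\Gamma)$ (even $m\ge2$) as the set of $f\in S_m(\Gamma)$ such that $f=0$ or $$\mathfrak c_f\ge\sum_{\mathfrak a\ \text{elliptic}}\left[\tfrac m2(1-1/e_{\mathfrak a})\right]\mathfrak a+\left(\tfrac m2-1\right)\sum_{\mathfrak b\ \text{cusp}}\mathfrak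 b .$$ *)

theory Defs
  imports
    "HOL-Complex_Analysis.Complex_Analysis"
    "HOL-Algebra.Group"
    "HOL-Library.Function_Algebras"
    "Jordan_Normal_Form.Determinant"
begin

no_notation Matrix.vec_index (infixl \<open>$\<close> 100)

section \<open>Complex vector spaces of functions\<close>

definition fscale :: "complex \<Rightarrow> ('a \<Rightarrow> complex) \<Rightarrow> ('a \<Rightarrow> complex)" where
  "fscale c f = (\<lambda>x. c * f x)"

definition dscale :: "complex \<Rightarrow> ('a \<Rightarrow> 'b \<Rightarrow> complex) \<Rightarrow> ('a \<Rightarrow> 'b \<Rightarrow> complex)" where
  "dscale c \<omega> = (\<lambda>x y. c * \<omega> x y)"

definition (in vector_space) indexed_basis :: "nat \<Rightarrow> (nat \<Rightarrow> 'b) \<Rightarrow> 'b set \<Rightarrow> bool" where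
  "indexed_basis t v V \<longleftrightarrow>
     inj_on v {..<t} \<and> independent (v ` {..<t}) \<and> span (v ` {..<t}) = V"

global_interpretation fspace: vector_space "fscale :: complex \<Rightarrow> ('a \<Rightarrow> complex) \<Rightarrow> 'a \<Rightarrow> complex"
  by unfold_locales (auto simp: fscale_def fun_eq_iff algebra_simps)

global_interpretation dspace:
  vector_space "dscale :: complex \<Rightarrow> ('a \<Rightarrow> 'b \<Rightarrow> complex) \<Rightarrow> 'a \<Rightarrow> 'b \<Rightarrow> complex"
  by unfold_locales (auto simp: dscale_def fun_eq_iff algebra_simps)

section \<open>Differentials on a Riemann surface given by an atlas\<close>

text \<open>A chart is a pair of a subset \<open>U\<close> of the surface and a coordinate that is injective on \<open>U\<close>
  with open image in the complex plane.  A differential of degree \<open>l\<close> is the family of its local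
  expressions \<open>\<omega> (U, \<phi>)\<close>, functions of the coordinate.  To make equality of differentials
  equality of families, local expressions are \<open>0\<close> off the image of their chart and at their poles
  (the latter is part of \<open>nicely_meromorphic_on\<close>), and \<open>\<omega> c = 0\<close> if \<open>c\<close> is not in the atlas.\<close>

type_synonym 'p chart = "'p set \<times> ('p \<Rightarrow> complex)"
type_synonym 'p differential = "'p chart \<Rightarrow> complex \<Rightarrow> complex"

definition meromorphic_differentials :: "'p chart set \<Rightarrow> nat \<Rightarrow> 'p differential set" where
  "meromorphic_differentials A l = {\<omega>.
     (\<forall>c. c \<notin> A \<longrightarrow> \<omega> c = (\<lambda>_. 0)) \<and>
     (\<forall>(U, \<phi>) \<in> A. \<omega> (U, \<phi>) nicely_meromorphic_on \<phi> ` U \<and> (\<forall>z. z \<notin> \<phi> ` U \<longrightarrow> \<omega> (U, \<phi>) z = 0)) \<and>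
     (\<forall>(U, \<phi>) \<in> A. \<forall>(V, \<psi>) \<in> A. \<forall>z \<in> \<phi> ` (U \<inter> V).
        \<omega> (U, \<phi>) z =
        \<omega> (V, \<psi>) (\<psi> (inv_into U \<phi> z)) * deriv (\<lambda>w. \<psi> (inv_into U \<phi> w)) z ^ l)}"

definition holomorphic_differentials :: "'p chart set \<Rightarrow> nat \<Rightarrow> 'p differential set" where
  "holomorphic_differentials A l =
     {\<omega> \<in> meromorphic_differentials A l. \<forall>(U, \<phi>) \<in> A. \<omega> (U, \<phi>) holomorphic_on \<phi> ` U}"

text \<open>The order does not depend on the chosen chart around the point.\<close>

definition differential_order :: "'p chart set \<Rightarrow> 'p differential \<Rightarrow> 'p \<Rightarrow> int" where
  "differential_order A \<omega> a =
     (let (U, \<phi>) = (SOME c. c \<in> A \<and> a \<in> fst c) in zorder (\<omega> (U, \<phi>)) (\<phi> a))"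

definition weierstrass_point :: "'p chart set \<Rightarrow> nat \<Rightarrow> 'p \<Rightarrow> bool" where
  "weierstrass_point A l a \<longleftrightarrow>
     (\<exists>\<omega> \<in> holomorphic_differentials A l. \<omega> \<noteq> 0 \<and>
        differential_order A \<omega> a \<ge> int (dspace.dim (holomorphic_differentials A l)))"

definition local_wronskian :: "nat \<Rightarrow> (nat \<Rightarrow> complex \<Rightarrow> complex) \<Rightarrow> complex \<Rightarrow> complex" where
  "local_wronskian t f z =
     Determinant.det (Matrix.mat t t (\<lambda>(i, j). (deriv ^^ i) (f j) z))"

definition differential_wronskian ::
    "'p chart set \<Rightarrow> nat \<Rightarrow> (nat \<Rightarrow> 'p differential) \<Rightarrow> 'p differential" where
  "differential_wronskian A t \<omega> = (\<lambda>(U, \<phi>) z.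
     if (U, \<phi>) \<in> A \<and> z \<in> \<phi> ` U then local_wronskian t (\<lambda>j. \<omega> j (U, \<phi>)) z else 0)"

section \<open>Fuchsian groups of the first kind\<close>

type_synonym mat22 = "real^2^2"

definition SL2R :: "mat22 monoid" where
  "SL2R = \<lparr>carrier = {A. Determinants.det A = 1}, mult = (**), one = Finite_Cartesian_Product.mat 1\<rparr>"

definition upper_half_plane :: "complex set" (\<open>\<H>\<close>) where
  "\<H> = {z. Im z > 0}"

definition cocycle :: "mat22 \<Rightarrow> complex \<Rightarrow> complex" where
  "cocycle g z = of_real (g$2$1) * z + of_real (g$2$2)"

definition moebius :: "mat22 \<Rightarrow> complex \<Rightarrow> complex" where
  "moebius g z = (of_real (g$1$1) * z + of_real (g$1$2)) / cocycle g z"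

definition slash :: "nat \<Rightarrow> (complex \<Rightarrow> complex) \<Rightarrow> mat22 \<Rightarrow> complex \<Rightarrow> complex" where
  "slash m f g z = f (moebius g z) / cocycle g z ^ m"

definition hyperbolic_area :: "complex set \<Rightarrow> ennreal" where
  "hyperbolic_area F = (\<integral>\<^sup>+ z \<in> F. ennreal (1 / (Im z)\<^sup>2) \<partial>lborel)"

text \<open>The area of the quotient of \<open>\<H>\<close> by \<open>\<Gamma>\<close> is that of any Borel set of orbit representatives.\<close>

definition fuchsian_first_kind :: "mat22 set \<Rightarrow> bool" where
  "fuchsian_first_kind \<Gamma> \<longleftrightarrow>
     subgroup \<Gamma> SL2R \<and> discrete \<Gamma> \<and>
     (\<exists>F \<in> sets borel. F \<subseteq> \<H> \<and> (\<forall>z \<in> \<H>. \<exists>!w. w \<in> F \<and> (\<exists>\<gamma> \<in> \<Gamma>. w = moebius \<gamma> z)) \<and>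
        hyperbolic_area F < \<infinity>)"

section \<open>Cusps and elliptic points\<close>

datatype ecomplex = Fin complex | Infty

fun emoebius :: "mat22 \<Rightarrow> ecomplex \<Rightarrow> ecomplex" where
  "emoebius g (Fin z) = (if cocycle g z = 0 then Infty else Fin (moebius g z))"
| "emoebius g Infty = (if g$2$1 = 0 then Infty else Fin (of_real (g$1$1 / g$2$1)))"

definition plus_minus_one :: "mat22 set" where
  "plus_minus_one = {Finite_Cartesian_Product.mat 1, - Finite_Cartesian_Product.mat 1}"

definition parabolic :: "mat22 \<Rightarrow> bool" where
  "parabolic g \<longleftrightarrow> g \<in> carrier SL2R \<and> g \<notin> plus_minus_one \<and> \<bar>Determinants.trace g\<bar> = 2"

definition cusps :: "mat22 set \<Rightarrow> ecomplex set" where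
  "cusps \<Gamma> = {x. (x = Infty \<or> (\<exists>r::real. x = Fin (of_real r))) \<and>
                 (\<exists>\<gamma> \<in> \<Gamma>. parabolic \<gamma> \<and> emoebius \<gamma> x = x)}"

definition stab :: "mat22 set \<Rightarrow> ecomplex \<Rightarrow> mat22 set" where
  "stab \<Gamma> x = {\<gamma> \<in> \<Gamma>. emoebius \<gamma> x = x}"

text \<open>Order of the quotient group of the stabiliser of \<open>\<xi>\<close> by its subgroup \<open>\<Gamma> \<inter> {1, -1}\<close>.\<close>

definition ellip_order :: "mat22 set \<Rightarrow> complex \<Rightarrow> nat" where
  "ellip_order \<Gamma> \<xi> =
     card ((\<lambda>\<gamma>. (\<lambda>\<epsilon>. \<epsilon> ** \<gamma>) ` (\<Gamma> \<inter> plus_minus_one)) ` stab \<Gamma> (Fin \<xi>))"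

definition translation :: "real \<Rightarrow> mat22" where
  "translation b = vector [vector [1, b], vector [0, 1]]"

definition cusp_scaling :: "mat22 set \<Rightarrow> ecomplex \<Rightarrow> mat22 \<Rightarrow> real \<Rightarrow> bool" where
  "cusp_scaling \<Gamma> x \<sigma> h \<longleftrightarrow>
     \<sigma> \<in> carrier SL2R \<and> emoebius \<sigma> x = Infty \<and> h > 0 \<and>
     {\<epsilon> ** (\<sigma> ** \<gamma> ** matrix_inv \<sigma>) | \<epsilon> \<gamma>. \<epsilon> \<in> plus_minus_one \<and> \<gamma> \<in> stab \<Gamma> x} =
     {\<epsilon> ** translation (of_int l * h) | \<epsilon> (l::int). \<epsilon> \<in> plus_minus_one}"

section \<open>The Riemann surface of a Fuchsian group\<close>

definition extended_half_plane :: "mat22 set \<Rightarrow> ecomplex set" where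
  "extended_half_plane \<Gamma> = Fin ` \<H> \<union> cusps \<Gamma>"

type_synonym point = "ecomplex set"

definition orbit :: "mat22 set \<Rightarrow> ecomplex \<Rightarrow> point" where
  "orbit \<Gamma> x = {emoebius \<gamma> x | \<gamma>. \<gamma> \<in> \<Gamma>}"

definition surface :: "mat22 set \<Rightarrow> point set" where
  "surface \<Gamma> = orbit \<Gamma> ` extended_half_plane \<Gamma>"

definition cusp_points :: "mat22 set \<Rightarrow> point set" where
  "cusp_points \<Gamma> = orbit \<Gamma> ` cusps \<Gamma>"

text \<open>\<open>coordinate_nbhd \<Gamma> x N \<tau>\<close>: \<open>N\<close> is a standard neighbourhood (hyperbolic disc or horoball) of the
  point \<open>x\<close> of the extended half plane, and \<open>\<tau>\<close> is the function on \<open>N\<close> that induces the standard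
  local coordinate at the orbit of \<open>x\<close>.\<close>

inductive coordinate_nbhd ::
    "mat22 set \<Rightarrow> ecomplex \<Rightarrow> ecomplex set \<Rightarrow> (ecomplex \<Rightarrow> complex) \<Rightarrow> bool" for \<Gamma> where
  interior: "coordinate_nbhd \<Gamma> (Fin \<xi>) N \<tau>"
    if "\<xi> \<in> \<H>" "r > 0"
       "N = Fin ` {z \<in> \<H>. norm ((z - \<xi>) / (z - cnj \<xi>)) < r}"
       "\<And>z. Fin z \<in> N \<Longrightarrow> \<tau> (Fin z) = ((z - \<xi>) / (z - cnj \<xi>)) ^ ellip_order \<Gamma> \<xi>"
| cusp: "coordinate_nbhd \<Gamma> x N \<tau>"
    if "x \<in> cusps \<Gamma>" "cusp_scaling \<Gamma> x \<sigma> h" "T > 0"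
       "N = insert x (Fin ` {z \<in> \<H>. Im (moebius \<sigma> z) > T})"
       "\<tau> x = 0"
       "\<And>z. z \<in> \<H> \<Longrightarrow> Fin z \<in> N \<Longrightarrow>
          \<tau> (Fin z) = exp (2 * of_real pi * \<i> * moebius \<sigma> z / of_real h)"

text \<open>The condition on \<open>\<gamma>\<close> makes \<open>N\<close> modulo the stabiliser of \<open>x\<close> a subset of the surface, on which
  \<open>\<tau>\<close> then is injective.\<close>

definition atlas :: "mat22 set \<Rightarrow> point chart set" where
  "atlas \<Gamma> = {(U, \<phi>). \<exists>x N \<tau>. coordinate_nbhd \<Gamma> x N \<tau> \<and>
     (\<forall>\<gamma> \<in> \<Gamma>. emoebius \<gamma> ` N \<inter> N \<noteq> {} \<longrightarrow> emoebius \<gamma> x = x) \<and>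
     U = orbit \<Gamma> ` N \<and> \<phi> \<in> extensional U \<and> (\<forall>y \<in> N. \<phi> (orbit \<Gamma> y) = \<tau> y)}"

abbreviation H_space :: "mat22 set \<Rightarrow> nat \<Rightarrow> point differential set" where
  "H_space \<Gamma> l \<equiv> holomorphic_differentials (atlas \<Gamma>) l"

text \<open>The genus of a compact Riemann surface as the dimension of its space of holomorphic
  differentials of degree 1.\<close>

definition genus :: "mat22 set \<Rightarrow> nat" where
  "genus \<Gamma> = dspace.dim (H_space \<Gamma> 1)"

text \<open>The pull-back of \<open>\<omega>\<close> to \<open>\<H>\<close> is \<open>f(z) (dz)^l\<close>, as an identity of meromorphic differentials, i.e.
  up to a discrete set: at an elliptic point \<open>\<omega>\<close> may have a pole although \<open>f\<close> has none.\<close>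

definition has_pullback ::
    "mat22 set \<Rightarrow> nat \<Rightarrow> point differential \<Rightarrow> (complex \<Rightarrow> complex) \<Rightarrow> bool" where
  "has_pullback \<Gamma> l \<omega> f \<longleftrightarrow>
     (\<forall>(U, \<phi>) \<in> atlas \<Gamma>. \<forall>\<^sub>\<approx>z \<in> {z \<in> \<H>. orbit \<Gamma> (Fin z) \<in> U}.
        \<omega> (U, \<phi>) (\<phi> (orbit \<Gamma> (Fin z))) * deriv (\<lambda>w. \<phi> (orbit \<Gamma> (Fin w))) z ^ l = f z)"

text \<open>The differential \<open>\<omega>\<^sub>f\<close> of degree \<open>m/2\<close> of a form \<open>f\<close> of even weight \<open>m\<close>.\<close>

definition form_differential :: "mat22 set \<Rightarrow> nat \<Rightarrow> (complex \<Rightarrow> complex) \<Rightarrow> point differential" where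
  "form_differential \<Gamma> m f =
     (THE \<omega>. \<omega> \<in> meromorphic_differentials (atlas \<Gamma>) (m div 2) \<and> has_pullback \<Gamma> (m div 2) \<omega> f)"

section \<open>Modular forms of even weight\<close>

definition cusp_expansion ::
    "nat \<Rightarrow> (complex \<Rightarrow> complex) \<Rightarrow> mat22 \<Rightarrow> real \<Rightarrow> (nat \<Rightarrow> complex) \<Rightarrow> bool" where
  "cusp_expansion m f \<sigma> h a \<longleftrightarrow>
     (\<forall>z \<in> \<H>. (\<lambda>n. a n * exp (2 * of_real pi * \<i> * of_nat n * z / of_real h))
                sums slash m f (matrix_inv \<sigma>) z)"

text \<open>Functions on \<open>\<H>\<close> are extended by \<open>0\<close>.  The expansion in powers of \<open>exp(2\<pi>iz/h)\<close> is the right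
  condition at a cusp for even \<open>m\<close> only (at an irregular cusp and for odd \<open>m\<close> the period is \<open>2h\<close>).\<close>

definition modular_forms :: "mat22 set \<Rightarrow> nat \<Rightarrow> (complex \<Rightarrow> complex) set" where
  "modular_forms \<Gamma> m = {f. f holomorphic_on \<H> \<and> (\<forall>z. z \<notin> \<H> \<longrightarrow> f z = 0) \<and>
     (\<forall>\<gamma> \<in> \<Gamma>. \<forall>z \<in> \<H>. f (moebius \<gamma> z) = cocycle \<gamma> z ^ m * f z) \<and>
     (\<forall>x \<in> cusps \<Gamma>. \<forall>\<sigma> h. cusp_scaling \<Gamma> x \<sigma> h \<longrightarrow> (\<exists>a. cusp_expansion m f \<sigma> h a))}"

definition cusp_forms :: "mat22 set \<Rightarrow> nat \<Rightarrow> (complex \<Rightarrow> complex) set" where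
  "cusp_forms \<Gamma> m = {f \<in> modular_forms \<Gamma> m.
     \<forall>x \<in> cusps \<Gamma>. \<forall>\<sigma> h. cusp_scaling \<Gamma> x \<sigma> h \<longrightarrow> (\<exists>a. cusp_expansion m f \<sigma> h a \<and> a 0 = 0)}"

definition modular_wronskian :: "nat \<Rightarrow> (nat \<Rightarrow> complex \<Rightarrow> complex) \<Rightarrow> complex \<Rightarrow> complex" where
  "modular_wronskian t f = (\<lambda>z. if z \<in> \<H> then local_wronskian t f z else 0)"

section \<open>Divisors\<close>

text \<open>Divisors with rational coefficients are given by their coefficient functions, of which only the
  values at points of the surface matter.\<close>

type_synonym divisor = "point \<Rightarrow> rat"

definition divisor_ge :: "mat22 set \<Rightarrow> divisor \<Rightarrow> divisor \<Rightarrow> bool" where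
  "divisor_ge \<Gamma> d1 d2 \<longleftrightarrow> (\<forall>a \<in> surface \<Gamma>. d1 a - d2 a \<in> \<int> \<and> d1 a - d2 a \<ge> 0)"

definition interior_rep :: "point \<Rightarrow> complex" where
  "interior_rep a = (SOME \<xi>. \<xi> \<in> \<H> \<and> Fin \<xi> \<in> a)"

definition point_order :: "mat22 set \<Rightarrow> point \<Rightarrow> nat" where
  "point_order \<Gamma> a = ellip_order \<Gamma> (interior_rep a)"

definition elliptic_points :: "mat22 set \<Rightarrow> point set" where
  "elliptic_points \<Gamma> = (\<lambda>\<xi>. orbit \<Gamma> (Fin \<xi>)) ` {\<xi> \<in> \<H>. ellip_order \<Gamma> \<xi> > 1}"

text \<open>The order at a cusp does not depend on the choice of the representative \<open>x\<close>, of \<open>\<sigma>\<close> and \<open>h\<close>.\<close>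

definition cusp_order :: "mat22 set \<Rightarrow> nat \<Rightarrow> (complex \<Rightarrow> complex) \<Rightarrow> point \<Rightarrow> nat" where
  "cusp_order \<Gamma> m f b =
     (let (x, \<sigma>, h) = (SOME (x, \<sigma>, h). x \<in> cusps \<Gamma> \<and> x \<in> b \<and> cusp_scaling \<Gamma> x \<sigma> h);
          a = (THE a. cusp_expansion m f \<sigma> h a)
      in LEAST n. a n \<noteq> 0)"

definition div_form :: "mat22 set \<Rightarrow> nat \<Rightarrow> (complex \<Rightarrow> complex) \<Rightarrow> divisor" where
  "div_form \<Gamma> m f a =
     (if a \<in> cusp_points \<Gamma> then of_nat (cusp_order \<Gamma> m f a)
      else of_int (zorder f (interior_rep a)) / of_nat (point_order \<Gamma> a))"

definition elliptic_weight :: "mat22 set \<Rightarrow> nat \<Rightarrow> point \<Rightarrow> rat" where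
  "elliptic_weight \<Gamma> m a = of_nat m / 2 * (1 - 1 / of_nat (point_order \<Gamma> a))"

definition c'_divisor :: "mat22 set \<Rightarrow> nat \<Rightarrow> (complex \<Rightarrow> complex) \<Rightarrow> divisor" where
  "c'_divisor \<Gamma> m f a = div_form \<Gamma> m f a -
     (if a \<in> elliptic_points \<Gamma>
      then elliptic_weight \<Gamma> m a - of_int \<lfloor>elliptic_weight \<Gamma> m a\<rfloor> else 0)"

definition c_divisor :: "mat22 set \<Rightarrow> nat \<Rightarrow> (complex \<Rightarrow> complex) \<Rightarrow> divisor" where
  "c_divisor \<Gamma> m f a = c'_divisor \<Gamma> m f a - (if a \<in> cusp_points \<Gamma> then 1 else 0)"

definition SH_divisor :: "mat22 set \<Rightarrow> nat \<Rightarrow> divisor" where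
  "SH_divisor \<Gamma> m a =
     (if a \<in> elliptic_points \<Gamma> then of_int \<lfloor>elliptic_weight \<Gamma> m a\<rfloor> else 0) +
     (if a \<in> cusp_points \<Gamma> then of_nat m / 2 - 1 else 0)"

definition SH_forms :: "mat22 set \<Rightarrow> nat \<Rightarrow> (complex \<Rightarrow> complex) set" where
  "SH_forms \<Gamma> m = {f \<in> cusp_forms \<Gamma> m. f = 0 \<or> divisor_ge \<Gamma> (c_divisor \<Gamma> m f) (SH_divisor \<Gamma> m)}"

end

theory Submission
  imports Defs
begin

text \<open>
  Forms and differentials correspond to each other by pull-back along the projection from \<open>\<H>\<close> to the
  surface.  In a chart with lifted coordinate \<open>\<Phi>\<close>, a differential of degree \<open>l\<close> with local expression \<open>G\<close>
  pulls back to \<open>f = (G \<circ> \<Phi>) (\<Phi>')\<^sup>l\<close>.  The theorem follows from two facts about this formula.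

  First, pull-back is a linear isomorphism from the holomorphic differentials of degree \<open>l\<close> onto the space
  \<open>SH_forms \<Gamma> (2 * l)\<close> (\<open>pullback_SH\<close>, \<open>SH_is_pullback\<close>, \<open>pullback_inj\<close>), with inverse
  \<open>form_differential\<close> (\<open>form_differential_pullback\<close>).  Where \<open>\<Phi>'\<close> vanishes, or at a cusp, the order of the
  form and that of the differential differ by a known amount: \<open>\<Phi>\<close> is \<open>w\<^sup>e\<close> near an elliptic point and
  \<open>exp (2 \<pi> \<i> \<zeta> / h)\<close> near a cusp.  The divisor condition in the definition of these forms says exactly
  that the order of the differential is non-negative.

  Secondly, if \<open>f\<^sub>j = h \<cdot> (g\<^sub>j \<circ> T)\<close>, then the Wronskian of the \<open>f\<^sub>j\<close> is that of the \<open>g\<^sub>j\<close>, composed with \<open>T\<close> and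
  multiplied by \<open>h\<^sup>t\<close> and by the power of \<open>T'\<close> with exponent \<open>t (t - 1) / 2\<close> (\<open>local_wronskian_mult_compose\<close>).  For a change of
  coordinates \<open>T\<close> and \<open>h = (T')\<^sup>l\<close> this shows that the Wronskian of differentials is a differential of degree
  \<open>l t + t (t - 1) / 2\<close>; for \<open>T = \<Phi>\<close> and \<open>h = (\<Phi>')\<^sup>l\<close> it shows that it pulls back to the Wronskian of the
  forms.  By the first fact, the Wronskian of the forms therefore lies in the space \<open>SH_forms\<close> of its weight.
  It is non-zero because functions on a connected open set with vanishing Wronskian are linearly dependent
  (\<open>local_wronskian_zero_imp_dependent\<close>).

  A point is a Weierstrass point if and only if the Wronskian of the differentials vanishes there, by linear
  algebra (\<open>weierstrass_iff_wronskian\<close>).  At a cusp, the order of a form of weight \<open>2 k\<close> is the order of its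
  differential increased by \<open>k\<close> (\<open>cusp_order_pullback\<close>), whence the two numerical criteria.

  All this rests on the charts of the surface.  Their existence around every point, with explicit
  coordinates, comes from three consequences of discreteness: the action on \<open>\<H>\<close> is properly discontinuous, the
  stabiliser of an interior point acts on the disc coordinate by all roots of unity of its order, and a cusp
  has a horoball that only its stabiliser moves to a set meeting it (\<open>properly_discontinuous\<close>,
  \<open>rotations_of_stab\<close>, \<open>precisely_invariant_horoball\<close>).
\<close>

no_notation fps_nth (infixl \<open>$\<close> 75)

section \<open>Wronskians of holomorphic functions\<close>

lemma local_wronskian_cong:
  assumes "open S" "z \<in> S" "\<And>j w. j < t \<Longrightarrow> w \<in> S \<Longrightarrow> f j w = g j w"
  shows "local_wronskian t f z = local_wronskian t g z"
proof -
  have "(deriv ^^ i) (f j) z = (deriv ^^ i) (g j) z" if "j < t" for i j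
    by (rule higher_deriv_cong_ev)
       (use assms that eventually_nhds_in_open[OF assms(1,2)] in \<open>auto elim!: eventually_mono\<close>)
  then show ?thesis
    unfolding local_wronskian_def by (intro arg_cong[where f = Determinant.det] eq_matI) auto
qed

lemma local_wronskian_holomorphic:
  assumes "open S" "\<And>j. j < t \<Longrightarrow> f j holomorphic_on S"
  shows "local_wronskian t f holomorphic_on S"
proof -
  have eq: "local_wronskian t f =
      (\<lambda>z. \<Sum>p \<in> {p. p permutes {0..<t}}. signof p * (\<Prod>i = 0..<t. (deriv ^^ i) (f (p i)) z))"
    unfolding local_wronskian_def Determinant.det_def
    by (auto simp: fun_eq_iff intro!: sum.cong prod.cong arg_cong2[where f = "(*)"]
      dest: permutes_in_image)
  show ?thesis
    unfolding eq
    by (intro holomorphic_intros holomorphic_higher_deriv)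
       (use assms in \<open>auto dest: permutes_in_image\<close>)
qed

text \<open>The coefficients with which the derivatives of \<open>g\<close> at \<open>T z\<close> enter the derivative of
  order \<open>i\<close> of \<open>h \<cdot> (g \<circ> T)\<close>.  They do not depend on \<open>g\<close> and form a lower triangular matrix,
  which is why a Wronskian transforms by a power of \<open>h\<close> and of \<open>T'\<close> only.\<close>

fun chain_coeff :: "(complex \<Rightarrow> complex) \<Rightarrow> (complex \<Rightarrow> complex) \<Rightarrow> nat \<Rightarrow> nat \<Rightarrow> complex \<Rightarrow> complex" where
  "chain_coeff h T 0 k = (\<lambda>z. if k = 0 then h z else 0)"
| "chain_coeff h T (Suc i) k = (\<lambda>z. deriv (chain_coeff h T i k) z +
     (if k = 0 then 0 else chain_coeff h T i (k - 1) z * deriv T z))"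

lemma chain_coeff_holomorphic:
  assumes "open S" "h holomorphic_on S" "T holomorphic_on S"
  shows "chain_coeff h T i k holomorphic_on S"
proof (induction i arbitrary: k)
  case 0 then show ?case using assms by (cases "k = 0") auto
next
  case (Suc i) then show ?case using assms
    by (cases "k = 0") (auto intro!: holomorphic_intros)
qed

lemma chain_coeff_upper: "i < k \<Longrightarrow> chain_coeff h T i k = (\<lambda>_. 0)"
proof (induction i arbitrary: k)
  case (Suc i)
  then have "chain_coeff h T i k = (\<lambda>_. 0)" "chain_coeff h T i (k - 1) = (\<lambda>_. 0)" by simp_all
  then show ?case using Suc.prems by simp
qed simp

lemma chain_coeff_diag: "chain_coeff h T i i z = h z * deriv T z ^ i"
  by (induction i) (auto simp: chain_coeff_upper algebra_simps)

lemma higher_deriv_mult_compose: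
  assumes "open S" "h holomorphic_on S" "T holomorphic_on S"
    and "open S'" "g holomorphic_on S'" "T ` S \<subseteq> S'" and "z \<in> S"
  shows "(deriv ^^ i) (\<lambda>w. h w * g (T w)) z =
    (\<Sum>k\<le>i. chain_coeff h T i k z * (deriv ^^ k) g (T z))"
  using \<open>z \<in> S\<close>
proof (induction i arbitrary: z)
  case 0 then show ?case by simp
next
  case (Suc i)
  let ?C = "chain_coeff h T" and ?g = "\<lambda>k. (deriv ^^ k) g"
  have "(deriv ^^ Suc i) (\<lambda>w. h w * g (T w)) z = deriv (\<lambda>w. \<Sum>k\<le>i. ?C i k w * ?g k (T w)) z"
    unfolding funpow.simps comp_def
    by (rule deriv_cong_ev)
       (use Suc assms eventually_nhds_in_open[of S z] in \<open>auto elim!: eventually_mono\<close>)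
  also have "\<dots> = (\<Sum>k\<le>i. deriv (?C i k) z * ?g k (T z) + ?C i k z * (?g (Suc k) (T z) * deriv T z))"
  proof (rule DERIV_imp_deriv, rule DERIV_sum)
    fix k
    have 1: "(?C i k has_field_derivative deriv (?C i k) z) (at z)"
      using chain_coeff_holomorphic[OF assms(1-3)] assms Suc.prems holomorphic_derivI by blast
    have 2: "(T has_field_derivative deriv T z) (at z)"
      using assms Suc.prems holomorphic_derivI by blast
    have 3: "(?g k has_field_derivative ?g (Suc k) (T z)) (at (T z))"
      using has_field_derivative_higher_deriv[OF assms(5,4)] Suc.prems assms(6) by blast
    show "((\<lambda>w. ?C i k w * ?g k (T w)) has_field_derivative
        deriv (?C i k) z * ?g k (T z) + ?C i k z * (?g (Suc k) (T z) * deriv T z)) (at z)"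
      using DERIV_mult[OF 1 DERIV_chain2[OF 3 2]] by (simp add: algebra_simps)
  qed
  also have "\<dots> = (\<Sum>k\<le>Suc i. deriv (?C i k) z * ?g k (T z)) +
      (\<Sum>k\<le>i. ?C i k z * deriv T z * ?g (Suc k) (T z))"
    by (simp add: sum.distrib chain_coeff_upper algebra_simps)
  also have "(\<Sum>k\<le>i. ?C i k z * deriv T z * ?g (Suc k) (T z)) =
      (\<Sum>k\<le>Suc i. (if k = 0 then 0 else ?C i (k - 1) z * deriv T z) * ?g k (T z))"
    by (subst sum.atMost_Suc_shift) simp
  finally show ?case by (simp add: sum.distrib algebra_simps)
qed

text \<open>The matrix of derivatives of the functions \<open>h \<cdot> (g\<^sub>j \<circ> T)\<close> is the product of the triangular matrix
  above with the matrix of derivatives of the \<open>g\<^sub>j\<close>, so only its diagonal \<open>h, h T', h T'\<^sup>2, \<dots>\<close> contributes.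
  With \<open>h = T'\<^sup>l\<close> this is the rule by which local Wronskians glue and by which they pull back to \<open>\<H>\<close>.\<close>

lemma local_wronskian_mult_compose:
  assumes "open S" "h holomorphic_on S" "T holomorphic_on S"
    and "open S'" "\<And>j. j < t \<Longrightarrow> g j holomorphic_on S'" "T ` S \<subseteq> S'" and "z \<in> S"
  shows "local_wronskian t (\<lambda>j w. h w * g j (T w)) z =
    h z ^ t * deriv T z ^ (t * (t - 1) div 2) * local_wronskian t g (T z)"
proof -
  define C where "C = Matrix.mat t t (\<lambda>(i, k). chain_coeff h T i k z)"
  define G where "G = Matrix.mat t t (\<lambda>(k, j). (deriv ^^ k) (g j) (T z))"
  have "Matrix.mat t t (\<lambda>(i, j). (deriv ^^ i) (\<lambda>w. h w * g j (T w)) z) = C * G"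
  proof (rule eq_matI)
    fix i j assume ij: "i < dim_row (C * G)" "j < dim_col (C * G)"
    then have "(\<Sum>k\<le>i. chain_coeff h T i k z * (deriv ^^ k) (g j) (T z)) =
        (\<Sum>k = 0..<t. chain_coeff h T i k z * (deriv ^^ k) (g j) (T z))"
      by (intro sum.mono_neutral_left) (auto simp: C_def chain_coeff_upper)
    then show "Matrix.mat t t (\<lambda>(i, j). (deriv ^^ i) (\<lambda>w. h w * g j (T w)) z) $$ (i, j) = (C * G) $$ (i, j)"
      using ij higher_deriv_mult_compose[OF assms(1-4) assms(5) assms(6,7), of j i]
      by (simp add: C_def G_def scalar_prod_def)
  qed (auto simp: C_def G_def)
  moreover have "Determinant.det (C * G) = Determinant.det C * Determinant.det G"
    by (rule det_mult[of _ t]) (auto simp: C_def G_def)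
  moreover have "Determinant.det C = (\<Prod>i = 0..<t. h z * deriv T z ^ i)"
    by (subst det_lower_triangular[of t]) (auto simp: C_def chain_coeff_upper prod_list_diag_prod chain_coeff_diag)
  moreover have "(\<Prod>i = 0..<t. h z * deriv T z ^ i) = h z ^ t * deriv T z ^ (t * (t - 1) div 2)"
    by (simp add: prod.distrib power_sum[symmetric] Sum_Ico_nat)
  ultimately show ?thesis unfolding local_wronskian_def G_def by simp
qed

lemma local_wronskian_one:
  assumes "t = Suc s" "open S" "z \<in> S" "\<And>w. w \<in> S \<Longrightarrow> g 0 w = 1"
  shows "local_wronskian t g z = local_wronskian s (\<lambda>j. deriv (g (Suc j))) z"
proof -
  let ?M = "Matrix.mat t t (\<lambda>(i, j). (deriv ^^ i) (g j) z)"
  have g0: "(deriv ^^ i) (g 0) z = (if i = 0 then 1 else 0)" for i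
  proof -
    have "\<forall>\<^sub>F w in nhds z. g 0 w = 1"
      using eventually_nhds_in_open[OF assms(2,3)] assms(4) by (auto elim!: eventually_mono)
    then have "(deriv ^^ i) (g 0) z = (deriv ^^ i) (\<lambda>_. 1) z" by (rule higher_deriv_cong_ev) simp
    then show ?thesis by (simp add: higher_deriv_const)
  qed
  have "Determinant.det ?M = (\<Sum>i<t. ?M $$ (i, 0) * cofactor ?M i 0)"
    by (rule laplace_expansion_column) (auto simp: assms(1))
  also have "\<dots> = (\<Sum>i\<in>{0}. ?M $$ (i, 0) * cofactor ?M i 0)"
    by (rule sum.mono_neutral_right) (auto simp: assms(1) g0)
  also have "\<dots> = Determinant.det (mat_delete ?M 0 0)"
    using g0[of 0] by (simp add: assms(1) cofactor_def)
  also have "mat_delete ?M 0 0 = Matrix.mat s s (\<lambda>(i, j). (deriv ^^ i) (deriv (g (Suc j))) z)"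
    by (rule eq_matI) (auto simp: mat_delete_def assms(1) funpow_Suc_right simp del: funpow.simps)
  finally show ?thesis unfolding local_wronskian_def .
qed

text \<open>Near a point where \<open>f\<^sub>0\<close> does not vanish, division by \<open>f\<^sub>0\<close> changes the Wronskian by a power of
  \<open>f\<^sub>0\<close> only and turns the first function into \<open>1\<close>.  The Wronskian is then that of the \<open>t - 1\<close>
  derivatives \<open>(f\<^sub>j / f\<^sub>0)'\<close>, to which induction applies; a linear relation between these integrates to
  one between the \<open>f\<^sub>j\<close>, with the constant of integration as the coefficient of \<open>f\<^sub>0\<close>.\<close>

lemma local_wronskian_zero_imp_dependent:
  assumes "open S" "connected S" "S \<noteq> {}" "\<And>j. j < t \<Longrightarrow> f j holomorphic_on S"
    and "\<And>z. z \<in> S \<Longrightarrow> local_wronskian t f z = 0"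
  shows "\<exists>c. (\<exists>j<t. c j \<noteq> 0) \<and> (\<forall>z\<in>S. (\<Sum>j<t. c j * f j z) = 0)"
  using assms
proof (induction t arbitrary: f S)
  case 0
  then show ?case by (auto simp: local_wronskian_def)
next
  case (Suc t)
  show ?case
  proof (cases "\<forall>z\<in>S. f 0 z = 0")
    case True
    then show ?thesis
      by (intro exI[of _ "\<lambda>j. if j = 0 then 1 else 0"]) (auto simp: sum.lessThan_Suc_shift simp del: sum.lessThan_Suc)
  next
    case False
    then obtain z0 where z0: "z0 \<in> S" "f 0 z0 \<noteq> 0" by auto
    have "open (S \<inter> f 0 -` (-{0}))"
      using Suc.prems(1,4) holomorphic_on_imp_continuous_on
      by (intro continuous_open_preimage) auto
    moreover have "z0 \<in> S \<inter> f 0 -` (-{0})" using z0 by auto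
    ultimately obtain r where r: "r > 0" "ball z0 r \<subseteq> S \<inter> f 0 -` (-{0})"
      using open_contains_ball by blast
    define B where "B = ball z0 r"
    have B: "open B" "connected B" "B \<noteq> {}" "B \<subseteq> S" "\<And>z. z \<in> B \<Longrightarrow> f 0 z \<noteq> 0" "z0 \<in> B"
      using r unfolding B_def by (auto simp del: mem_ball)
    define g where "g = (\<lambda>j z. f j z / f 0 z)"
    have fB: "f j holomorphic_on B" if "j < Suc t" for j
      using Suc.prems(4)[OF that] B(4) by (rule holomorphic_on_subset)
    have g: "g j holomorphic_on B" if "j < Suc t" for j
      unfolding g_def by (intro holomorphic_on_divide fB B(5)) (use that in auto)
    have "local_wronskian t (\<lambda>j. deriv (g (Suc j))) z = 0" if z: "z \<in> B" for z
    proof -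
      have "0 = local_wronskian (Suc t) f z" using Suc.prems(5) z B by auto
      also have "\<dots> = local_wronskian (Suc t) (\<lambda>j w. f 0 w * g j ((\<lambda>w. w) w)) z"
        by (rule local_wronskian_cong[OF B(1) z]) (use B in \<open>auto simp: g_def\<close>)
      also have "\<dots> = f 0 z ^ Suc t * deriv (\<lambda>w. w) z ^ (Suc t * (Suc t - 1) div 2) * local_wronskian (Suc t) g z"
        by (rule local_wronskian_mult_compose[where S = B and S' = B])
           (use B(1) z g fB in \<open>simp_all add: holomorphic_on_ident\<close>)
      finally have "local_wronskian (Suc t) g z = 0" using B(5)[OF z] by simp
      then show ?thesis
        using local_wronskian_one[OF refl B(1) z, of g t] B(5) by (simp add: g_def)
    qed
    moreover have "deriv (g (Suc j)) holomorphic_on B" if "j < t" for j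
      by (intro holomorphic_deriv g B(1)) (use that in auto)
    ultimately obtain c where c: "\<exists>j<t. c j \<noteq> 0" "\<And>z. z \<in> B \<Longrightarrow> (\<Sum>j<t. c j * deriv (g (Suc j)) z) = 0"
      using Suc.IH[OF B(1-3), of "\<lambda>j. deriv (g (Suc j))"] by blast
    have "((\<lambda>z. \<Sum>j<t. c j * g (Suc j) z) has_field_derivative 0) (at z within B)" if "z \<in> B" for z
    proof -
      have "((\<lambda>z. \<Sum>j<t. c j * g (Suc j) z) has_field_derivative (\<Sum>j<t. c j * deriv (g (Suc j)) z)) (at z)"
        by (intro DERIV_sum DERIV_cmult holomorphic_derivI[of _ B] that B(1) g) auto
      then show ?thesis using c(2)[OF that] by (simp add: has_field_derivative_at_within)
    qed
    then obtain K where K: "\<And>z. z \<in> B \<Longrightarrow> (\<Sum>j<t. c j * g (Suc j) z) = K"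
      using has_field_derivative_zero_constant[of B "\<lambda>z. \<Sum>j<t. c j * g (Suc j) z"]
      by (auto simp: B_def)
    define d where "d = (\<lambda>j. case j of 0 \<Rightarrow> - K | Suc j \<Rightarrow> c j)"
    have d: "(\<Sum>j<Suc t. d j * f j z) = 0" if "z \<in> B" for z
    proof -
      have "f (Suc j) z = f 0 z * g (Suc j) z" for j using B(5)[OF that] by (simp add: g_def)
      then have "(\<Sum>j<Suc t. d j * f j z) = f 0 z * (- K + (\<Sum>j<t. c j * g (Suc j) z))"
        by (simp only: sum.lessThan_Suc_shift) (simp add: d_def algebra_simps sum_distrib_left)
      then show ?thesis using K[OF that] by simp
    qed
    have "(\<Sum>j<Suc t. d j * f j z) = 0" if "z \<in> S" for z
    proof (rule analytic_continuation[of "\<lambda>z. \<Sum>j<Suc t. d j * f j z" S B z0])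
      show "(\<lambda>z. \<Sum>j<Suc t. d j * f j z) holomorphic_on S"
        by (intro holomorphic_on_sum holomorphic_on_mult holomorphic_on_const Suc.prems(4)) auto
      show "z0 islimpt B" using r(1) by (simp add: B_def islimpt_ball)
    qed (rule Suc.prems(1) Suc.prems(2) B(4) z0(1) d that | assumption)+
    moreover have "\<exists>j<Suc t. d j \<noteq> 0"
    proof -
      obtain j where "j < t" "c j \<noteq> 0" using c(1) by blast
      then show ?thesis by (intro exI[of _ "Suc j"]) (auto simp: d_def)
    qed
    ultimately show ?thesis by blast
  qed
qed

lemma higher_deriv_linear_combination:
  fixes t :: nat
  assumes "open S" "z \<in> S" "\<And>j. j < t \<Longrightarrow> f j holomorphic_on S"
  shows "(deriv ^^ i) (\<lambda>w. \<Sum>j<t. c j * f j w) z = (\<Sum>j<t. c j * (deriv ^^ i) (f j) z)"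
  using assms(3)
proof (induction t)
  case 0 then show ?case by (simp add: higher_deriv_const)
next
  case (Suc t)
  have "(deriv ^^ i) (\<lambda>w. (\<Sum>j<t. c j * f j w) + c t * f t w) z =
      (deriv ^^ i) (\<lambda>w. \<Sum>j<t. c j * f j w) z + (deriv ^^ i) (\<lambda>w. c t * f t w) z"
    by (rule higher_deriv_add) (use assms Suc.prems in \<open>auto intro!: holomorphic_intros\<close>)
  also have "(deriv ^^ i) (\<lambda>w. c t * f t w) z = c t * (deriv ^^ i) (f t) z"
    by (rule higher_deriv_cmult) (use assms Suc.prems in auto)
  finally show ?case using Suc by simp
qed

text \<open>A singular matrix has a non-zero vector in its kernel, here the coefficients of a combination whose
  Taylor expansion starts at order \<open>t\<close> or later.\<close>

lemma local_wronskian_eq_0_iff: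
  assumes "open S" "z \<in> S" "\<And>j. j < t \<Longrightarrow> f j holomorphic_on S"
  shows "local_wronskian t f z = 0 \<longleftrightarrow>
    (\<exists>c. (\<exists>j<t. c j \<noteq> 0) \<and> (\<forall>i<t. (deriv ^^ i) (\<lambda>w. \<Sum>j<t. c j * f j w) z = 0))"
proof -
  let ?M = "Matrix.mat t t (\<lambda>(i, j). (deriv ^^ i) (f j) z)"
  have "local_wronskian t f z = 0 \<longleftrightarrow>
      (\<exists>v. v \<in> carrier_vec t \<and> v \<noteq> 0\<^sub>v t \<and> ?M *\<^sub>v v = 0\<^sub>v t)"
    unfolding local_wronskian_def by (rule det_0_iff_vec_prod_zero_field) auto
  also have "\<dots> \<longleftrightarrow> (\<exists>c. (\<exists>j<t. c j \<noteq> 0) \<and> (\<forall>i<t. (\<Sum>j<t. c j * (deriv ^^ i) (f j) z) = 0))"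
  proof safe
    fix v assume v: "v \<in> carrier_vec t" "v \<noteq> 0\<^sub>v t" "?M *\<^sub>v v = 0\<^sub>v t"
    have "(\<Sum>j<t. Matrix.vec_index v j * (deriv ^^ i) (f j) z) = 0" if "i < t" for i
    proof -
      have "Matrix.vec_index (?M *\<^sub>v v) i = (\<Sum>j<t. Matrix.vec_index v j * (deriv ^^ i) (f j) z)"
        using that v(1) by (auto simp: scalar_prod_def atLeast0LessThan mult.commute intro!: sum.cong)
      then show ?thesis using v(3) that by simp
    qed
    moreover have "\<exists>j<t. Matrix.vec_index v j \<noteq> 0"
      using v(1,2) by (metis carrier_vecD eq_vecI index_zero_vec(1) index_zero_vec(2))
    ultimately show "\<exists>c. (\<exists>j<t. c j \<noteq> 0) \<and> (\<forall>i<t. (\<Sum>j<t. c j * (deriv ^^ i) (f j) z) = 0)" by blast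
  next
    fix c :: "nat \<Rightarrow> complex" and j
    assume c: "\<forall>i<t. (\<Sum>j<t. c j * (deriv ^^ i) (f j) z) = 0" "j < t" "c j \<noteq> 0"
    show "\<exists>v. v \<in> carrier_vec t \<and> v \<noteq> 0\<^sub>v t \<and> ?M *\<^sub>v v = 0\<^sub>v t"
    proof (intro exI conjI)
      show "Matrix.vec t c \<in> carrier_vec t" by simp
      show "Matrix.vec t c \<noteq> 0\<^sub>v t" using c(2,3) by (metis index_vec index_zero_vec(1))
      show "?M *\<^sub>v Matrix.vec t c = 0\<^sub>v t"
        using c(1) by (intro eq_vecI) (auto simp: scalar_prod_def atLeast0LessThan mult.commute)
    qed
  qed
  also have "\<dots> \<longleftrightarrow> (\<exists>c. (\<exists>j<t. c j \<noteq> 0) \<and> (\<forall>i<t. (deriv ^^ i) (\<lambda>w. \<Sum>j<t. c j * f j w) z = 0))"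
    by (simp add: higher_deriv_linear_combination[OF assms])
  finally show ?thesis .
qed

lemma zorder_ge_iff_higher_deriv:
  assumes "open S" "z \<in> S" "f holomorphic_on S" "\<exists>\<^sub>F w in at z. f w \<noteq> 0"
  shows "zorder f z \<ge> int t \<longleftrightarrow> (\<forall>i<t. (deriv ^^ i) f z = 0)"
proof -
  obtain r where r: "r > 0" "ball z r \<subseteq> S" using assms open_contains_ball by blast
  have "\<exists>n. (deriv ^^ n) f z \<noteq> 0"
  proof (rule ccontr)
    assume "\<nexists>n. (deriv ^^ n) f z \<noteq> 0"
    then have "f w = 0" if "w \<in> ball z r" for w
      using holomorphic_fun_eq_0_on_ball[of f z r w] that assms(3) r(2) by (auto intro: holomorphic_on_subset)
    then have "\<forall>\<^sub>F w in at z. f w = 0"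
      using eventually_at_ball[OF r(1), of z UNIV] by (auto elim: eventually_mono)
    then show False using assms(4) by (simp add: frequently_def)
  qed
  then obtain n where n: "(deriv ^^ n) f z \<noteq> 0" "\<And>i. i < n \<Longrightarrow> (deriv ^^ i) f z = 0"
    using exists_least_iff[of "\<lambda>n. (deriv ^^ n) f z \<noteq> 0"] by auto
  have "zorder f z = int n"
    by (rule zorder_zero_eqI[OF assms(3,1,2)]) (use n in auto)
  then have "zorder f z \<ge> int t \<longleftrightarrow> t \<le> n" by simp
  also have "\<dots> \<longleftrightarrow> (\<forall>i<t. (deriv ^^ i) f z = 0)" using n by (meson linorder_not_le order_less_le_trans)
  finally show ?thesis .
qed

section \<open>Descending functions along holomorphic maps\<close>

text \<open>A function that becomes holomorphic after composition with a local biholomorphism is holomorphic.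
  Coordinate changes, local expressions of differentials and functions of the exponential coordinate
  at a cusp are all obtained in this way.\<close>

lemma holomorphic_descend:
  assumes "open P" "\<Phi> holomorphic_on P" "\<And>z. z \<in> P \<Longrightarrow> deriv \<Phi> z \<noteq> 0"
    and "k holomorphic_on P" "\<And>z. z \<in> P \<Longrightarrow> G (\<Phi> z) = k z"
  shows "open (\<Phi> ` P)" "G holomorphic_on \<Phi> ` P"
proof -
  have *: "\<exists>B \<subseteq> \<Phi> ` P. \<Phi> z \<in> B \<and> open B \<and> G holomorphic_on B" if z: "z \<in> P" for z
  proof -
    obtain r where r: "r > 0" "ball z r \<subseteq> P" "inj_on \<Phi> (ball z r)"
      using has_complex_derivative_locally_injective[OF assms(2) z assms(1) assms(3)[OF z]] by blast
    have hol: "\<Phi> holomorphic_on ball z r" using assms(2) r(2) by (rule holomorphic_on_subset)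
    have op: "open (\<Phi> ` ball z r)" by (rule open_mapping_thm3[OF hol open_ball r(3)])
    obtain g where g: "g holomorphic_on \<Phi> ` ball z r" "\<And>w. w \<in> ball z r \<Longrightarrow> g (\<Phi> w) = w"
      using holomorphic_has_inverse[OF hol open_ball r(3)] by metis
    have "k \<circ> g holomorphic_on \<Phi> ` ball z r"
      by (rule holomorphic_on_compose_gen[OF g(1) assms(4)]) (use g(2) r(2) in auto)
    moreover have "(k \<circ> g) u = G u" if "u \<in> \<Phi> ` ball z r" for u
      using that g(2) r(2) assms(5) by auto
    ultimately have "G holomorphic_on \<Phi> ` ball z r" by (rule holomorphic_transform)
    then show ?thesis using op r by (intro exI[of _ "\<Phi> ` ball z r"]) auto
  qed
  then show op: "open (\<Phi> ` P)"
    by (subst open_subopen) blast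
  show "G holomorphic_on \<Phi> ` P"
    using * holomorphic_on_imp_differentiable_at
    by (auto simp: holomorphic_on_open[OF op] field_differentiable_def) (metis field_differentiable_def)
qed

lemma holomorphic_fill_puncture:
  assumes "G holomorphic_on ball 0 R - {0}" "(G \<longlongrightarrow> L) (at 0)"
  shows "(\<lambda>u. if u = 0 then L else G u) holomorphic_on ball 0 R"
proof (rule no_isolated_singularity[of _ _ "{0}"])
  let ?G = "\<lambda>u. if u = 0 then L else G u"
  show hol: "?G holomorphic_on ball 0 R - {0}"
    using assms(1) by (rule holomorphic_transform) auto
  have "isCont ?G u" if "u \<in> ball 0 R" for u
  proof (cases "u = 0")
    case True
    have "(?G \<longlongrightarrow> L) (at 0)"
      using assms(2) by (rule Lim_transform_eventually) (auto simp: eventually_at_filter)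
    then show ?thesis using True by (simp add: isCont_def)
  next
    case False
    have "continuous_on (ball 0 R - {0}) ?G" using hol by (rule holomorphic_on_imp_continuous_on)
    moreover have "open (ball 0 R - {0::complex})" by (intro open_delete open_ball)
    ultimately show ?thesis using False that by (subst (asm) continuous_on_eq_continuous_at) blast+
  qed
  then show "continuous_on (ball 0 R) ?G" by (intro continuous_at_imp_continuous_on) blast
qed auto

text \<open>Identities between local expressions are checked away from the centre of a chart, where the lifted
  coordinate has a non-zero derivative, and extended to the centre by continuity.\<close>

lemma continuous_on_eq_off_point:
  fixes f g :: "complex \<Rightarrow> complex"
  assumes "open S" "continuous_on S f" "continuous_on S g" "\<And>u. u \<in> S \<Longrightarrow> u \<noteq> p \<Longrightarrow> f u = g u"
    and "u \<in> S"
  shows "f u = g u"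
proof (cases "u = p")
  case True
  have lim: "f \<midarrow>u\<rightarrow> f u" "g \<midarrow>u\<rightarrow> g u"
    using assms(2,3,5) continuous_on_eq_continuous_at[OF assms(1)] isCont_def by blast+
  have "\<forall>\<^sub>F v in at u. f v = g v"
    using eventually_at_in_open[OF assms(1,5)] assms(4) True by (auto elim!: eventually_mono)
  then have "g \<midarrow>u\<rightarrow> f u" by (rule Lim_transform_eventually[OF lim(1)])
  then show ?thesis using tendsto_unique[OF trivial_limit_at lim(2)] by simp
qed (use assms in simp)

section \<open>The exponential coordinate on a horoball\<close>

definition qexp :: "real \<Rightarrow> complex \<Rightarrow> complex" where
  "qexp h z = exp (2 * of_real pi * \<i> * z / of_real h)"

lemma qexp_nonzero [simp]: "qexp h z \<noteq> 0"
  by (simp add: qexp_def)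

lemma norm_qexp: "norm (qexp h z) = exp (- (2 * pi * Im z / h))"
  by (simp add: qexp_def norm_exp_eq_Re Re_divide_of_real)

lemma qexp_power: "qexp h z ^ n = exp (2 * of_real pi * \<i> * of_nat n * z / of_real h)"
  by (simp add: qexp_def exp_of_nat_mult[symmetric] algebra_simps)

lemma has_field_derivative_qexp:
  assumes "h > 0"
  shows "(qexp h has_field_derivative 2 * of_real pi * \<i> / of_real h * qexp h z) (at z)"
  unfolding qexp_def[abs_def] using assms by (auto intro!: derivative_eq_intros)

lemma qexp_eq_iff:
  assumes "h > 0"
  shows "qexp h z = qexp h z' \<longleftrightarrow> (\<exists>n::int. z' = z + of_real (of_int n * h))"
proof -
  have "qexp h z' = qexp h z \<longleftrightarrow>
      (\<exists>n::int. 2 * of_real pi * \<i> * z' / of_real h = 2 * of_real pi * \<i> * z / of_real h + of_int (2 * n) * of_real pi * \<i>)"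
    unfolding qexp_def by (subst exp_eq) auto
  also have "\<dots> \<longleftrightarrow> (\<exists>n::int. z' = z + of_real (of_int n * h))"
  proof (intro ex_cong1)
    fix n :: int
    have "2 * of_real pi * \<i> * z' / of_real h = 2 * of_real pi * \<i> * z / of_real h + of_int (2 * n) * of_real pi * \<i>
       \<longleftrightarrow> (2 * of_real pi * \<i> / of_real h) * z' = (2 * of_real pi * \<i> / of_real h) * (z + of_real (of_int n * h))"
      using assms by (simp add: field_simps)
    also have "\<dots> \<longleftrightarrow> z' = z + of_real (of_int n * h)"
      using assms by (subst mult_cancel_left) auto
    finally show "2 * of_real pi * \<i> * z' / of_real h = 2 * of_real pi * \<i> * z / of_real h + of_int (2 * n) * of_real pi * \<i>
       \<longleftrightarrow> z' = z + of_real (of_int n * h)" .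
  qed
  finally show ?thesis by auto
qed

lemma qexp_surj:
  assumes "h > 0" "u \<noteq> 0" "norm u < exp (- (2 * pi * T / h))"
  obtains z where "qexp h z = u" "Im z > T"
proof -
  define z where "z = of_real h * Ln u / (2 * of_real pi * \<i>)"
  have q: "qexp h z = u" using assms(1,2) by (simp add: qexp_def z_def)
  have "exp (- (2 * pi * Im z / h)) < exp (- (2 * pi * T / h))"
    using assms(3) norm_qexp[of h z] by (simp add: q)
  then have "2 * pi * T / h < 2 * pi * Im z / h" by simp
  then have "2 * pi * T < 2 * pi * Im z" using assms(1) by (simp add: divide_less_cancel)
  then have "Im z > T" by simp
  with q show ?thesis by (rule that)
qed

text \<open>Two points with the same image under \<open>qexp h\<close> differ by a period.\<close>

lemma periodic_descend:
  assumes "h > 0" "F holomorphic_on {z. Im z > 0}"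
    and per: "\<And>z. Im z > 0 \<Longrightarrow> F (z + of_real h) = F z"
  obtains G where "G holomorphic_on ball 0 1 - {0}" "\<And>z. Im z > 0 \<Longrightarrow> G (qexp h z) = F z"
proof -
  let ?H = "{z. Im z > 0}"
  define G where "G = (\<lambda>u. F (SOME z. z \<in> ?H \<and> qexp h z = u))"
  have pern: "F (z + of_real (of_nat n * h)) = F z" if "Im z > 0" for z and n :: nat
  proof (induction n)
    case (Suc n)
    then show ?case using per[of "z + of_real (of_nat n * h)"] that by (simp add: algebra_simps)
  qed simp
  have peri: "F (z + of_real (of_int n * h)) = F z" if "Im z > 0" for z and n :: int
  proof (cases "n \<ge> 0")
    case True
    then have n: "of_int n = (of_nat (nat n) :: real)" by simp
    show ?thesis unfolding n by (rule pern[OF that])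
  next
    case False
    then have n: "of_int n = - (of_nat (nat (- n)) :: real)" by simp
    have "F (z + of_real (of_int n * h) + of_real (of_nat (nat (- n)) * h)) = F (z + of_real (of_int n * h))"
      by (rule pern) (use that in simp)
    moreover have "z + of_real (of_int n * h) + of_real (of_nat (nat (- n)) * h) = z"
      unfolding n by simp
    ultimately show ?thesis by metis
  qed
  have G: "G (qexp h z) = F z" if "Im z > 0" for z
  proof -
    let ?w = "SOME w. w \<in> ?H \<and> qexp h w = qexp h z"
    have "?w \<in> ?H \<and> qexp h ?w = qexp h z" by (rule someI[of _ z]) (use that in simp)
    then have "qexp h z = qexp h ?w" by simp
    then obtain n :: int where n: "?w = z + of_real (of_int n * h)"
      unfolding qexp_eq_iff[OF assms(1)] by blast
    have "G (qexp h z) = F ?w" by (simp only: G_def)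
    also have "\<dots> = F z" unfolding n by (rule peri[OF that])
    finally show ?thesis .
  qed
  have "qexp h ` ?H = ball 0 1 - {0}"
  proof (intro equalityI subsetI)
    fix u assume "u \<in> qexp h ` ?H"
    then show "u \<in> ball 0 1 - {0}" using assms(1) by (auto simp: norm_qexp)
  next
    fix u :: complex assume "u \<in> ball 0 1 - {0}"
    then obtain z where "qexp h z = u" "Im z > 0" using qexp_surj[OF assms(1), of u 0] by auto
    then show "u \<in> qexp h ` ?H" by blast
  qed
  moreover have "open ?H" by (simp add: open_halfspace_Im_gt)
  moreover have "qexp h holomorphic_on ?H"
    using has_field_derivative_qexp[OF assms(1)] by (auto simp: holomorphic_on_open[OF \<open>open ?H\<close>])
  moreover have "deriv (qexp h) z \<noteq> 0" for z
    using DERIV_imp_deriv[OF has_field_derivative_qexp[OF assms(1), of z]] assms(1) by simp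
  ultimately have "G holomorphic_on ball 0 1 - {0}"
    using holomorphic_descend(2)[of ?H "qexp h" F G] assms(2) G by auto
  then show ?thesis using that G by blast
qed

section \<open>The action of \<open>SL\<^sub>2(\<real>)\<close>\<close>

abbreviation SL :: "mat22 set" where "SL \<equiv> carrier SL2R"

lemma SL_iff: "A \<in> SL \<longleftrightarrow> A$1$1 * A$2$2 - A$1$2 * A$2$1 = 1"
  by (simp add: SL2R_def det_2)

lemma mat22_eq_iff: "(A::mat22) = B \<longleftrightarrow> A$1$1 = B$1$1 \<and> A$1$2 = B$1$2 \<and> A$2$1 = B$2$1 \<and> A$2$2 = B$2$2"
proof -
  have "A = B \<longleftrightarrow> (\<forall>i j. A$i$j = B$i$j)" by (simp add: Finite_Cartesian_Product.vec_eq_iff)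
  then show ?thesis unfolding forall_2 by blast
qed

lemma mult22 [simp]:
  fixes A B :: mat22
  shows "(A ** B)$1$1 = A$1$1 * B$1$1 + A$1$2 * B$2$1" "(A ** B)$1$2 = A$1$1 * B$1$2 + A$1$2 * B$2$2"
    "(A ** B)$2$1 = A$2$1 * B$1$1 + A$2$2 * B$2$1" "(A ** B)$2$2 = A$2$1 * B$1$2 + A$2$2 * B$2$2"
  by (simp_all add: matrix_matrix_mult_def sum_2)

lemma one22 [simp]:
  "(Finite_Cartesian_Product.mat 1 :: mat22)$1$1 = 1" "(Finite_Cartesian_Product.mat 1 :: mat22)$1$2 = 0"
  "(Finite_Cartesian_Product.mat 1 :: mat22)$2$1 = 0" "(Finite_Cartesian_Product.mat 1 :: mat22)$2$2 = 1"
  by (simp_all add: Finite_Cartesian_Product.mat_def)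

text \<open>The inverse on \<open>SL\<^sub>2(\<real>)\<close>.  Its entries are those of the matrix up to order and sign, so that bounds
  on entries pass to inverses.\<close>

definition adj22 :: "mat22 \<Rightarrow> mat22" where
  "adj22 A = vector [vector [A$2$2, - A$1$2], vector [- A$2$1, A$1$1]]"

lemma adj22_entries [simp]:
  "adj22 A$1$1 = A$2$2" "adj22 A$1$2 = - A$1$2" "adj22 A$2$1 = - A$2$1" "adj22 A$2$2 = A$1$1"
  by (simp_all add: adj22_def)

lemma translation22 [simp]:
  "translation b$1$1 = 1" "translation b$1$2 = b" "translation b$2$1 = 0" "translation b$2$2 = 1"
  by (simp_all add: translation_def)

lemma one_SL [simp]: "Finite_Cartesian_Product.mat 1 \<in> SL"
  and translation_SL [simp]: "translation b \<in> SL"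
  and adj22_SL [simp]: "A \<in> SL \<Longrightarrow> adj22 A \<in> SL"
  and uminus_SL [simp]: "A \<in> SL \<Longrightarrow> - A \<in> SL"
  by (simp_all add: SL_iff algebra_simps)

lemma mult_SL [simp]:
  assumes "A \<in> SL" "B \<in> SL"
  shows "A ** B \<in> SL"
  using assms det_mul[of A B] by (simp add: SL2R_def)

lemma adj22_mult:
  assumes "A \<in> SL"
  shows "adj22 A ** A = Finite_Cartesian_Product.mat 1" "A ** adj22 A = Finite_Cartesian_Product.mat 1"
  using assms by (simp_all add: mat22_eq_iff SL_iff algebra_simps)

lemma adj22_unique:
  assumes "A \<in> SL" "A ** B = Finite_Cartesian_Product.mat 1"
  shows "B = adj22 A"
  using arg_cong[OF assms(2), of "\<lambda>C. adj22 A ** C"] adj22_mult[OF assms(1)]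
  by (simp add: matrix_mul_assoc)

lemma matrix_inv_SL:
  assumes "A \<in> SL"
  shows "matrix_inv A = adj22 A"
proof -
  have "\<exists>B. A ** B = Finite_Cartesian_Product.mat 1 \<and> B ** A = Finite_Cartesian_Product.mat 1"
    using adj22_mult[OF assms] by blast
  from someI_ex[OF this] have "A ** matrix_inv A = Finite_Cartesian_Product.mat 1"
    by (simp add: matrix_inv_def)
  then show ?thesis using adj22_unique[OF assms] by blast
qed

lemma inv_SL2R:
  assumes "A \<in> SL"
  shows "inv\<^bsub>SL2R\<^esub> A = adj22 A"
proof -
  have 1: "B \<otimes>\<^bsub>SL2R\<^esub> C = B ** C" "\<one>\<^bsub>SL2R\<^esub> = Finite_Cartesian_Product.mat 1" for B C
    by (simp_all add: SL2R_def)
  show ?thesis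
    unfolding m_inv_def 1
  proof (rule the_equality)
    show "adj22 A \<in> SL \<and> A ** adj22 A = Finite_Cartesian_Product.mat 1 \<and> adj22 A ** A = Finite_Cartesian_Product.mat 1"
      using adj22_mult[OF assms] adj22_SL[OF assms] by (intro conjI)
  next
    fix B assume "B \<in> SL \<and> A ** B = Finite_Cartesian_Product.mat 1 \<and> B ** A = Finite_Cartesian_Product.mat 1"
    then show "B = adj22 A" using adj22_unique[OF assms] by (elim conjE)
  qed
qed

lemma conj_adj22:
  assumes "\<sigma> \<in> SL"
  shows "adj22 \<sigma> ** (\<sigma> ** A) = A" "\<sigma> ** (adj22 \<sigma> ** A) = A"
    "A ** \<sigma> ** adj22 \<sigma> = A" "A ** adj22 \<sigma> ** \<sigma> = A"
proof -
  show "adj22 \<sigma> ** (\<sigma> ** A) = A" "\<sigma> ** (adj22 \<sigma> ** A) = A"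
    unfolding matrix_mul_assoc adj22_mult[OF assms] by (rule matrix_mul_lid)+
  show "A ** \<sigma> ** adj22 \<sigma> = A" "A ** adj22 \<sigma> ** \<sigma> = A"
    unfolding matrix_mul_assoc[symmetric] adj22_mult[OF assms] by (rule matrix_mul_rid)+
qed

lemma plus_minus_one_iff:
  "A \<in> plus_minus_one \<longleftrightarrow> A$1$2 = 0 \<and> A$2$1 = 0 \<and> A$1$1 = A$2$2 \<and> \<bar>A$1$1\<bar> = 1"
  by (auto simp: plus_minus_one_def mat22_eq_iff)

lemma plus_minus_one_mult:
  fixes A :: mat22
  assumes "\<epsilon> \<in> plus_minus_one"
  shows "\<epsilon> ** A = A \<or> \<epsilon> ** A = - A"
proof -
  from assms consider "\<epsilon> = Finite_Cartesian_Product.mat 1" | "\<epsilon> = - Finite_Cartesian_Product.mat 1"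
    unfolding plus_minus_one_def by blast
  then show ?thesis
  proof cases
    case 2
    then have "\<epsilon> ** A = - A" by (subst mat22_eq_iff) simp
    then show ?thesis by blast
  qed (simp add: matrix_mul_lid)
qed

subsection \<open>Moebius transformations\<close>

lemma upper_half_plane_iff: "z \<in> \<H> \<longleftrightarrow> Im z > 0"
  by (simp add: upper_half_plane_def)

lemma open_upper_half_plane [simp]: "open \<H>"
  by (simp add: upper_half_plane_def open_halfspace_Im_gt)

lemma connected_upper_half_plane: "connected \<H>"
  unfolding upper_half_plane_def by (intro convex_connected convex_halfspace_Im_gt)

lemma cocycle_nonzero:
  assumes "A \<in> SL" "Im z \<noteq> 0"
  shows "cocycle A z \<noteq> 0"
proof
  assume 0: "cocycle A z = 0"
  then have "Im (cocycle A z) = 0" "Re (cocycle A z) = 0" by simp_all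
  then show False using assms by (auto simp: cocycle_def SL_iff)
qed

lemma cocycle_mult:
  assumes "cocycle B z \<noteq> 0"
  shows "cocycle (A ** B) z = cocycle A (moebius B z) * cocycle B z"
  using assms by (simp add: cocycle_def moebius_def field_simps)

lemma moebius_mult:
  assumes "cocycle B z \<noteq> 0"
  shows "moebius (A ** B) z = moebius A (moebius B z)"
proof -
  have n: "moebius B z * cocycle B z = of_real (B$1$1) * z + of_real (B$1$2)"
    using assms by (simp add: moebius_def)
  have "(of_real (A$1$1) * moebius B z + of_real (A$1$2)) * cocycle B z =
      of_real (A$1$1) * (moebius B z * cocycle B z) + of_real (A$1$2) * cocycle B z"
    by (simp add: algebra_simps)
  also have "\<dots> = of_real ((A ** B)$1$1) * z + of_real ((A ** B)$1$2)"
    unfolding n by (simp add: cocycle_def algebra_simps)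
  finally have n': "(of_real (A$1$1) * moebius B z + of_real (A$1$2)) * cocycle B z =
      of_real ((A ** B)$1$1) * z + of_real ((A ** B)$1$2)" .
  have "moebius A (moebius B z) =
      ((of_real (A$1$1) * moebius B z + of_real (A$1$2)) * cocycle B z) / (cocycle A (moebius B z) * cocycle B z)"
    using assms by (simp add: moebius_def[of A])
  also have "\<dots> = moebius (A ** B) z"
    unfolding cocycle_mult[OF assms, symmetric] n' by (simp only: moebius_def[of "A ** B"])
  finally show ?thesis by simp
qed

lemma SL_complex:
  assumes "A \<in> SL"
  shows "of_real (A$1$1) * of_real (A$2$2) - of_real (A$1$2) * of_real (A$2$1) = (1::complex)"
proof -
  have "complex_of_real (A$1$1 * A$2$2 - A$1$2 * A$2$1) = of_real 1"
    using assms by (simp only: SL_iff)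
  then show ?thesis by (simp only: of_real_diff of_real_mult of_real_1)
qed

lemma moebius_diff:
  assumes "A \<in> SL" "cocycle A z \<noteq> 0" "cocycle A w \<noteq> 0"
  shows "moebius A z - moebius A w = (z - w) / (cocycle A z * cocycle A w)"
proof -
  note SL_complex[OF assms(1)]
  moreover have "(of_real (A$1$1) * z + of_real (A$1$2)) * cocycle A w -
      (of_real (A$1$1) * w + of_real (A$1$2)) * cocycle A z =
      (of_real (A$1$1) * of_real (A$2$2) - of_real (A$1$2) * of_real (A$2$1)) * (z - w)"
    by (simp add: cocycle_def algebra_simps)
  ultimately have "(of_real (A$1$1) * z + of_real (A$1$2)) * cocycle A w -
      (of_real (A$1$1) * w + of_real (A$1$2)) * cocycle A z = z - w"
    by (metis mult_1)
  then show ?thesis unfolding moebius_def diff_frac_eq[OF assms(2,3)] by simp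
qed

lemma Im_moebius:
  assumes "A \<in> SL" "Im z \<noteq> 0"
  shows "Im (moebius A z) = Im z / (norm (cocycle A z))\<^sup>2"
proof -
  have c: "cocycle A (cnj z) = cnj (cocycle A z)" by (simp add: cocycle_def)
  have m: "moebius A (cnj z) = cnj (moebius A z)" by (simp add: moebius_def c)
  have "moebius A z - cnj (moebius A z) = (z - cnj z) / (cocycle A z * cnj (cocycle A z))"
    unfolding m[symmetric] c[symmetric] by (rule moebius_diff) (use assms cocycle_nonzero in auto)
  also have "cocycle A z * cnj (cocycle A z) = of_real ((norm (cocycle A z))\<^sup>2)"
    by (metis complex_norm_square)
  finally have "Im (moebius A z - cnj (moebius A z)) = Im ((z - cnj z) / of_real ((norm (cocycle A z))\<^sup>2))" by simp
  then show ?thesis by (simp add: Im_divide_of_real)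
qed

lemma moebius_in_H [simp]:
  assumes "A \<in> SL" "z \<in> \<H>"
  shows "moebius A z \<in> \<H>"
  using assms Im_moebius[of A z] cocycle_nonzero[of A z] by (simp add: upper_half_plane_iff)

lemma cocycle_H [simp]: "A \<in> SL \<Longrightarrow> z \<in> \<H> \<Longrightarrow> cocycle A z \<noteq> 0"
  using cocycle_nonzero by (simp add: upper_half_plane_iff)

lemma moebius_one [simp]: "moebius (Finite_Cartesian_Product.mat 1) z = z"
  by (simp add: moebius_def cocycle_def)

lemma moebius_translation [simp]: "moebius (translation b) z = z + of_real b"
  by (simp add: moebius_def cocycle_def)

lemma cocycle_translation [simp]: "cocycle (translation b) z = 1"
  by (simp add: cocycle_def)

lemma moebius_uminus [simp]: "moebius (- A) z = moebius A z"
proof -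
  have "moebius (- A) z = - (of_real (A$1$1) * z + of_real (A$1$2)) / - cocycle A z"
    by (simp add: moebius_def cocycle_def)
  then show ?thesis unfolding minus_divide_divide by (simp add: moebius_def)
qed

lemma moebius_adj22 [simp]:
  assumes "A \<in> SL" "z \<in> \<H>"
  shows "moebius (adj22 A) (moebius A z) = z" "moebius A (moebius (adj22 A) z) = z"
  using moebius_mult[of A z "adj22 A"] moebius_mult[of "adj22 A" z A] assms adj22_mult[OF assms(1)]
  by auto

lemma has_field_derivative_moebius:
  assumes "A \<in> SL" "cocycle A z \<noteq> 0"
  shows "(moebius A has_field_derivative 1 / (cocycle A z)\<^sup>2) (at z)"
proof -
  note SL_complex[OF assms(1)]
  then have "of_real (A$1$1) * cocycle A z - (of_real (A$1$1) * z + of_real (A$1$2)) * of_real (A$2$1) = (1::complex)"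
    by (simp add: cocycle_def algebra_simps)
  moreover have "(moebius A has_field_derivative
     (of_real (A$1$1) * cocycle A z - (of_real (A$1$1) * z + of_real (A$1$2)) * of_real (A$2$1)) / (cocycle A z * cocycle A z)) (at z)"
    unfolding moebius_def[abs_def] using assms(2)
    by (auto intro!: derivative_eq_intros simp: cocycle_def)
  ultimately show ?thesis by (simp add: power2_eq_square)
qed

lemma moebius_holomorphic: "A \<in> SL \<Longrightarrow> moebius A holomorphic_on \<H>"
  unfolding holomorphic_on_open[OF open_upper_half_plane]
  using has_field_derivative_moebius[OF _ cocycle_H] by blast

subsection \<open>The action on the extended plane\<close>

lemma emoebius_H [simp]: "A \<in> SL \<Longrightarrow> z \<in> \<H> \<Longrightarrow> emoebius A (Fin z) = Fin (moebius A z)"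
  by simp

lemma emoebius_one [simp]: "emoebius (Finite_Cartesian_Product.mat 1) x = x"
  by (cases x) (simp_all add: cocycle_def)

lemma emoebius_uminus [simp]: "emoebius (- A) x = emoebius A x"
proof -
  have "cocycle (- A) z = - cocycle A z" for z by (simp add: cocycle_def)
  then show ?thesis by (cases x) simp_all
qed

lemma emoebius_mult:
  assumes A: "A \<in> SL" and B: "B \<in> SL"
  shows "emoebius (A ** B) x = emoebius A (emoebius B x)"
proof (cases x)
  case (Fin z)
  show ?thesis
  proof (cases "cocycle B z = 0")
    case False
    then show ?thesis using Fin by (simp add: cocycle_mult moebius_mult)
  next
    case True
    let ?n = "of_real (B$1$1) * z + of_real (B$1$2) :: complex"
    note SL_complex[OF B]
    moreover have "of_real (B$1$1) * of_real (B$2$2) - of_real (B$1$2) * of_real (B$2$1) =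
        of_real (B$1$1) * cocycle B z - of_real (B$2$1) * ?n"
      by (simp add: cocycle_def algebra_simps)
    ultimately have n: "?n \<noteq> 0" using True by auto
    have c: "cocycle (A ** B) z = of_real (A$2$1) * ?n + of_real (A$2$2) * cocycle B z"
      "of_real ((A ** B)$1$1) * z + of_real ((A ** B)$1$2) = of_real (A$1$1) * ?n + of_real (A$1$2) * cocycle B z"
      by (simp_all add: cocycle_def algebra_simps)
    show ?thesis
      using Fin True n by (simp add: moebius_def[of "A ** B"] c del: mult22)
  qed
next
  case Infty
  show ?thesis
  proof (cases "B$2$1 = 0")
    case True
    then have "B$1$1 \<noteq> 0" using B by (auto simp: SL_iff)
    then show ?thesis using Infty True by simp
  next
    case False
    have "cocycle A (of_real (B$1$1 / B$2$1)) = of_real ((A ** B)$2$1 / B$2$1)"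
      using False by (simp add: cocycle_def field_simps)
    moreover have "moebius A (of_real (B$1$1 / B$2$1)) = of_real (((A ** B)$1$1 / B$2$1) / ((A ** B)$2$1 / B$2$1))"
      unfolding moebius_def calculation using False by (simp add: field_simps)
    ultimately show ?thesis using Infty False by (simp del: mult22)
  qed
qed

lemma emoebius_adj22 [simp]:
  assumes "A \<in> SL"
  shows "emoebius (adj22 A) (emoebius A x) = x" "emoebius A (emoebius (adj22 A) x) = x"
  using emoebius_mult[of A "adj22 A" x] emoebius_mult[of "adj22 A" A x] assms adj22_mult[OF assms]
  by auto

definition boundary :: "ecomplex set" where
  "boundary = {x. x = Infty \<or> (\<exists>r::real. x = Fin (of_real r))}"

lemma emoebius_boundary:
  assumes "x \<in> boundary"
  shows "emoebius A x \<in> boundary"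
proof (cases x)
  case (Fin z)
  then obtain r :: real where r: "z = of_real r" using assms by (auto simp: boundary_def)
  define s where "s = (A$1$1 * r + A$1$2) / (A$2$1 * r + A$2$2)"
  have "moebius A z = of_real s"
    by (simp add: r moebius_def cocycle_def s_def)
  then show ?thesis using Fin by (auto simp: boundary_def)
next
  case Infty
  then show ?thesis by (auto simp: boundary_def simp del: of_real_divide)
qed

lemma boundary_H: "Fin z \<in> boundary \<Longrightarrow> z \<notin> \<H>"
  by (auto simp: boundary_def upper_half_plane_iff)

subsection \<open>The disc coordinate at a point of the upper half plane\<close>

text \<open>A biholomorphic map of \<open>\<H>\<close> onto the unit disc that takes \<open>\<xi>\<close> to \<open>0\<close>.\<close>

definition cayley :: "complex \<Rightarrow> complex \<Rightarrow> complex" where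
  "cayley \<xi> z = (z - \<xi>) / (z - cnj \<xi>)"

lemma cayley_denom: "z \<in> \<H> \<Longrightarrow> \<xi> \<in> \<H> \<Longrightarrow> z - cnj \<xi> \<noteq> 0"
  by (auto simp: upper_half_plane_iff complex_eq_iff)

lemma cayley_self [simp]: "cayley \<xi> \<xi> = 0"
  by (simp add: cayley_def)

lemma cayley_eq_0: "z \<in> \<H> \<Longrightarrow> \<xi> \<in> \<H> \<Longrightarrow> cayley \<xi> z = 0 \<longleftrightarrow> z = \<xi>"
  using cayley_denom by (simp add: cayley_def)

lemma has_field_derivative_cayley:
  assumes "z \<in> \<H>" "\<xi> \<in> \<H>"
  shows "(cayley \<xi> has_field_derivative (\<xi> - cnj \<xi>) / (z - cnj \<xi>)\<^sup>2) (at z)"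
  unfolding cayley_def[abs_def] using cayley_denom[OF assms]
  by (auto intro!: derivative_eq_intros simp: power2_eq_square)

lemma deriv_cayley_nonzero:
  assumes "z \<in> \<H>" "\<xi> \<in> \<H>"
  shows "deriv (cayley \<xi>) z \<noteq> 0"
proof -
  have "\<xi> - cnj \<xi> \<noteq> 0" using assms(2) by (rule cayley_denom[rotated]) fact
  then show ?thesis
    using DERIV_imp_deriv[OF has_field_derivative_cayley[OF assms]] cayley_denom[OF assms] by simp
qed

lemma cayley_holomorphic: "\<xi> \<in> \<H> \<Longrightarrow> cayley \<xi> holomorphic_on \<H>"
  unfolding holomorphic_on_open[OF open_upper_half_plane]
  using has_field_derivative_cayley by blast

lemma norm_cayley_less_1:
  assumes "z \<in> \<H>" "\<xi> \<in> \<H>"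
  shows "norm (cayley \<xi> z) < 1"
proof -
  have "(Im z - Im \<xi>)\<^sup>2 < (Im z + Im \<xi>)\<^sup>2"
    using assms by (simp add: upper_half_plane_iff power2_eq_square algebra_simps)
  then have "(norm (z - \<xi>))\<^sup>2 < (norm (z - cnj \<xi>))\<^sup>2"
    by (simp add: cmod_power2)
  then have "norm (z - \<xi>) < norm (z - cnj \<xi>)" by (rule power_less_imp_less_base) simp
  then show ?thesis using cayley_denom[OF assms] by (simp add: cayley_def norm_divide)
qed

lemma cayley_inject:
  assumes "z \<in> \<H>" "z' \<in> \<H>" "\<xi> \<in> \<H>" "cayley \<xi> z = cayley \<xi> z'"
  shows "z = z'"
proof -
  have "(z - \<xi>) * (z' - cnj \<xi>) = (z' - \<xi>) * (z - cnj \<xi>)"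
    using assms(4) cayley_denom assms(1-3) by (simp add: cayley_def frac_eq_eq)
  moreover have "(z - z') * (\<xi> - cnj \<xi>) = (z - \<xi>) * (z' - cnj \<xi>) - (z' - \<xi>) * (z - cnj \<xi>)"
    by (simp add: algebra_simps)
  ultimately have "(z - z') * (\<xi> - cnj \<xi>) = 0" by simp
  then show ?thesis using cayley_denom[OF assms(3,3)] by simp
qed

lemma cayley_surj:
  assumes "\<xi> \<in> \<H>" "norm w < 1"
  obtains z where "z \<in> \<H>" "cayley \<xi> z = w"
proof
  define z where "z = (\<xi> - cnj \<xi> * w) / (1 - w)"
  have w1: "1 - w \<noteq> 0" using assms(2) by auto
  have d: "z - cnj \<xi> = (\<xi> - cnj \<xi>) / (1 - w)" "z - \<xi> = w * ((\<xi> - cnj \<xi>) / (1 - w))"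
    using w1 by (simp_all add: z_def field_simps)
  have x: "(\<xi> - cnj \<xi>) / (1 - w) \<noteq> 0" using w1 cayley_denom[OF assms(1,1)] by simp
  show "cayley \<xi> z = w" unfolding cayley_def d using x by simp
  have "(norm (z - \<xi>))\<^sup>2 < (norm (z - cnj \<xi>))\<^sup>2"
    unfolding d norm_mult using x assms(2)
    by (intro power_strict_mono) (auto intro!: mult_less_cancel_right1[THEN iffD2])
  then have "(Im z - Im \<xi>)\<^sup>2 < (Im z + Im \<xi>)\<^sup>2" by (simp add: cmod_power2)
  then have "Im \<xi> * Im z > 0" by (simp add: power2_eq_square algebra_simps)
  then show "z \<in> \<H>" using assms(1) zero_less_mult_pos by (simp add: upper_half_plane_iff)
qed

lemma cayley_nbhd:
  assumes "\<xi> \<in> \<H>" "open U" "\<xi> \<in> U"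
  obtains r where "r > 0" "r < 1" "\<And>z. z \<in> \<H> \<Longrightarrow> norm (cayley \<xi> z) < r \<Longrightarrow> z \<in> U"
proof -
  obtain e where e: "e > 0" "ball \<xi> e \<subseteq> U" using assms open_contains_ball by blast
  have y: "Im \<xi> > 0" using assms(1) by (simp add: upper_half_plane_iff)
  define r where "r = min (1/2) (e / (8 * Im \<xi>))"
  have "z \<in> U" if z: "z \<in> \<H>" "norm (cayley \<xi> z) < r" for z
  proof -
    have "norm (z - \<xi>) = norm (cayley \<xi> z) * norm (z - cnj \<xi>)"
      using cayley_denom[OF z(1) assms(1)] by (simp add: cayley_def norm_divide)
    also have "\<dots> \<le> norm (cayley \<xi> z) * (norm (z - \<xi>) + 2 * Im \<xi>)"
    proof (rule mult_left_mono)
      have "\<xi> - cnj \<xi> = of_real (2 * Im \<xi>) * \<i>" by (simp add: complex_eq_iff)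
      then have "norm (\<xi> - cnj \<xi>) = 2 * Im \<xi>" using y by (simp add: norm_mult)
      then show "norm (z - cnj \<xi>) \<le> norm (z - \<xi>) + 2 * Im \<xi>"
        using norm_triangle_ineq[of "z - \<xi>" "\<xi> - cnj \<xi>"] by simp
    qed simp
    also have "\<dots> = norm (cayley \<xi> z) * norm (z - \<xi>) + norm (cayley \<xi> z) * (2 * Im \<xi>)"
      by (simp add: algebra_simps)
    also have "\<dots> \<le> 1/2 * norm (z - \<xi>) + norm (cayley \<xi> z) * (2 * Im \<xi>)"
      using z(2) by (intro add_right_mono mult_right_mono) (auto simp: r_def)
    finally have "norm (z - \<xi>) \<le> norm (cayley \<xi> z) * (4 * Im \<xi>)" by simp
    also have "\<dots> < e"
    proof -
      have "norm (cayley \<xi> z) < e / (8 * Im \<xi>)" using z(2) by (simp add: r_def)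
      then have "norm (cayley \<xi> z) * (8 * Im \<xi>) < e" using y by (simp add: pos_less_divide_eq)
      moreover have "norm (cayley \<xi> z) * Im \<xi> \<ge> 0" using y by simp
      ultimately show ?thesis by linarith
    qed
    finally show ?thesis using e by (auto simp: dist_norm norm_minus_commute)
  qed
  then show ?thesis using that[of r] e y by (auto simp: r_def)
qed

text \<open>If \<open>A\<close> fixes \<open>\<xi>\<close>, it acts on the disc coordinate at \<open>\<xi>\<close> by multiplication with this number.\<close>

definition rotation_factor :: "complex \<Rightarrow> mat22 \<Rightarrow> complex" where
  "rotation_factor \<xi> A = cnj (cocycle A \<xi>) / cocycle A \<xi>"

lemma cayley_moebius:
  assumes "A \<in> SL" "\<xi> \<in> \<H>" "moebius A \<xi> = \<xi>" "z \<in> \<H>"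
  shows "cayley \<xi> (moebius A z) = rotation_factor \<xi> A * cayley \<xi> z"
proof -
  have c: "cocycle A (cnj \<xi>) = cnj (cocycle A \<xi>)" by (simp add: cocycle_def)
  have m: "moebius A (cnj \<xi>) = cnj \<xi>" using assms(3) by (metis c moebius_def complex_cnj_add complex_cnj_complex_of_real complex_cnj_divide complex_cnj_mult)
  have nz: "cocycle A z \<noteq> 0" "cocycle A \<xi> \<noteq> 0" "cocycle A (cnj \<xi>) \<noteq> 0"
    using assms c by auto
  have "moebius A z - \<xi> = (z - \<xi>) / (cocycle A z * cocycle A \<xi>)"
    using moebius_diff[OF assms(1) nz(1,2)] assms(3) by simp
  moreover have "moebius A z - cnj \<xi> = (z - cnj \<xi>) / (cocycle A z * cocycle A (cnj \<xi>))"
    using moebius_diff[OF assms(1) nz(1,3)] m by simp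
  ultimately show ?thesis unfolding cayley_def rotation_factor_def c[symmetric] using nz by simp
qed

section \<open>Discrete subgroups of \<open>SL\<^sub>2(\<real>)\<close>\<close>

definition entries_le :: "real \<Rightarrow> mat22 \<Rightarrow> bool" where
  "entries_le C A \<longleftrightarrow> \<bar>A$1$1\<bar> \<le> C \<and> \<bar>A$1$2\<bar> \<le> C \<and> \<bar>A$2$1\<bar> \<le> C \<and> \<bar>A$2$2\<bar> \<le> C"

lemma entries_le_norm: "entries_le (norm A) A"
proof -
  have "\<bar>A$i$j\<bar> \<le> norm A" for i j
    using component_le_norm_cart[of "A$i" j] Finite_Cartesian_Product.norm_nth_le[of A i] by linarith
  then show ?thesis by (simp add: entries_le_def)
qed

lemma norm_le_entries:
  assumes "entries_le C A"
  shows "norm (A::mat22) \<le> 4 * C"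
proof -
  have "norm A \<le> (\<Sum>i\<in>UNIV. norm (A$i))"
    unfolding norm_vec_def by (rule L2_set_le_sum) simp
  also have "\<dots> \<le> (\<Sum>i\<in>UNIV. \<Sum>j\<in>UNIV. \<bar>A$i$j\<bar>)"
    by (intro sum_mono norm_le_l1_cart)
  also have "\<dots> = \<bar>A$1$1\<bar> + \<bar>A$1$2\<bar> + (\<bar>A$2$1\<bar> + \<bar>A$2$2\<bar>)"
    by (simp add: sum_2)
  finally show ?thesis using assms by (simp add: entries_le_def)
qed

lemma entries_le_mult:
  assumes "entries_le a A" "entries_le b B" "a \<ge> 0"
  shows "entries_le (2 * (a * b)) (A ** B)"
proof -
  have *: "\<bar>x * y + x' * y'\<bar> \<le> 2 * (a * b)" if "\<bar>x\<bar> \<le> a" "\<bar>y\<bar> \<le> b" "\<bar>x'\<bar> \<le> a" "\<bar>y'\<bar> \<le> b" for x y x' y' :: real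
  proof -
    have "\<bar>x * y\<bar> \<le> a * b" "\<bar>x' * y'\<bar> \<le> a * b"
      unfolding abs_mult using that assms(3) by (auto intro!: mult_mono)
    then show ?thesis by linarith
  qed
  show ?thesis using assms(1,2) unfolding entries_le_def mult22 by (intro conjI *) auto
qed

lemma entries_le_adj22: "entries_le C A \<Longrightarrow> entries_le C (adj22 A)"
  by (simp add: entries_le_def)

text \<open>The order of a stabiliser is defined by counting cosets, which is the same as counting the values of
  any function with the same fibres.\<close>

lemma card_image_eq_kernel:
  assumes "\<And>x y. x \<in> A \<Longrightarrow> y \<in> A \<Longrightarrow> f x = f y \<longleftrightarrow> g x = g y"
  shows "card (f ` A) = card (g ` A)"
proof (rule bij_betw_same_card)
  show "bij_betw (\<lambda>s. g (inv_into A f s)) (f ` A) (g ` A)"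
  proof (rule bij_betw_imageI)
    show "inj_on (\<lambda>s. g (inv_into A f s)) (f ` A)"
    proof (rule inj_onI)
      fix s t assume st: "s \<in> f ` A" "t \<in> f ` A" "g (inv_into A f s) = g (inv_into A f t)"
      then have "f (inv_into A f s) = f (inv_into A f t)"
        using assms inv_into_into[of _ f A] by meson
      then show "s = t" using st f_inv_into_f[of _ f A] by metis
    qed
    have "g (inv_into A f (f x)) = g x" if "x \<in> A" for x
      using assms[OF inv_into_into[of "f x" f A] that] f_inv_into_f[of "f x" f A] that by blast
    then show "(\<lambda>s. g (inv_into A f s)) ` f ` A = g ` A" by (force simp: image_image)
  qed
qed

text \<open>Multiplication by an element \<open>x\<close> permutes the set, and comparing the products of all elements before
  and after gives \<open>x ^ card Z = 1\<close>; there are only \<open>card Z\<close> such roots of unity.\<close>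

lemma finite_mult_closed_roots_of_unity:
  fixes Z :: "complex set"
  assumes "finite Z" "Z \<noteq> {}" "0 \<notin> Z" "\<And>x y. x \<in> Z \<Longrightarrow> y \<in> Z \<Longrightarrow> x * y \<in> Z"
  shows "Z = {z. z ^ card Z = 1}"
proof -
  have e: "card Z > 0" using assms by (simp add: card_gt_0_iff)
  have "x ^ card Z = 1" if x: "x \<in> Z" for x
  proof -
    have x0: "x \<noteq> 0" using x assms(3) by auto
    have inj: "inj_on ((*) x) Z" using x0 by (auto simp: inj_on_def)
    have "(*) x ` Z = Z"
      by (rule endo_inj_surj[OF assms(1) _ inj]) (use assms(4) x in auto)
    then have "\<Prod>Z = (\<Prod>z\<in>(*) x ` Z. z)" by simp
    also have "\<dots> = (\<Prod>z\<in>Z. x * z)" by (rule prod.reindex_cong[OF inj]) auto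
    also have "\<dots> = x ^ card Z * \<Prod>Z" by (simp add: prod.distrib)
    finally show ?thesis using assms(1,3) by auto
  qed
  then have "Z \<subseteq> {z. z ^ card Z = 1}" by blast
  moreover have "finite {z::complex. z ^ card Z = 1}" using finite_roots_unity[of "card Z"] e by simp
  moreover have "card {z::complex. z ^ card Z = 1} = card Z" by (rule card_roots_unity_eq[OF e])
  ultimately show ?thesis using card_subset_eq by metis
qed

text \<open>The least positive element divides every other one, by division with remainder.\<close>

lemma discrete_subgroup_reals:
  fixes B :: "real set"
  assumes fin: "\<And>C. finite {b \<in> B. \<bar>b\<bar> \<le> C}"
    and add: "\<And>x y. x \<in> B \<Longrightarrow> y \<in> B \<Longrightarrow> x + y \<in> B" and neg: "\<And>x. x \<in> B \<Longrightarrow> - x \<in> B"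
    and \<beta>: "\<beta> \<in> B" "\<beta> \<noteq> 0"
  obtains h where "h > 0" "B = {of_int l * h | l::int. True}"
proof -
  define P where "P = {b \<in> B. \<bar>b\<bar> \<le> \<bar>\<beta>\<bar>} \<inter> {0<..}"
  have P: "finite P" "\<bar>\<beta>\<bar> \<in> P"
    using fin[of "\<bar>\<beta>\<bar>"] \<beta> neg[OF \<beta>(1)] by (auto simp: P_def abs_if)
  define h where "h = Min P"
  have "h \<in> P" unfolding h_def using P by (intro Min_in) auto
  then have h: "h > 0" "h \<in> B" "h \<le> \<bar>\<beta>\<bar>" by (auto simp: P_def)
  have least: "h \<le> b" if "b \<in> B" "b > 0" for b
  proof (cases "b \<le> \<bar>\<beta>\<bar>")
    case True
    then have "b \<in> P" using that by (auto simp: P_def)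
    then show ?thesis unfolding h_def using P(1) by simp
  qed (use h in linarith)
  have zero: "0 \<in> B" using add[OF h(2) neg[OF h(2)]] by simp
  have nat: "of_nat n * h \<in> B" for n
    by (induction n) (use zero add[OF h(2)] in \<open>auto simp: distrib_right\<close>)
  have int: "of_int l * h \<in> B" for l
  proof (cases "l \<ge> 0")
    case True then show ?thesis using nat[of "nat l"] by simp
  next
    case False then show ?thesis using neg[OF nat[of "nat (- l)"]] by simp
  qed
  have "\<exists>l::int. b = of_int l * h" if b: "b \<in> B" for b
  proof -
    define l where "l = \<lfloor>b / h\<rfloor>"
    define s where "s = b - of_int l * h"
    have "s \<in> B" using add[OF b neg[OF int[of l]]] by (simp add: s_def)
    moreover have "0 \<le> s" "s < h"
      using floor_divide_lower[OF h(1), of b] floor_divide_upper[OF h(1), of b]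
      by (simp_all add: s_def l_def algebra_simps)
    ultimately have "s = 0" using least[of s] by force
    then show ?thesis by (auto simp: s_def)
  qed
  then have "B = {of_int l * h | l::int. True}" using int by blast
  then show ?thesis using that h(1) by blast
qed

locale discrete_group =
  fixes \<Gamma> :: "mat22 set"
  assumes subgroup: "subgroup \<Gamma> SL2R" and discrete: "discrete \<Gamma>"
begin

lemma mem_SL [simp]: "\<gamma> \<in> \<Gamma> \<Longrightarrow> \<gamma> \<in> SL"
  by (rule subgroup.mem_carrier[OF subgroup])

lemma one_mem [simp]: "Finite_Cartesian_Product.mat 1 \<in> \<Gamma>"
  using subgroup.one_closed[OF subgroup] by (simp add: SL2R_def)

lemma mult_mem [simp]: "\<gamma> \<in> \<Gamma> \<Longrightarrow> \<delta> \<in> \<Gamma> \<Longrightarrow> \<gamma> ** \<delta> \<in> \<Gamma>"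
  using subgroup.m_closed[OF subgroup, of \<gamma> \<delta>] by (simp add: SL2R_def)

lemma adj22_mem [simp]: "\<gamma> \<in> \<Gamma> \<Longrightarrow> adj22 \<gamma> \<in> \<Gamma>"
  using subgroup.m_inv_closed[OF subgroup, of \<gamma>] inv_SL2R[of \<gamma>] by simp

text \<open>Two elements with bounded entries whose difference is small have a quotient close to \<open>1\<close>, so
  they coincide because \<open>1\<close> is isolated.\<close>

lemma finite_entries_le: "finite {\<gamma> \<in> \<Gamma>. entries_le C \<gamma>}"
proof -
  let ?S = "{\<gamma> \<in> \<Gamma>. entries_le C \<gamma>}"
  have "(Finite_Cartesian_Product.mat 1) isolated_in \<Gamma>" using discrete one_mem discreteD by blast
  then obtain e where e: "e > 0" "\<And>\<gamma>. \<gamma> \<in> \<Gamma> \<Longrightarrow> dist (Finite_Cartesian_Product.mat 1) \<gamma> < e \<Longrightarrow> \<gamma> = Finite_Cartesian_Product.mat 1"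
    using isolated_inE_dist by blast
  define c where "c = \<bar>C\<bar> + 1"
  have c: "c > 0" by (simp add: c_def)
  have "uniform_discrete ?S"
  proof (rule uniformI1)
    show "e / (8 * c) > 0" using e c by simp
  next
    fix A B assume AB: "A \<in> ?S" "B \<in> ?S" "dist A B < e / (8 * c)"
    have A: "A \<in> \<Gamma>" "A \<in> SL" "entries_le c (adj22 A)"
      using AB(1) entries_le_adj22 by (auto simp: c_def entries_le_def)
    have "entries_le (2 * (c * norm (B - A))) (adj22 A ** (B - A))"
      by (rule entries_le_mult[OF A(3) entries_le_norm]) (use c in simp)
    also have "adj22 A ** (B - A) = adj22 A ** B - Finite_Cartesian_Product.mat 1"
      using adj22_mult[OF A(2)] by (simp add: matrix_mul_assoc mat22_eq_iff algebra_simps)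
    finally have "norm (adj22 A ** B - Finite_Cartesian_Product.mat 1) \<le> 4 * (2 * (c * norm (B - A)))"
      by (rule norm_le_entries)
    also have "\<dots> < e" using AB(3) c by (simp add: dist_norm norm_minus_commute pos_less_divide_eq mult.commute mult.left_commute)
    finally have "adj22 A ** B = Finite_Cartesian_Product.mat 1"
      using e(2)[of "adj22 A ** B"] AB(2) A(1) by (simp add: dist_norm norm_minus_commute)
    then show "A = B" using conj_adj22(2)[OF A(2), of B] by simp
  qed
  moreover have "bounded ?S"
    unfolding bounded_iff using norm_le_entries by blast
  ultimately show ?thesis using uniform_discrete_finite_iff by blast
qed

text \<open>If \<open>z\<close> and \<open>\<gamma> z\<close> both lie in a fixed disc, then \<open>Im (\<gamma> z) = Im z / \<bar>c z + d\<bar>\<^sup>2\<close> bounds \<open>\<bar>c z + d\<bar>\<close>, and with it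
  \<open>\<bar>a z + b\<bar> = \<bar>\<gamma> z\<bar> \<bar>c z + d\<bar>\<close>; as \<open>Im z\<close> is bounded below, all entries of \<open>\<gamma>\<close> are bounded.\<close>

lemma finite_meeting_compact:
  assumes "\<xi> \<in> \<H>"
  shows "finite {\<gamma> \<in> \<Gamma>. \<exists>z\<in>ball \<xi> (Im \<xi> / 2). moebius \<gamma> z \<in> ball \<xi> (Im \<xi> / 2)}" (is "finite ?S")
proof -
  define y where "y = Im \<xi>"
  have y: "y > 0" using assms by (simp add: y_def upper_half_plane_iff)
  define M where "M = norm \<xi> + y"
  define C where "C = 2 * (2 + 2 * M) / y + (2 + 2 * M + 2 * (2 + 2 * M) / y * M)"
  have M: "M \<ge> 0" using y by (simp add: M_def)
  have "entries_le C \<gamma>" if \<gamma>: "\<gamma> \<in> ?S" for \<gamma>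
  proof -
    obtain z where z: "\<gamma> \<in> \<Gamma>" "z \<in> ball \<xi> (y / 2)" "moebius \<gamma> z \<in> ball \<xi> (y / 2)"
      using \<gamma> by (auto simp: y_def)
    have b: "Im w > y / 2 \<and> Im w < 2 * y \<and> norm w \<le> M" if "w \<in> ball \<xi> (y / 2)" for w
    proof -
      have "norm (w - \<xi>) < y / 2" using that by (simp add: dist_norm norm_minus_commute)
      moreover have "\<bar>Im (w - \<xi>)\<bar> \<le> norm (w - \<xi>)" by (rule abs_Im_le_cmod)
      moreover have "norm w \<le> norm \<xi> + norm (w - \<xi>)" using norm_triangle_ineq[of \<xi> "w - \<xi>"] by simp
      ultimately show ?thesis using y by (auto simp: M_def y_def)
    qed
    note bz = b[OF z(2)] and bm = b[OF z(3)]
    define j where "j = cocycle \<gamma> z"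
    have j0: "j \<noteq> 0" unfolding j_def using z(1) bz y by (intro cocycle_nonzero) auto
    have "Im (moebius \<gamma> z) = Im z / (norm j)\<^sup>2"
      unfolding j_def using z(1) bz y by (intro Im_moebius) auto
    then have "y / 2 < Im z / (norm j)\<^sup>2" using bm by simp
    then have "y / 2 * (norm j)\<^sup>2 < Im z" using j0 by (simp add: pos_less_divide_eq)
    then have "y * (norm j)\<^sup>2 < y * 4" using bz by linarith
    then have "(norm j)\<^sup>2 < 2\<^sup>2" using y by (subst (asm) mult_less_cancel_left_pos) auto
    then have j: "norm j < 2" by (rule power_less_imp_less_base) simp
    have bound: "\<bar>p\<bar> \<le> 2 * N / y" "\<bar>q\<bar> \<le> N + 2 * N / y * M"
      if n: "norm (of_real p * z + of_real q) \<le> N" for p q N :: real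
    proof -
      have "\<bar>Im (of_real p * z + of_real q)\<bar> \<le> N" using abs_Im_le_cmod n order_trans by blast
      then have "\<bar>p\<bar> * Im z \<le> N" using bz y by (simp add: abs_mult)
      moreover have "\<bar>p\<bar> * (y / 2) \<le> \<bar>p\<bar> * Im z" using bz by (intro mult_left_mono) auto
      ultimately have "\<bar>p\<bar> * (y / 2) \<le> N" by linarith
      then show p: "\<bar>p\<bar> \<le> 2 * N / y" using y by (simp add: field_simps)
      have "\<bar>q\<bar> = norm ((of_real p * z + of_real q) - of_real p * z)" by simp
      also have "\<dots> \<le> norm (of_real p * z + of_real q) + norm (of_real p * z)" by (rule norm_triangle_ineq4)
      also have "\<dots> \<le> N + \<bar>p\<bar> * norm z" using n by (simp add: norm_mult)
      also have "\<bar>p\<bar> * norm z \<le> 2 * N / y * M" using p bz by (intro mult_mono) auto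
      finally show "\<bar>q\<bar> \<le> N + 2 * N / y * M" by simp
    qed
    have "norm (of_real (\<gamma>$1$1) * z + of_real (\<gamma>$1$2)) = norm (moebius \<gamma> z) * norm j"
      using j0 by (simp add: moebius_def j_def norm_divide)
    also have "\<dots> \<le> M * 2" using bm j M by (intro mult_mono) auto
    finally have 1: "norm (of_real (\<gamma>$1$1) * z + of_real (\<gamma>$1$2)) \<le> 2 + 2 * M" by simp
    have 2: "norm (of_real (\<gamma>$2$1) * z + of_real (\<gamma>$2$2)) \<le> 2 + 2 * M"
      using j M by (simp add: j_def cocycle_def)
    have K: "2 * (2 + 2 * M) / y \<le> C" "2 + 2 * M + 2 * (2 + 2 * M) / y * M \<le> C"
      using y M by (simp_all add: C_def)
    show ?thesis unfolding entries_le_def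
      using bound[OF 1] bound[OF 2] K by linarith
  qed
  then have "?S \<subseteq> {\<gamma> \<in> \<Gamma>. entries_le C \<gamma>}" by blast
  then show ?thesis using finite_entries_le finite_subset by blast
qed

text \<open>Only finitely many elements come into question near \<open>\<xi>\<close>, and each of them that does not fix \<open>\<xi>\<close> moves
  a neighbourhood of \<open>\<xi>\<close> off itself.\<close>

lemma properly_discontinuous:
  assumes "\<xi> \<in> \<H>"
  obtains r where "r > 0" "r < 1"
    "\<And>\<gamma> z. \<gamma> \<in> \<Gamma> \<Longrightarrow> z \<in> \<H> \<Longrightarrow> norm (cayley \<xi> z) < r \<Longrightarrow> norm (cayley \<xi> (moebius \<gamma> z)) < r \<Longrightarrow>
      moebius \<gamma> \<xi> = \<xi>"
proof -
  let ?K = "ball \<xi> (Im \<xi> / 2)"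
  define S where "S = {\<gamma> \<in> \<Gamma>. \<exists>z\<in>?K. moebius \<gamma> z \<in> ?K} \<inter> {\<gamma>. moebius \<gamma> \<xi> \<noteq> \<xi>}"
  have finS: "finite S" unfolding S_def using finite_meeting_compact[OF assms] by blast
  have "\<forall>\<gamma>\<in>S. \<exists>V W. open V \<and> open W \<and> \<xi> \<in> V \<and> moebius \<gamma> \<xi> \<in> W \<and> V \<inter> W = {}"
    using hausdorff unfolding S_def by (metis (mono_tags, lifting) IntD2 mem_Collect_eq)
  then obtain V W where VW: "\<And>\<gamma>. \<gamma> \<in> S \<Longrightarrow> open (V \<gamma>) \<and> open (W \<gamma>) \<and> \<xi> \<in> V \<gamma> \<and> moebius \<gamma> \<xi> \<in> W \<gamma> \<and> V \<gamma> \<inter> W \<gamma> = {}"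
    by metis
  define U where "U = ?K \<inter> (\<Inter>\<gamma>\<in>S. V \<gamma> \<inter> (\<H> \<inter> moebius \<gamma> -` W \<gamma>))"
  have "open (\<H> \<inter> moebius \<gamma> -` W \<gamma>)" if "\<gamma> \<in> S" for \<gamma>
    using that VW moebius_holomorphic[of \<gamma>] holomorphic_on_imp_continuous_on
    by (intro continuous_open_preimage) (auto simp: S_def)
  then have "open U" unfolding U_def using VW finS by (intro open_Int open_INT) auto
  moreover have "\<xi> \<in> U" using assms VW by (auto simp: U_def upper_half_plane_iff)
  ultimately obtain r where r: "r > 0" "r < 1" "\<And>z. z \<in> \<H> \<Longrightarrow> norm (cayley \<xi> z) < r \<Longrightarrow> z \<in> U"
    using cayley_nbhd[OF assms] by blast
  show ?thesis
  proof (rule that[OF r(1,2)], rule ccontr)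
    fix \<gamma> z assume a: "\<gamma> \<in> \<Gamma>" "z \<in> \<H>" "norm (cayley \<xi> z) < r" "norm (cayley \<xi> (moebius \<gamma> z)) < r"
      "moebius \<gamma> \<xi> \<noteq> \<xi>"
    have zU: "z \<in> U" "moebius \<gamma> z \<in> U" using r(3) a by auto
    then have S: "\<gamma> \<in> S" using a by (auto simp: S_def U_def)
    then have "moebius \<gamma> z \<in> W \<gamma>" "moebius \<gamma> z \<in> V \<gamma>" using zU unfolding U_def by auto
    then show False using VW[OF S] by blast
  qed
qed

lemma stab_H: "\<xi> \<in> \<H> \<Longrightarrow> stab \<Gamma> (Fin \<xi>) = {\<gamma> \<in> \<Gamma>. moebius \<gamma> \<xi> = \<xi>}"
  by (auto simp: stab_def)

lemma finite_stab:
  assumes "\<xi> \<in> \<H>"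
  shows "finite (stab \<Gamma> (Fin \<xi>))"
proof (rule finite_subset[OF _ finite_meeting_compact[OF assms]])
  show "stab \<Gamma> (Fin \<xi>) \<subseteq> {\<gamma> \<in> \<Gamma>. \<exists>z\<in>ball \<xi> (Im \<xi> / 2). moebius \<gamma> z \<in> ball \<xi> (Im \<xi> / 2)}"
    using assms by (auto simp: stab_H upper_half_plane_iff intro!: bexI[of _ \<xi>])
qed

lemma rotation_factor_mult:
  assumes "A \<in> SL" "B \<in> SL" "\<xi> \<in> \<H>" "moebius B \<xi> = \<xi>"
  shows "rotation_factor \<xi> (A ** B) = rotation_factor \<xi> A * rotation_factor \<xi> B"
  using assms by (simp add: rotation_factor_def cocycle_mult)

lemma rotation_factor_eq_1:
  assumes "A \<in> SL" "\<xi> \<in> \<H>" "moebius A \<xi> = \<xi>" "rotation_factor \<xi> A = 1"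
  shows "A \<in> plus_minus_one"
proof -
  have nz: "cocycle A \<xi> \<noteq> 0" using assms by simp
  then have "cnj (cocycle A \<xi>) = cocycle A \<xi>" using assms(4) by (simp add: rotation_factor_def)
  then have "Im (cocycle A \<xi>) = 0" by (simp add: complex_eq_iff)
  then have c: "A$2$1 = 0" using assms(2) by (simp add: cocycle_def upper_half_plane_iff)
  have "of_real (A$1$1) * \<xi> + of_real (A$1$2) = \<xi> * of_real (A$2$2)"
    using assms(3) nz c by (simp add: moebius_def cocycle_def field_simps)
  then have "A$1$1 * Im \<xi> = Im \<xi> * A$2$2" "A$1$1 * Re \<xi> + A$1$2 = Re \<xi> * A$2$2"
    by (auto simp: complex_eq_iff)
  then have d: "A$1$1 = A$2$2" "A$1$2 = 0" using assms(2) by (auto simp: upper_half_plane_iff)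
  then have "(A$1$1)\<^sup>2 = 1" using assms(1) by (simp add: SL_iff power2_eq_square c)
  then have "A$1$1 = 1 \<or> A$1$1 = - 1" by (simp add: power2_eq_1_iff)
  then have "\<bar>A$1$1\<bar> = 1" by auto
  then show ?thesis using c d by (simp add: plus_minus_one_iff)
qed

lemma rotation_factor_uminus [simp]: "rotation_factor \<xi> (- A) = rotation_factor \<xi> A"
proof -
  have "cocycle (- A) \<xi> = - cocycle A \<xi>" by (simp add: cocycle_def)
  then show ?thesis by (simp add: rotation_factor_def)
qed

text \<open>The stabiliser modulo \<open>\<plusminus>1\<close> acts faithfully by rotations of the disc, through a finite
  subgroup of the unit circle; such a subgroup consists of all roots of unity of its order.\<close>

lemma rotations_of_stab:
  assumes \<xi>: "\<xi> \<in> \<H>"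
  shows "ellip_order \<Gamma> \<xi> > 0"
    "rotation_factor \<xi> ` stab \<Gamma> (Fin \<xi>) = {\<zeta>. \<zeta> ^ ellip_order \<Gamma> \<xi> = 1}"
proof -
  let ?S = "stab \<Gamma> (Fin \<xi>)" and ?P = "\<Gamma> \<inter> plus_minus_one"
  let ?q = "\<lambda>\<gamma>. (\<lambda>\<epsilon>. \<epsilon> ** \<gamma>) ` ?P" and ?Z = "rotation_factor \<xi> ` stab \<Gamma> (Fin \<xi>)"
  have S: "\<gamma> \<in> \<Gamma>" "\<gamma> \<in> SL" "moebius \<gamma> \<xi> = \<xi>" if "\<gamma> \<in> ?S" for \<gamma>
    using that \<xi> by (auto simp: stab_H)
  have Smult: "\<gamma> ** \<delta> \<in> ?S" if "\<gamma> \<in> ?S" "\<delta> \<in> ?S" for \<gamma> \<delta>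
    using S[OF that(1)] S[OF that(2)] \<xi> moebius_mult[of \<delta> \<xi> \<gamma>] by (simp add: stab_H)
  have Sadj: "adj22 \<gamma> \<in> ?S" if "\<gamma> \<in> ?S" for \<gamma>
    using S[OF that] \<xi> moebius_adj22(1)[of \<gamma> \<xi>] by (simp add: stab_H)
  have one: "Finite_Cartesian_Product.mat 1 \<in> ?S" using \<xi> by (simp add: stab_H)
  have Pmult: "\<epsilon> ** \<delta> \<in> ?P" if "\<epsilon> \<in> ?P" "\<delta> \<in> ?P" for \<epsilon> \<delta>
    using that plus_minus_one_mult[of \<epsilon> \<delta>] mult_mem[of \<epsilon> \<delta>] by (auto simp: plus_minus_one_def)
  have q_le: "?q \<gamma> \<subseteq> ?q \<delta>" if "rotation_factor \<xi> \<gamma> = rotation_factor \<xi> \<delta>" "\<gamma> \<in> ?S" "\<delta> \<in> ?S" for \<gamma> \<delta>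
  proof -
    let ?\<eta> = "\<gamma> ** adj22 \<delta>"
    have \<eta>: "?\<eta> \<in> ?S" using Smult Sadj that by blast
    have \<gamma>: "\<gamma> = ?\<eta> ** \<delta>" using conj_adj22(4)[OF S(2)[OF that(3)], of \<gamma>] by simp
    have "rotation_factor \<xi> \<gamma> = rotation_factor \<xi> ?\<eta> * rotation_factor \<xi> \<delta>"
      using rotation_factor_mult[of ?\<eta> \<delta> \<xi>] S[OF \<eta>] S[OF that(3)] \<xi> \<gamma> by simp
    moreover have "rotation_factor \<xi> \<delta> \<noteq> 0" using S[OF that(3)] \<xi> by (simp add: rotation_factor_def)
    ultimately have "rotation_factor \<xi> ?\<eta> = 1" using that(1) by simp
    then have "?\<eta> \<in> ?P" using rotation_factor_eq_1[of ?\<eta> \<xi>] S[OF \<eta>] \<xi> by simp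
    then show ?thesis
    proof (intro subsetI, elim imageE)
      fix x \<epsilon> assume "?\<eta> \<in> ?P" "x = \<epsilon> ** \<gamma>" "\<epsilon> \<in> ?P"
      moreover have "\<epsilon> ** \<gamma> = (\<epsilon> ** ?\<eta>) ** \<delta>" by (subst \<gamma>) (simp only: matrix_mul_assoc)
      ultimately show "x \<in> ?q \<delta>" using Pmult by blast
    qed
  qed
  have "card (?q ` ?S) = card ?Z"
  proof (rule card_image_eq_kernel)
    fix \<gamma> \<delta> assume \<gamma>\<delta>: "\<gamma> \<in> ?S" "\<delta> \<in> ?S"
    show "?q \<gamma> = ?q \<delta> \<longleftrightarrow> rotation_factor \<xi> \<gamma> = rotation_factor \<xi> \<delta>"
    proof
      assume q: "?q \<gamma> = ?q \<delta>"
      have "Finite_Cartesian_Product.mat 1 ** \<gamma> \<in> ?q \<gamma>" by (intro imageI) (simp add: plus_minus_one_def)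
      then obtain \<epsilon> where \<epsilon>: "\<epsilon> \<in> plus_minus_one" "\<gamma> = \<epsilon> ** \<delta>" unfolding q by auto
      from \<epsilon>(2) plus_minus_one_mult[OF \<epsilon>(1), of \<delta>] show "rotation_factor \<xi> \<gamma> = rotation_factor \<xi> \<delta>" by auto
    next
      assume "rotation_factor \<xi> \<gamma> = rotation_factor \<xi> \<delta>"
      then show "?q \<gamma> = ?q \<delta>" using q_le[of \<gamma> \<delta>] q_le[of \<delta> \<gamma>] \<gamma>\<delta> by (intro equalityI) auto
    qed
  qed
  then have card: "ellip_order \<Gamma> \<xi> = card ?Z" by (simp add: ellip_order_def)
  have fin: "finite ?Z" using finite_stab[OF \<xi>] by simp
  have ne: "?Z \<noteq> {}" using one by blast
  show "ellip_order \<Gamma> \<xi> > 0" unfolding card using fin ne by (simp add: card_gt_0_iff)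
  show "?Z = {\<zeta>. \<zeta> ^ ellip_order \<Gamma> \<xi> = 1}"
    unfolding card
  proof (rule finite_mult_closed_roots_of_unity[OF fin ne])
    show "0 \<notin> ?Z" using S \<xi> by (auto simp: rotation_factor_def)
  next
    fix x y assume "x \<in> ?Z" "y \<in> ?Z"
    then obtain \<gamma> \<delta> where gd: "\<gamma> \<in> ?S" "\<delta> \<in> ?S" "x = rotation_factor \<xi> \<gamma>" "y = rotation_factor \<xi> \<delta>" by blast
    then have "x * y = rotation_factor \<xi> (\<gamma> ** \<delta>)"
      using rotation_factor_mult[of \<gamma> \<delta> \<xi>] S \<xi> by simp
    then show "x * y \<in> ?Z" using Smult[OF gd(1,2)] by blast
  qed
qed

subsection \<open>Cusps\<close>

text \<open>The definition of a cusp scaling identifies the conjugated stabiliser with a group of translations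
  up to sign only, so the conjugated group is closed under signs from the outset.\<close>

definition conj_group :: "mat22 \<Rightarrow> mat22 set" where
  "conj_group \<sigma> = {g. \<exists>\<gamma>\<in>\<Gamma>. g = \<sigma> ** \<gamma> ** adj22 \<sigma> \<or> g = - (\<sigma> ** \<gamma> ** adj22 \<sigma>)}"

lemma conj_mult:
  assumes "\<sigma> \<in> SL"
  shows "(\<sigma> ** \<gamma> ** adj22 \<sigma>) ** (\<sigma> ** \<delta> ** adj22 \<sigma>) = \<sigma> ** (\<gamma> ** \<delta>) ** adj22 \<sigma>"
proof -
  have "(\<sigma> ** \<gamma> ** adj22 \<sigma>) ** (\<sigma> ** \<delta> ** adj22 \<sigma>) = \<sigma> ** \<gamma> ** (adj22 \<sigma> ** (\<sigma> ** (\<delta> ** adj22 \<sigma>)))"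
    by (simp only: matrix_mul_assoc)
  also have "\<dots> = \<sigma> ** \<gamma> ** (\<delta> ** adj22 \<sigma>)" by (simp only: conj_adj22(1)[OF assms])
  finally show ?thesis by (simp only: matrix_mul_assoc)
qed

lemma mult22_uminus: "(- (A::mat22)) ** B = - (A ** B)" "(A::mat22) ** (- B) = - (A ** (B::mat22))"
  for B :: mat22
  by (simp_all add: mat22_eq_iff)

lemma adj22_mult_distrib: "adj22 (A ** B) = adj22 B ** adj22 A"
  and adj22_adj22 [simp]: "adj22 (adj22 A) = A"
  and adj22_uminus [simp]: "adj22 (- A) = - adj22 A"
  by (simp_all add: mat22_eq_iff algebra_simps)

lemma conj_group_closed:
  assumes "\<sigma> \<in> SL"
  shows "g \<in> conj_group \<sigma> \<Longrightarrow> g \<in> SL" "g \<in> conj_group \<sigma> \<Longrightarrow> - g \<in> conj_group \<sigma>"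
    "g \<in> conj_group \<sigma> \<Longrightarrow> g' \<in> conj_group \<sigma> \<Longrightarrow> g ** g' \<in> conj_group \<sigma>"
    "g \<in> conj_group \<sigma> \<Longrightarrow> adj22 g \<in> conj_group \<sigma>"
proof -
  show "g \<in> conj_group \<sigma> \<Longrightarrow> g \<in> SL" "g \<in> conj_group \<sigma> \<Longrightarrow> - g \<in> conj_group \<sigma>"
    using assms by (auto simp: conj_group_def)
next
  assume "g \<in> conj_group \<sigma>" "g' \<in> conj_group \<sigma>"
  then obtain \<gamma> \<delta> where "\<gamma> \<in> \<Gamma>" "\<delta> \<in> \<Gamma>"
    "g = \<sigma> ** \<gamma> ** adj22 \<sigma> \<or> g = - (\<sigma> ** \<gamma> ** adj22 \<sigma>)" "g' = \<sigma> ** \<delta> ** adj22 \<sigma> \<or> g' = - (\<sigma> ** \<delta> ** adj22 \<sigma>)"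
    unfolding conj_group_def by blast
  then show "g ** g' \<in> conj_group \<sigma>"
    unfolding conj_group_def mem_Collect_eq
    by (intro bexI[of _ "\<gamma> ** \<delta>"] mult_mem) (auto simp: mult22_uminus conj_mult[OF assms])
next
  assume "g \<in> conj_group \<sigma>"
  then obtain \<gamma> where \<gamma>: "\<gamma> \<in> \<Gamma>" "g = \<sigma> ** \<gamma> ** adj22 \<sigma> \<or> g = - (\<sigma> ** \<gamma> ** adj22 \<sigma>)"
    unfolding conj_group_def by blast
  have "adj22 (\<sigma> ** \<gamma> ** adj22 \<sigma>) = \<sigma> ** adj22 \<gamma> ** adj22 \<sigma>"
    by (simp add: adj22_mult_distrib matrix_mul_assoc)
  then show "adj22 g \<in> conj_group \<sigma>"
    unfolding conj_group_def mem_Collect_eq using \<gamma>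
    by (intro bexI[of _ "adj22 \<gamma>"] adj22_mem) auto
qed

lemma finite_conj_group_entries_le:
  assumes "\<sigma> \<in> SL"
  shows "finite {g \<in> conj_group \<sigma>. entries_le C g}"
proof (cases "C \<ge> 0")
  case False
  then have "{g \<in> conj_group \<sigma>. entries_le C g} = {}" by (auto simp: entries_le_def)
  then show ?thesis by (simp only: finite.emptyI)
next
  case True
  define S where "S = norm \<sigma>"
  define D where "D = 2 * ((2 * (S * C)) * S)"
  let ?f = "\<lambda>\<gamma>. \<sigma> ** \<gamma> ** adj22 \<sigma>"
  have S: "entries_le S \<sigma>" "entries_le S (adj22 \<sigma>)" "S \<ge> 0"
    using entries_le_norm[of \<sigma>] entries_le_adj22 by (auto simp: S_def)
  have "{g \<in> conj_group \<sigma>. entries_le C g} \<subseteq>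
      ?f ` {\<gamma> \<in> \<Gamma>. entries_le D \<gamma>} \<union> (\<lambda>\<gamma>. - ?f \<gamma>) ` {\<gamma> \<in> \<Gamma>. entries_le D \<gamma>}"
  proof
    fix g assume g: "g \<in> {g \<in> conj_group \<sigma>. entries_le C g}"
    then obtain \<gamma> where \<gamma>: "\<gamma> \<in> \<Gamma>" "g = ?f \<gamma> \<or> g = - ?f \<gamma>" unfolding conj_group_def by blast
    have "entries_le C (?f \<gamma>)" using g \<gamma>(2) by (auto simp: entries_le_def simp del: mult22)
    then have "entries_le D ((adj22 \<sigma> ** ?f \<gamma>) ** \<sigma>)"
      unfolding D_def using S True by (intro entries_le_mult) auto
    also have "(adj22 \<sigma> ** ?f \<gamma>) ** \<sigma> = adj22 \<sigma> ** (\<sigma> ** (\<gamma> ** adj22 \<sigma> ** \<sigma>))"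
      by (simp only: matrix_mul_assoc)
    also have "\<dots> = \<gamma>" by (simp only: conj_adj22[OF assms])
    finally show "g \<in> ?f ` {\<gamma> \<in> \<Gamma>. entries_le D \<gamma>} \<union> (\<lambda>\<gamma>. - ?f \<gamma>) ` {\<gamma> \<in> \<Gamma>. entries_le D \<gamma>}"
      using \<gamma> by blast
  qed
  then show ?thesis
    by (rule finite_subset) (intro finite_UnI finite_imageI finite_entries_le)
qed

lemma stab_conj:
  assumes "\<sigma> \<in> SL" "emoebius \<sigma> x = Infty" "\<gamma> \<in> \<Gamma>"
  shows "emoebius \<gamma> x = x \<longleftrightarrow> (\<sigma> ** \<gamma> ** adj22 \<sigma>)$2$1 = 0"
proof -
  have x: "x = emoebius (adj22 \<sigma>) Infty" using assms(1,2) by (metis emoebius_adj22(1))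
  have "emoebius (\<sigma> ** \<gamma> ** adj22 \<sigma>) Infty = emoebius \<sigma> (emoebius \<gamma> x)"
    using assms x by (simp add: emoebius_mult del: emoebius.simps)
  then have "emoebius \<sigma> (emoebius \<gamma> x) = Infty \<longleftrightarrow> (\<sigma> ** \<gamma> ** adj22 \<sigma>)$2$1 = 0"
    by (metis ecomplex.distinct(1) emoebius.simps(2))
  moreover have "emoebius \<sigma> (emoebius \<gamma> x) = Infty \<longleftrightarrow> emoebius \<gamma> x = x"
    using assms(1,2) emoebius_adj22(1) by metis
  ultimately show ?thesis by simp
qed

text \<open>Since \<open>\<sigma> x = \<infinity>\<close>, the stabiliser of \<open>x\<close> corresponds to the upper triangular elements of the conjugated
  group.\<close>

lemma cusp_scaling_iff:
  "cusp_scaling \<Gamma> x \<sigma> h \<longleftrightarrow> \<sigma> \<in> SL \<and> emoebius \<sigma> x = Infty \<and> h > 0 \<and>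
    {g \<in> conj_group \<sigma>. g$2$1 = 0} = {g. \<exists>l::int. g = translation (of_int l * h) \<or> g = - translation (of_int l * h)}"
proof (cases "\<sigma> \<in> SL \<and> emoebius \<sigma> x = Infty")
  case True
  have pm: "{\<epsilon> ** A | \<epsilon> A. \<epsilon> \<in> plus_minus_one \<and> P A} = {g. \<exists>A. P A \<and> (g = A \<or> g = - A)}" for P :: "mat22 \<Rightarrow> bool"
    unfolding plus_minus_one_def by (auto simp: mult22_uminus) (metis mult22_uminus(1) matrix_mul_lid)+
  have "{\<epsilon> ** (\<sigma> ** \<gamma> ** matrix_inv \<sigma>) | \<epsilon> \<gamma>. \<epsilon> \<in> plus_minus_one \<and> \<gamma> \<in> stab \<Gamma> x} =
      {\<epsilon> ** A | \<epsilon> A. \<epsilon> \<in> plus_minus_one \<and> (\<exists>\<gamma>\<in>stab \<Gamma> x. A = \<sigma> ** \<gamma> ** adj22 \<sigma>)}"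
    using matrix_inv_SL True by force
  also have "\<dots> = {g \<in> conj_group \<sigma>. g$2$1 = 0}"
    unfolding pm
  proof (intro equalityI subsetI)
    fix g assume "g \<in> {g. \<exists>A. (\<exists>\<gamma>\<in>stab \<Gamma> x. A = \<sigma> ** \<gamma> ** adj22 \<sigma>) \<and> (g = A \<or> g = - A)}"
    then obtain \<gamma> where \<gamma>: "\<gamma> \<in> \<Gamma>" "emoebius \<gamma> x = x" "g = \<sigma> ** \<gamma> ** adj22 \<sigma> \<or> g = - (\<sigma> ** \<gamma> ** adj22 \<sigma>)"
      unfolding stab_def by blast
    then have "g$2$1 = 0" using stab_conj[of \<sigma> x \<gamma>] True by (auto simp del: mult22)
    then show "g \<in> {g \<in> conj_group \<sigma>. g$2$1 = 0}" using \<gamma> unfolding conj_group_def by blast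
  next
    fix g assume "g \<in> {g \<in> conj_group \<sigma>. g$2$1 = 0}"
    then obtain \<gamma> where \<gamma>: "\<gamma> \<in> \<Gamma>" "g$2$1 = 0" "g = \<sigma> ** \<gamma> ** adj22 \<sigma> \<or> g = - (\<sigma> ** \<gamma> ** adj22 \<sigma>)"
      unfolding conj_group_def by blast
    then have "emoebius \<gamma> x = x" using stab_conj[of \<sigma> x \<gamma>] True by (auto simp del: mult22)
    then show "g \<in> {g. \<exists>A. (\<exists>\<gamma>\<in>stab \<Gamma> x. A = \<sigma> ** \<gamma> ** adj22 \<sigma>) \<and> (g = A \<or> g = - A)}"
      using \<gamma> unfolding stab_def by blast
  qed
  finally have 1: "{\<epsilon> ** (\<sigma> ** \<gamma> ** matrix_inv \<sigma>) | \<epsilon> \<gamma>. \<epsilon> \<in> plus_minus_one \<and> \<gamma> \<in> stab \<Gamma> x} =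
    {g \<in> conj_group \<sigma>. g$2$1 = 0}" .
  have "{\<epsilon> ** translation (of_int l * h) | \<epsilon> (l::int). \<epsilon> \<in> plus_minus_one} =
      {\<epsilon> ** A | \<epsilon> A. \<epsilon> \<in> plus_minus_one \<and> (\<exists>l::int. A = translation (of_int l * h))}"
    by blast
  also have "\<dots> = {g. \<exists>l::int. g = translation (of_int l * h) \<or> g = - translation (of_int l * h)}"
    unfolding pm by blast
  finally show ?thesis unfolding cusp_scaling_def 1 by simp
qed (auto simp: cusp_scaling_def)

lemma boundary_to_Infty:
  assumes "x \<in> boundary"
  obtains \<sigma> where "\<sigma> \<in> SL" "emoebius \<sigma> x = Infty"
proof (cases x)
  case Infty
  then show ?thesis using that[of "Finite_Cartesian_Product.mat 1"] by simp
next
  case (Fin z)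
  then obtain r :: real where r: "z = of_real r" using assms by (auto simp: boundary_def)
  have "vector [vector [0, -1], vector [1, -r]] \<in> SL" by (simp add: SL_iff)
  then show ?thesis using that[of "vector [vector [0, -1], vector [1, -r]]"] Fin r by (simp add: cocycle_def)
qed

lemma conj_translation:
  assumes "g \<in> SL" "g$2$1 = 0"
  shows "g ** translation b ** adj22 g = translation ((g$1$1)\<^sup>2 * b)"
  using assms by (auto simp: mat22_eq_iff SL_iff power2_eq_square algebra_simps)

lemma translations_in_conj_group:
  assumes \<sigma>: "\<sigma> \<in> SL" and \<beta>: "translation \<beta> \<in> conj_group \<sigma>" "\<beta> \<noteq> 0"
  obtains h where "h > 0" "{b. translation b \<in> conj_group \<sigma>} = {of_int l * h | l::int. True}"
proof (rule discrete_subgroup_reals[of "{b. translation b \<in> conj_group \<sigma>}" \<beta>])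
  fix C :: real
  have "translation ` {b \<in> {b. translation b \<in> conj_group \<sigma>}. \<bar>b\<bar> \<le> C} \<subseteq> {g \<in> conj_group \<sigma>. entries_le (\<bar>C\<bar> + 1) g}"
    by (auto simp: entries_le_def)
  then have "finite (translation ` {b \<in> {b. translation b \<in> conj_group \<sigma>}. \<bar>b\<bar> \<le> C})"
    using finite_conj_group_entries_le[OF \<sigma>] finite_subset by blast
  moreover have "inj translation" by (rule injI) (metis translation22(2))
  ultimately show "finite {b \<in> {b. translation b \<in> conj_group \<sigma>}. \<bar>b\<bar> \<le> C}"
    using finite_imageD inj_on_subset by blast
next
  fix x y assume "x \<in> {b. translation b \<in> conj_group \<sigma>}" "y \<in> {b. translation b \<in> conj_group \<sigma>}"
  moreover have "translation x ** translation y = translation (x + y)" by (simp add: mat22_eq_iff)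
  ultimately show "x + y \<in> {b. translation b \<in> conj_group \<sigma>}" using conj_group_closed(3)[OF \<sigma>] by force
next
  fix x assume "x \<in> {b. translation b \<in> conj_group \<sigma>}"
  moreover have "adj22 (translation x) = translation (- x)" by (simp add: mat22_eq_iff)
  ultimately show "- x \<in> {b. translation b \<in> conj_group \<sigma>}" using conj_group_closed(4)[OF \<sigma>] by force
qed (use \<beta> that in auto)

text \<open>An upper triangular element with diagonal entries other than \<open>\<plusminus>1\<close> would, by conjugation,
  shrink the least positive translation.\<close>

lemma cusp_scaling_exists:
  assumes x: "x \<in> cusps \<Gamma>"
  obtains \<sigma> h where "cusp_scaling \<Gamma> x \<sigma> h"
proof -
  have xb: "x \<in> boundary" using x by (auto simp: cusps_def boundary_def)
  obtain \<pi> where \<pi>: "\<pi> \<in> \<Gamma>" "parabolic \<pi>" "emoebius \<pi> x = x" using x by (auto simp: cusps_def)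
  obtain \<sigma> where \<sigma>: "\<sigma> \<in> SL" "emoebius \<sigma> x = Infty" using boundary_to_Infty[OF xb] .
  define p where "p = \<sigma> ** \<pi> ** adj22 \<sigma>"
  have p: "p \<in> conj_group \<sigma>" "p \<in> SL" "p$2$1 = 0"
    using \<pi> \<sigma> stab_conj[OF \<sigma> \<pi>(1)] by (auto simp: p_def conj_group_def simp del: mult22)
  have tr: "p$1$1 + p$2$2 = \<pi>$1$1 + \<pi>$2$2"
  proof -
    have "p$1$1 + p$2$2 = (\<pi>$1$1 + \<pi>$2$2) * (\<sigma>$1$1 * \<sigma>$2$2 - \<sigma>$1$2 * \<sigma>$2$1)"
      by (simp add: p_def algebra_simps)
    then show ?thesis using \<sigma>(1) by (simp add: SL_iff)
  qed
  have "\<bar>p$1$1 + p$2$2\<bar> = 2"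
    using \<pi>(2) unfolding tr by (simp add: parabolic_def Determinants.trace_def sum_2)
  moreover have ad: "p$1$1 * p$2$2 = 1" using p by (simp add: SL_iff)
  ultimately have "(p$1$1 - p$2$2)\<^sup>2 = 0"
  proof -
    assume "\<bar>p$1$1 + p$2$2\<bar> = 2"
    then have "(p$1$1 + p$2$2)\<^sup>2 = 2\<^sup>2" by (metis power2_abs)
    then show ?thesis using ad by (simp add: power2_eq_square algebra_simps)
  qed
  then have d: "p$1$1 = p$2$2" by simp
  then have a: "p$1$1 = 1 \<or> p$1$1 = - 1"
    using ad by (metis power2_eq_1_iff power2_eq_square)
  have b: "p$1$2 \<noteq> 0"
  proof
    assume "p$1$2 = 0"
    then have "p \<in> plus_minus_one" using p a d by (auto simp: plus_minus_one_iff)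
    then consider "p = Finite_Cartesian_Product.mat 1" | "p = - Finite_Cartesian_Product.mat 1"
      unfolding plus_minus_one_def by blast
    then have "adj22 \<sigma> ** (p ** \<sigma>) \<in> plus_minus_one"
      using adj22_mult[OF \<sigma>(1)] by cases (simp_all add: plus_minus_one_def mult22_uminus matrix_mul_lid)
    also have "adj22 \<sigma> ** (p ** \<sigma>) = adj22 \<sigma> ** (\<sigma> ** (\<pi> ** adj22 \<sigma> ** \<sigma>))"
      unfolding p_def by (simp only: matrix_mul_assoc)
    also have "\<dots> = \<pi>" by (simp only: conj_adj22[OF \<sigma>(1)])
    finally show False using \<pi>(2) by (simp add: parabolic_def)
  qed
  have "\<exists>\<beta>. \<beta> \<noteq> 0 \<and> translation \<beta> \<in> conj_group \<sigma>"
  proof (cases "p$1$1 = 1")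
    case True
    then have "p = translation (p$1$2)" using p d by (simp add: mat22_eq_iff)
    then show ?thesis using b p by metis
  next
    case False
    then have "- p = translation (- p$1$2)" using p d a by (simp add: mat22_eq_iff)
    then show ?thesis using b conj_group_closed(2)[OF \<sigma>(1) p(1)] by (metis neg_equal_0_iff_equal)
  qed
  then obtain \<beta> where \<beta>: "\<beta> \<noteq> 0" "translation \<beta> \<in> conj_group \<sigma>" by blast
  then obtain h where h: "h > 0" "{b. translation b \<in> conj_group \<sigma>} = {of_int l * h | l::int. True}"
    using translations_in_conj_group[OF \<sigma>(1)] by metis
  have hh: "translation b \<in> conj_group \<sigma> \<longleftrightarrow> (\<exists>l::int. b = of_int l * h)" for b
    using h(2) by auto
  have diag: "\<bar>g$1$1\<bar> \<ge> 1" if g: "g \<in> conj_group \<sigma>" "g$2$1 = 0" for g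
  proof -
    have gSL: "g \<in> SL" using conj_group_closed(1)[OF \<sigma>(1)] g by blast
    have "translation h \<in> conj_group \<sigma>" unfolding hh by (intro exI[of _ 1]) simp
    then have "g ** translation h ** adj22 g \<in> conj_group \<sigma>"
      by (intro conj_group_closed(3)[OF \<sigma>(1)] conj_group_closed(4)[OF \<sigma>(1)] g(1))
    then have "translation ((g$1$1)\<^sup>2 * h) \<in> conj_group \<sigma>" by (simp only: conj_translation[OF gSL g(2)])
    then obtain l :: int where "(g$1$1)\<^sup>2 * h = of_int l * h" unfolding hh by blast
    then have l: "(g$1$1)\<^sup>2 = of_int l" using h(1) by simp
    have "g$1$1 \<noteq> 0" using gSL g(2) by (auto simp: SL_iff)
    then have "(of_int l :: real) > 0" unfolding l[symmetric] by simp
    then have "1 \<le> (of_int l :: real)" by simp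
    then have "1\<^sup>2 \<le> \<bar>g$1$1\<bar>\<^sup>2" unfolding l[symmetric] by simp
    then show ?thesis by (rule power2_le_imp_le) simp
  qed
  have "{g \<in> conj_group \<sigma>. g$2$1 = 0} = {g. \<exists>l::int. g = translation (of_int l * h) \<or> g = - translation (of_int l * h)}"
  proof (intro equalityI subsetI)
    fix g assume "g \<in> {g \<in> conj_group \<sigma>. g$2$1 = 0}"
    then have g: "g \<in> conj_group \<sigma>" "g$2$1 = 0" by auto
    have gd: "g$1$1 * g$2$2 = 1" using conj_group_closed(1)[OF \<sigma>(1) g(1)] g(2) by (simp add: SL_iff)
    have "\<bar>g$1$1\<bar> \<ge> 1" "\<bar>g$2$2\<bar> \<ge> 1"
      using diag[OF g] diag[OF conj_group_closed(4)[OF \<sigma>(1) g(1)]] g(2) by auto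
    moreover have "\<bar>g$1$1\<bar> * \<bar>g$2$2\<bar> = 1" using gd by (metis abs_1 abs_mult)
    moreover have "\<bar>g$1$1\<bar> * 1 \<le> \<bar>g$1$1\<bar> * \<bar>g$2$2\<bar>" by (rule mult_left_mono) (use calculation in auto)
    ultimately have "\<bar>g$1$1\<bar> = 1" by linarith
    then have "g$1$1 = 1 \<or> g$1$1 = -1" by linarith
    then show "g \<in> {g. \<exists>l::int. g = translation (of_int l * h) \<or> g = - translation (of_int l * h)}"
    proof
      assume a: "g$1$1 = 1"
      then have t: "g = translation (g$1$2)" using g(2) gd by (simp add: mat22_eq_iff)
      then obtain l :: int where "g$1$2 = of_int l * h" using hh[of "g$1$2"] g(1) by auto
      then show ?thesis using t by auto
    next
      assume a: "g$1$1 = -1"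
      then have t: "- g = translation (- g$1$2)" using g(2) gd by (simp add: mat22_eq_iff)
      then obtain l :: int where "- g$1$2 = of_int l * h"
        using hh[of "- g$1$2"] conj_group_closed(2)[OF \<sigma>(1) g(1)] by auto
      then have "g = - translation (of_int l * h)" using t by (metis minus_minus)
      then show ?thesis by blast
    qed
  next
    fix g assume "g \<in> {g. \<exists>l::int. g = translation (of_int l * h) \<or> g = - translation (of_int l * h)}"
    then obtain l :: int where "g = translation (of_int l * h) \<or> g = - translation (of_int l * h)" by blast
    then show "g \<in> {g \<in> conj_group \<sigma>. g$2$1 = 0}"
      using hh conj_group_closed(2)[OF \<sigma>(1)] by auto
  qed
  then have "cusp_scaling \<Gamma> x \<sigma> h" unfolding cusp_scaling_iff using \<sigma> h(1) by blast
  then show ?thesis by (rule that)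
qed

text \<open>Multiplication by translations from both sides keeps the lower left entry \<open>c\<close> and moves the
  diagonal entries to within \<open>h \<bar>c\<bar>\<close> of \<open>1\<close>, which also bounds the upper right entry.\<close>

lemma lower_left_entry_bounded_below:
  assumes \<sigma>: "\<sigma> \<in> SL" and h: "h > 0" "translation h \<in> conj_group \<sigma>"
  shows "\<exists>c0>0. \<forall>g\<in>conj_group \<sigma>. g$2$1 \<noteq> 0 \<longrightarrow> c0 \<le> \<bar>g$2$1\<bar>"
proof -
  have T: "translation (of_int l * h) \<in> conj_group \<sigma>" for l :: int
  proof -
    have nat: "translation (of_nat n * h) \<in> conj_group \<sigma>" for n
    proof (induction n)
      case 0
      have "translation h ** adj22 (translation h) \<in> conj_group \<sigma>"
        by (intro conj_group_closed(3)[OF \<sigma>] conj_group_closed(4)[OF \<sigma>] h(2))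
      also have "translation h ** adj22 (translation h) = translation (of_nat 0 * h)" by (simp add: mat22_eq_iff)
      finally show ?case .
    next
      case (Suc n)
      then have "translation h ** translation (of_nat n * h) \<in> conj_group \<sigma>"
        by (intro conj_group_closed(3)[OF \<sigma>] h(2))
      also have "translation h ** translation (of_nat n * h) = translation (of_nat (Suc n) * h)"
        by (simp add: mat22_eq_iff algebra_simps)
      finally show ?case .
    qed
    show ?thesis
    proof (cases "l \<ge> 0")
      case True then show ?thesis using nat[of "nat l"] by simp
    next
      case False
      have "adj22 (translation (of_nat (nat (- l)) * h)) \<in> conj_group \<sigma>"
        by (intro conj_group_closed(4)[OF \<sigma>] nat)
      also have "adj22 (translation (of_nat (nat (- l)) * h)) = translation (of_int l * h)"
        using False by (simp add: mat22_eq_iff)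
      finally show ?thesis .
    qed
  qed
  \<comment> \<open>The bound for the entries of an element with \<open>\<bar>c\<bar> \<le> 1\<close> after it has been moved by translations.\<close>
  define C where "C = 1 + h + h\<^sup>2 + 2 * h"
  define F where "F = insert 1 ((\<lambda>g. \<bar>g$2$1\<bar>) ` {g \<in> conj_group \<sigma>. entries_le C g} - {0})"
  have F: "finite F" "F \<noteq> {}" unfolding F_def using finite_conj_group_entries_le[OF \<sigma>] by auto
  have "Min F > 0" using F by (auto simp: F_def)
  moreover have "Min F \<le> \<bar>g$2$1\<bar>" if g: "g \<in> conj_group \<sigma>" "g$2$1 \<noteq> 0" for g
  proof (cases "\<bar>g$2$1\<bar> \<le> 1")
    case False
    moreover have "Min F \<le> 1" using F by (simp add: F_def)
    ultimately show ?thesis by linarith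
  next
    case True
    define c where "c = g$2$1"
    have c: "c \<noteq> 0" "\<bar>c\<bar> \<le> 1" using g True by (auto simp: c_def)
    have shift: "\<exists>k::int. \<bar>a + of_int k * h * c - 1\<bar> \<le> h * \<bar>c\<bar>" for a :: real
    proof -
      define q where "q = (a - 1) / (h * c)"
      have "\<bar>q - of_int \<lfloor>q\<rfloor>\<bar> \<le> 1" by linarith
      moreover have "a + of_int (- \<lfloor>q\<rfloor>) * h * c - 1 = (q - of_int \<lfloor>q\<rfloor>) * (h * c)"
      proof -
        have "q * (h * c) = a - 1" using c h(1) by (simp add: q_def)
        then show ?thesis by (simp add: left_diff_distrib mult.assoc)
      qed
      ultimately have "\<bar>a + of_int (- \<lfloor>q\<rfloor>) * h * c - 1\<bar> \<le> 1 * \<bar>h * c\<bar>"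
        by (simp only: abs_mult) (rule mult_right_mono, simp_all)
      then show ?thesis using h(1) by (intro exI[of _ "- \<lfloor>q\<rfloor>"]) (simp add: abs_mult)
    qed
    obtain k where k: "\<bar>g$1$1 + of_int k * h * c - 1\<bar> \<le> h * \<bar>c\<bar>" using shift by blast
    obtain l where l: "\<bar>g$2$2 + of_int l * h * c - 1\<bar> \<le> h * \<bar>c\<bar>" using shift by blast
    define g' where "g' = translation (of_int k * h) ** g ** translation (of_int l * h)"
    have g': "g' \<in> conj_group \<sigma>" "g' \<in> SL"
    proof -
      show "g' \<in> conj_group \<sigma>" unfolding g'_def by (intro conj_group_closed(3)[OF \<sigma>] T g(1))
      then show "g' \<in> SL" by (rule conj_group_closed(1)[OF \<sigma>])
    qed
    have e: "g'$2$1 = c" "\<bar>g'$1$1 - 1\<bar> \<le> h * \<bar>c\<bar>" "\<bar>g'$2$2 - 1\<bar> \<le> h * \<bar>c\<bar>"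
      using k l by (simp_all add: g'_def c_def algebra_simps)
    have hc: "h * \<bar>c\<bar> \<le> h" using c h(1) by (simp add: mult_left_le)
    have "g'$1$2 * c = (g'$1$1 - 1) * (g'$2$2 - 1) + (g'$1$1 - 1) + (g'$2$2 - 1)"
      using g'(2) e(1) by (simp add: SL_iff algebra_simps)
    also have "\<bar>\<dots>\<bar> \<le> \<bar>g'$1$1 - 1\<bar> * \<bar>g'$2$2 - 1\<bar> + \<bar>g'$1$1 - 1\<bar> + \<bar>g'$2$2 - 1\<bar>"
      unfolding abs_mult[symmetric] by linarith
    also have "\<dots> \<le> (h * \<bar>c\<bar>) * h + h * \<bar>c\<bar> + h * \<bar>c\<bar>"
    proof -
      have "\<bar>g'$1$1 - 1\<bar> * \<bar>g'$2$2 - 1\<bar> \<le> (h * \<bar>c\<bar>) * h"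
        by (rule mult_mono) (use e(2,3) hc h(1) in \<open>linarith | simp\<close>)+
      then show ?thesis using e(2,3) by linarith
    qed
    finally have "\<bar>g'$1$2\<bar> * \<bar>c\<bar> \<le> (h\<^sup>2 + 2 * h) * \<bar>c\<bar>"
      by (simp add: abs_mult power2_eq_square algebra_simps)
    then have "\<bar>g'$1$2\<bar> \<le> h\<^sup>2 + 2 * h" using c(1) by simp
    moreover have "h\<^sup>2 \<ge> 0" by simp
    ultimately have "\<bar>g'$1$1\<bar> \<le> C" "\<bar>g'$1$2\<bar> \<le> C" "\<bar>g'$2$1\<bar> \<le> C" "\<bar>g'$2$2\<bar> \<le> C"
      using e hc h(1) c(2) unfolding C_def by linarith+
    then have "entries_le C g'" by (simp only: entries_le_def)
    then have "\<bar>c\<bar> \<in> F" using g'(1) e(1) c(1) unfolding F_def by force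
    then show ?thesis using F(1) by (simp add: c_def)
  qed
  ultimately show ?thesis by blast
qed

lemma cusp_scaling_translation:
  assumes "cusp_scaling \<Gamma> x \<sigma> h"
  shows "translation h \<in> conj_group \<sigma>"
proof -
  have "translation h \<in> {g. \<exists>l::int. g = translation (of_int l * h) \<or> g = - translation (of_int l * h)}"
    by (auto intro!: exI[of _ 1])
  then show ?thesis using assms unfolding cusp_scaling_iff by blast
qed

text \<open>For \<open>g\<close> with lower left entry \<open>c \<noteq> 0\<close> one has \<open>Im (g \<zeta>) \<le> 1 / (c\<^sup>2 Im \<zeta>)\<close>, so that a lower bound \<open>c\<^sub>0\<close>
  for \<open>\<bar>c\<bar>\<close> prevents \<open>\<zeta>\<close> and \<open>g \<zeta>\<close> from both lying above the height \<open>1 / c\<^sub>0\<close>.\<close>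

lemma precisely_invariant_horoball:
  assumes "cusp_scaling \<Gamma> x \<sigma> h"
  obtains T where "T > 0"
    "\<And>\<gamma> z. \<gamma> \<in> \<Gamma> \<Longrightarrow> z \<in> \<H> \<Longrightarrow> Im (moebius \<sigma> z) > T \<Longrightarrow> Im (moebius \<sigma> (moebius \<gamma> z)) > T \<Longrightarrow> emoebius \<gamma> x = x"
proof -
  have \<sigma>: "\<sigma> \<in> SL" "emoebius \<sigma> x = Infty" "h > 0" using assms by (auto simp: cusp_scaling_iff)
  obtain c0 where c0: "c0 > 0" "\<And>g. g \<in> conj_group \<sigma> \<Longrightarrow> g$2$1 \<noteq> 0 \<Longrightarrow> c0 \<le> \<bar>g$2$1\<bar>"
    using lower_left_entry_bounded_below[OF \<sigma>(1,3) cusp_scaling_translation[OF assms]] by blast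
  show ?thesis
  proof (rule that[of "1 / c0"])
    show "1 / c0 > 0" using c0 by simp
    fix \<gamma> z assume a: "\<gamma> \<in> \<Gamma>" "z \<in> \<H>" "Im (moebius \<sigma> z) > 1 / c0" "Im (moebius \<sigma> (moebius \<gamma> z)) > 1 / c0"
    define g where "g = \<sigma> ** \<gamma> ** adj22 \<sigma>"
    define \<zeta> where "\<zeta> = moebius \<sigma> z"
    have g: "g \<in> conj_group \<sigma>" "g \<in> SL" using a \<sigma> by (auto simp: g_def conj_group_def)
    have \<zeta>: "\<zeta> \<in> \<H>" using a \<sigma> by (simp add: \<zeta>_def)
    have "moebius g \<zeta> = moebius \<sigma> (moebius \<gamma> z)"
      using a \<sigma> \<zeta> by (simp add: g_def moebius_mult \<zeta>_def)
    then have Im: "Im \<zeta> > 1 / c0" "Im \<zeta> / (norm (cocycle g \<zeta>))\<^sup>2 > 1 / c0"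
      using a Im_moebius[OF g(2), of \<zeta>] \<zeta> by (auto simp: \<zeta>_def upper_half_plane_iff)
    have "g$2$1 = 0"
    proof (rule ccontr)
      assume "g$2$1 \<noteq> 0"
      then have c: "c0 \<le> \<bar>g$2$1\<bar>" using c0(2) g by blast
      have y: "Im \<zeta> > 0" using \<zeta> by (simp add: upper_half_plane_iff)
      have "c0 * Im \<zeta> \<le> \<bar>g$2$1\<bar> * Im \<zeta>" using c y by simp
      also have "\<dots> = \<bar>Im (cocycle g \<zeta>)\<bar>" using y by (simp add: cocycle_def abs_mult)
      also have "\<dots> \<le> norm (cocycle g \<zeta>)" by (rule abs_Im_le_cmod)
      finally have "(c0 * Im \<zeta>)\<^sup>2 \<le> (norm (cocycle g \<zeta>))\<^sup>2" using c0(1) y by (intro power_mono) auto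
      moreover have "(c0 * Im \<zeta>)\<^sup>2 > 0" using c0(1) y by simp
      ultimately have "Im \<zeta> / (norm (cocycle g \<zeta>))\<^sup>2 \<le> Im \<zeta> / (c0 * Im \<zeta>)\<^sup>2"
        using y by (intro divide_left_mono mult_pos_pos) linarith+
      also have "\<dots> = 1 / c0 * (1 / (c0 * Im \<zeta>))" using y by (simp add: power2_eq_square)
      also have "\<dots> \<le> 1 / c0 * 1"
        using Im(1) c0(1) by (intro mult_left_mono) (auto simp: field_simps)
      finally show False using Im(2) by simp
    qed
    then show "emoebius \<gamma> x = x" using stab_conj[OF \<sigma>(1,2) a(1)] by (simp only: g_def)
  qed
qed

end

section \<open>The charts of the Riemann surface\<close>

context discrete_group
begin

lemma orbit_self [simp]: "x \<in> orbit \<Gamma> x"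
  unfolding orbit_def using emoebius_one one_mem by (metis (mono_tags, lifting) mem_Collect_eq)

lemma orbit_eq_iff: "orbit \<Gamma> x = orbit \<Gamma> y \<longleftrightarrow> (\<exists>\<gamma>\<in>\<Gamma>. y = emoebius \<gamma> x)"
proof
  assume "orbit \<Gamma> x = orbit \<Gamma> y"
  then have "y \<in> orbit \<Gamma> x" by simp
  then show "\<exists>\<gamma>\<in>\<Gamma>. y = emoebius \<gamma> x" unfolding orbit_def by blast
next
  assume "\<exists>\<gamma>\<in>\<Gamma>. y = emoebius \<gamma> x"
  then obtain \<gamma> where \<gamma>: "\<gamma> \<in> \<Gamma>" "y = emoebius \<gamma> x" by blast
  have x: "x = emoebius (adj22 \<gamma>) y" unfolding \<gamma>(2) using \<gamma>(1) by simp
  have sub: "orbit \<Gamma> (emoebius \<delta> w) \<subseteq> orbit \<Gamma> w" if "\<delta> \<in> \<Gamma>" for \<delta> w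
  proof
    fix v assume "v \<in> orbit \<Gamma> (emoebius \<delta> w)"
    then obtain \<eta> where \<eta>: "\<eta> \<in> \<Gamma>" "v = emoebius \<eta> (emoebius \<delta> w)" unfolding orbit_def by blast
    then have "v = emoebius (\<eta> ** \<delta>) w" using that by (simp only: emoebius_mult mem_SL)
    then show "v \<in> orbit \<Gamma> w" unfolding orbit_def using mult_mem[OF \<eta>(1) that] by blast
  qed
  have "orbit \<Gamma> y \<subseteq> orbit \<Gamma> x" unfolding \<gamma>(2) by (rule sub[OF \<gamma>(1)])
  moreover have "orbit \<Gamma> x \<subseteq> orbit \<Gamma> y" by (subst x) (rule sub[OF adj22_mem[OF \<gamma>(1)]])
  ultimately show "orbit \<Gamma> x = orbit \<Gamma> y" by (rule equalityI[rotated])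
qed

lemma orbit_H_eq_iff:
  assumes "z \<in> \<H>"
  shows "orbit \<Gamma> (Fin z) = orbit \<Gamma> (Fin z') \<longleftrightarrow> (\<exists>\<gamma>\<in>\<Gamma>. z' = moebius \<gamma> z)"
  unfolding orbit_eq_iff using assms by (metis ecomplex.inject emoebius_H mem_SL)

lemma orbit_moebius: "\<gamma> \<in> \<Gamma> \<Longrightarrow> z \<in> \<H> \<Longrightarrow> orbit \<Gamma> (Fin (moebius \<gamma> z)) = orbit \<Gamma> (Fin z)"
  using orbit_H_eq_iff by blast

lemma cusps_boundary: "x \<in> cusps \<Gamma> \<Longrightarrow> x \<in> boundary"
  by (auto simp: cusps_def boundary_def)

lemma orbit_cusp_not_H:
  assumes "x \<in> boundary" "z \<in> \<H>"
  shows "orbit \<Gamma> x \<noteq> orbit \<Gamma> (Fin z)"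
proof
  assume "orbit \<Gamma> x = orbit \<Gamma> (Fin z)"
  then obtain \<gamma> where "Fin z = emoebius \<gamma> x" unfolding orbit_eq_iff by blast
  then show False using emoebius_boundary[OF assms(1)] boundary_H assms(2) by metis
qed

text \<open>The two kinds of charts with their coordinates made explicit.  As the disc coordinate takes values
  in the unit disc, radii up to \<open>1\<close> suffice.\<close>

definition interior_chart :: "complex \<Rightarrow> real \<Rightarrow> point set \<Rightarrow> (point \<Rightarrow> complex) \<Rightarrow> bool" where
  "interior_chart \<xi> r U \<phi> \<longleftrightarrow> \<xi> \<in> \<H> \<and> 0 < r \<and> r \<le> 1 \<and>
     U = (\<lambda>z. orbit \<Gamma> (Fin z)) ` {z \<in> \<H>. norm (cayley \<xi> z) < r} \<and> \<phi> \<in> extensional U \<and>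
     (\<forall>z\<in>\<H>. norm (cayley \<xi> z) < r \<longrightarrow> \<phi> (orbit \<Gamma> (Fin z)) = cayley \<xi> z ^ ellip_order \<Gamma> \<xi>) \<and>
     (\<forall>\<gamma>\<in>\<Gamma>. \<forall>z\<in>\<H>. norm (cayley \<xi> z) < r \<longrightarrow> norm (cayley \<xi> (moebius \<gamma> z)) < r \<longrightarrow> moebius \<gamma> \<xi> = \<xi>)"

definition cusp_chart :: "ecomplex \<Rightarrow> mat22 \<Rightarrow> real \<Rightarrow> real \<Rightarrow> point set \<Rightarrow> (point \<Rightarrow> complex) \<Rightarrow> bool" where
  "cusp_chart x \<sigma> h T U \<phi> \<longleftrightarrow> x \<in> cusps \<Gamma> \<and> cusp_scaling \<Gamma> x \<sigma> h \<and> 0 < T \<and>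
     U = insert (orbit \<Gamma> x) ((\<lambda>z. orbit \<Gamma> (Fin z)) ` {z \<in> \<H>. Im (moebius \<sigma> z) > T}) \<and> \<phi> \<in> extensional U \<and>
     \<phi> (orbit \<Gamma> x) = 0 \<and>
     (\<forall>z\<in>\<H>. Im (moebius \<sigma> z) > T \<longrightarrow> \<phi> (orbit \<Gamma> (Fin z)) = qexp h (moebius \<sigma> z)) \<and>
     (\<forall>\<gamma>\<in>\<Gamma>. \<forall>z\<in>\<H>. Im (moebius \<sigma> z) > T \<longrightarrow> Im (moebius \<sigma> (moebius \<gamma> z)) > T \<longrightarrow> emoebius \<gamma> x = x)"

lemma atlas_cases:
  assumes "(U, \<phi>) \<in> atlas \<Gamma>"
  obtains \<xi> r where "interior_chart \<xi> r U \<phi>" | x \<sigma> h T where "cusp_chart x \<sigma> h T U \<phi>"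
proof -
  obtain x N \<tau> where c: "coordinate_nbhd \<Gamma> x N \<tau>"
    "\<And>\<gamma>. \<gamma> \<in> \<Gamma> \<Longrightarrow> emoebius \<gamma> ` N \<inter> N \<noteq> {} \<Longrightarrow> emoebius \<gamma> x = x"
    "U = orbit \<Gamma> ` N" "\<phi> \<in> extensional U" "\<And>y. y \<in> N \<Longrightarrow> \<phi> (orbit \<Gamma> y) = \<tau> y"
    using assms unfolding atlas_def by blast
  from c(1) show ?thesis
  proof cases
    case (interior \<xi> r)
    have lt: "norm (cayley \<xi> z) < r \<longleftrightarrow> norm (cayley \<xi> z) < min r 1" if "z \<in> \<H>" for z
      using norm_cayley_less_1[OF that interior(2)] by simp
    have N: "Fin z \<in> N \<longleftrightarrow> z \<in> \<H> \<and> norm (cayley \<xi> z) < min r 1" for z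
      unfolding interior(4) cayley_def[symmetric] using lt by auto
    have "interior_chart \<xi> (min r 1) U \<phi>"
      unfolding interior_chart_def
    proof (intro conjI ballI impI)
      show "U = (\<lambda>z. orbit \<Gamma> (Fin z)) ` {z \<in> \<H>. norm (cayley \<xi> z) < min r 1}"
        unfolding c(3) interior(4) cayley_def[symmetric] image_image using lt by auto
    next
      fix z assume z: "z \<in> \<H>" "norm (cayley \<xi> z) < min r 1"
      then have "Fin z \<in> N" using N by blast
      then show "\<phi> (orbit \<Gamma> (Fin z)) = cayley \<xi> z ^ ellip_order \<Gamma> \<xi>"
        using c(5) interior(5) by (simp add: cayley_def)
    next
      fix \<gamma> z assume a: "\<gamma> \<in> \<Gamma>" "z \<in> \<H>" "norm (cayley \<xi> z) < min r 1" "norm (cayley \<xi> (moebius \<gamma> z)) < min r 1"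
      then have "Fin z \<in> N" "emoebius \<gamma> (Fin z) \<in> N" using N by simp_all
      then have "emoebius \<gamma> (Fin \<xi>) = Fin \<xi>" using c(2)[OF a(1)] interior(1) by blast
      then show "moebius \<gamma> \<xi> = \<xi>" using a(1) interior(2) by simp
    qed (use interior c(4) in auto)
    then show ?thesis by (rule that(1))
  next
    case (cusp \<sigma> h T)
    have N: "Fin z \<in> N" if "z \<in> \<H>" "Im (moebius \<sigma> z) > T" for z
      using that unfolding cusp(4) by blast
    have "cusp_chart x \<sigma> h T U \<phi>"
      unfolding cusp_chart_def
    proof (intro conjI ballI impI)
      show "U = insert (orbit \<Gamma> x) ((\<lambda>z. orbit \<Gamma> (Fin z)) ` {z \<in> \<H>. T < Im (moebius \<sigma> z)})"
        unfolding c(3) cusp(4) by (simp add: image_image)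
      show "\<phi> (orbit \<Gamma> x) = 0" using c(5)[of x] cusp(4,5) by simp
    next
      fix z assume z: "z \<in> \<H>" "Im (moebius \<sigma> z) > T"
      then show "\<phi> (orbit \<Gamma> (Fin z)) = qexp h (moebius \<sigma> z)"
        using c(5)[OF N[OF z]] cusp(6)[OF z(1) N[OF z]] by (simp add: qexp_def)
    next
      fix \<gamma> z assume a: "\<gamma> \<in> \<Gamma>" "z \<in> \<H>" "T < Im (moebius \<sigma> z)" "T < Im (moebius \<sigma> (moebius \<gamma> z))"
      have "Fin z \<in> N" "Fin (moebius \<gamma> z) \<in> N" using N a by simp_all
      moreover have "emoebius \<gamma> (Fin z) = Fin (moebius \<gamma> z)" using a by simp
      ultimately show "emoebius \<gamma> x = x" using c(2)[OF a(1)] by (metis Int_iff empty_iff imageI)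
    qed (use cusp(1-3) c(4) in auto)
    then show ?thesis by (rule that(2))
  qed
qed

lemma interior_chart_atlas:
  assumes "interior_chart \<xi> r U \<phi>"
  shows "(U, \<phi>) \<in> atlas \<Gamma>"
proof -
  let ?N = "Fin ` {z \<in> \<H>. norm ((z - \<xi>) / (z - cnj \<xi>)) < r}"
  let ?\<tau> = "\<lambda>y. \<phi> (orbit \<Gamma> y)"
  have a: "\<xi> \<in> \<H>" "0 < r" "U = (\<lambda>z. orbit \<Gamma> (Fin z)) ` {z \<in> \<H>. norm (cayley \<xi> z) < r}" "\<phi> \<in> extensional U"
    "\<And>z. z \<in> \<H> \<Longrightarrow> norm (cayley \<xi> z) < r \<Longrightarrow> \<phi> (orbit \<Gamma> (Fin z)) = cayley \<xi> z ^ ellip_order \<Gamma> \<xi>"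
    "\<And>\<gamma> z. \<gamma> \<in> \<Gamma> \<Longrightarrow> z \<in> \<H> \<Longrightarrow> norm (cayley \<xi> z) < r \<Longrightarrow> norm (cayley \<xi> (moebius \<gamma> z)) < r \<Longrightarrow> moebius \<gamma> \<xi> = \<xi>"
    using assms unfolding interior_chart_def by blast+
  have "coordinate_nbhd \<Gamma> (Fin \<xi>) ?N ?\<tau>"
    by (rule coordinate_nbhd.interior[OF a(1,2) refl]) (use a(5) in \<open>auto simp: cayley_def\<close>)
  moreover have "emoebius \<gamma> (Fin \<xi>) = Fin \<xi>" if g: "\<gamma> \<in> \<Gamma>" "emoebius \<gamma> ` ?N \<inter> ?N \<noteq> {}" for \<gamma>
  proof -
    obtain z where z: "z \<in> \<H>" "norm (cayley \<xi> z) < r" "emoebius \<gamma> (Fin z) \<in> ?N"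
      using g(2) unfolding cayley_def by blast
    then have "norm (cayley \<xi> (moebius \<gamma> z)) < r" using g(1) by (auto simp: cayley_def)
    then show ?thesis using a(6)[OF g(1) z(1,2)] g(1) a(1) by simp
  qed
  moreover have "U = orbit \<Gamma> ` ?N" unfolding a(3) cayley_def by (simp add: image_image)
  ultimately show ?thesis unfolding atlas_def using a(4) by blast
qed

lemma cusp_chart_atlas:
  assumes "cusp_chart x \<sigma> h T U \<phi>"
  shows "(U, \<phi>) \<in> atlas \<Gamma>"
proof -
  let ?N = "insert x (Fin ` {z \<in> \<H>. Im (moebius \<sigma> z) > T})"
  let ?\<tau> = "\<lambda>y. \<phi> (orbit \<Gamma> y)"
  have a: "x \<in> cusps \<Gamma>" "cusp_scaling \<Gamma> x \<sigma> h" "0 < T"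
    "U = insert (orbit \<Gamma> x) ((\<lambda>z. orbit \<Gamma> (Fin z)) ` {z \<in> \<H>. Im (moebius \<sigma> z) > T})" "\<phi> \<in> extensional U"
    "\<phi> (orbit \<Gamma> x) = 0" "\<And>z. z \<in> \<H> \<Longrightarrow> Im (moebius \<sigma> z) > T \<Longrightarrow> \<phi> (orbit \<Gamma> (Fin z)) = qexp h (moebius \<sigma> z)"
    "\<And>\<gamma> z. \<gamma> \<in> \<Gamma> \<Longrightarrow> z \<in> \<H> \<Longrightarrow> Im (moebius \<sigma> z) > T \<Longrightarrow> Im (moebius \<sigma> (moebius \<gamma> z)) > T \<Longrightarrow> emoebius \<gamma> x = x"
    using assms unfolding cusp_chart_def by blast+
  have xb: "x \<in> boundary" by (rule cusps_boundary[OF a(1)])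
  have "coordinate_nbhd \<Gamma> x ?N ?\<tau>"
  proof (rule coordinate_nbhd.cusp[OF a(1-3) refl])
    show "\<phi> (orbit \<Gamma> x) = 0" by (rule a(6))
  next
    fix z assume z: "z \<in> \<H>" "Fin z \<in> ?N"
    then have "Im (moebius \<sigma> z) > T" using xb boundary_H by auto
    then show "\<phi> (orbit \<Gamma> (Fin z)) = exp (2 * complex_of_real pi * \<i> * moebius \<sigma> z / complex_of_real h)"
      using a(7) z by (simp add: qexp_def)
  qed
  moreover have "emoebius \<gamma> x = x" if g: "\<gamma> \<in> \<Gamma>" "emoebius \<gamma> ` ?N \<inter> ?N \<noteq> {}" for \<gamma>
  proof -
    obtain y where y: "y \<in> ?N" "emoebius \<gamma> y \<in> ?N" using g(2) by blast
    show ?thesis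
    proof (cases "y = x")
      case True
      have b: "emoebius \<gamma> x \<in> boundary" by (rule emoebius_boundary[OF xb])
      from y(2) have "emoebius \<gamma> x \<in> ?N" unfolding True .
      then consider "emoebius \<gamma> x = x" | z where "emoebius \<gamma> x = Fin z" "z \<in> \<H>" by blast
      then show ?thesis using b boundary_H by cases auto
    next
      case False
      then obtain z where z: "y = Fin z" "z \<in> \<H>" "Im (moebius \<sigma> z) > T" using y(1) by blast
      then have "emoebius \<gamma> y = Fin (moebius \<gamma> z)" "moebius \<gamma> z \<in> \<H>" using g(1) by simp_all
      then have "Im (moebius \<sigma> (moebius \<gamma> z)) > T" using y(2) xb boundary_H by auto
      then show ?thesis using a(8)[OF g(1) z(2,3)] by blast
    qed
  qed
  moreover have "U = orbit \<Gamma> ` ?N" unfolding a(4) by (simp add: image_image)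
  ultimately show ?thesis unfolding atlas_def using a(5) by blast
qed

text \<open>Two points of a small disc around \<open>\<xi>\<close> in the same orbit differ by an element of the stabiliser, which
  multiplies the disc coordinate by a root of unity whose order divides the exponent of the coordinate.
  Hence the coordinate is well defined on orbits.\<close>

lemma interior_chart_exists:
  assumes \<xi>: "\<xi> \<in> \<H>"
  obtains r U \<phi> where "interior_chart \<xi> r U \<phi>"
proof -
  obtain r where r: "r > 0" "r < 1" "\<And>\<gamma> z. \<gamma> \<in> \<Gamma> \<Longrightarrow> z \<in> \<H> \<Longrightarrow> norm (cayley \<xi> z) < r \<Longrightarrow>
      norm (cayley \<xi> (moebius \<gamma> z)) < r \<Longrightarrow> moebius \<gamma> \<xi> = \<xi>"
    using properly_discontinuous[OF \<xi>] by blast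
  let ?N = "{z \<in> \<H>. norm (cayley \<xi> z) < r}" and ?o = "\<lambda>z. orbit \<Gamma> (Fin z)" and ?e = "ellip_order \<Gamma> \<xi>"
  let ?U = "?o ` ?N"
  define \<phi> where "\<phi> = (\<lambda>a. if a \<in> ?U then cayley \<xi> (SOME z. z \<in> ?N \<and> a = ?o z) ^ ?e else undefined)"
  have \<phi>: "\<phi> (?o z) = cayley \<xi> z ^ ?e" if z: "z \<in> ?N" for z
  proof -
    let ?w = "SOME w. w \<in> ?N \<and> ?o z = ?o w"
    have w: "?w \<in> ?N \<and> ?o z = ?o ?w" by (rule someI[of _ z]) (use z in simp)
    have zH: "z \<in> \<H>" using z by blast
    obtain \<gamma> where \<gamma>: "\<gamma> \<in> \<Gamma>" "?w = moebius \<gamma> z"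
      using w orbit_H_eq_iff[OF zH] by blast
    have fixed: "moebius \<gamma> \<xi> = \<xi>" using r(3)[OF \<gamma>(1) zH] z w unfolding \<gamma>(2)[symmetric] by blast
    then have "rotation_factor \<xi> \<gamma> \<in> rotation_factor \<xi> ` stab \<Gamma> (Fin \<xi>)"
      using \<gamma>(1) by (intro imageI) (simp add: stab_H[OF \<xi>])
    then have "rotation_factor \<xi> \<gamma> ^ ?e = 1" unfolding rotations_of_stab(2)[OF \<xi>] by simp
    then have "cayley \<xi> ?w ^ ?e = cayley \<xi> z ^ ?e"
      unfolding \<gamma>(2) by (simp only: cayley_moebius[OF mem_SL[OF \<gamma>(1)] \<xi> fixed zH] power_mult_distrib mult_1)
    moreover have inU: "?o z \<in> ?U" using z by blast
    have "\<phi> (?o z) = cayley \<xi> ?w ^ ?e" unfolding \<phi>_def by (simp only: inU if_True)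
    ultimately show ?thesis by simp
  qed
  have "interior_chart \<xi> r ?U \<phi>"
    unfolding interior_chart_def using \<xi> r \<phi> by (auto simp: extensional_def \<phi>_def)
  then show ?thesis by (rule that)
qed

text \<open>The second equation, between squares, is what the ambiguity of the sign leaves of the cocycle
  relation; it is all that forms of even weight depend on.\<close>

lemma stab_cusp_translation:
  assumes "cusp_scaling \<Gamma> x \<sigma> h" "\<gamma> \<in> \<Gamma>" "emoebius \<gamma> x = x" "z \<in> \<H>"
  obtains l :: int where "moebius \<sigma> (moebius \<gamma> z) = moebius \<sigma> z + of_real (of_int l * h)"
    "(cocycle \<sigma> (moebius \<gamma> z) * cocycle \<gamma> z)\<^sup>2 = (cocycle \<sigma> z)\<^sup>2"
proof -
  have \<sigma>: "\<sigma> \<in> SL" "emoebius \<sigma> x = Infty" using assms(1) by (auto simp: cusp_scaling_iff)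
  let ?g = "\<sigma> ** \<gamma> ** adj22 \<sigma>"
  have "?g \<in> {g \<in> conj_group \<sigma>. g$2$1 = 0}"
    using stab_conj[OF \<sigma> assms(2)] assms(2,3) unfolding conj_group_def by blast
  then obtain l :: int where l: "?g = translation (of_int l * h) \<or> ?g = - translation (of_int l * h)"
    using assms(1) unfolding cusp_scaling_iff by blast
  have g: "?g ** \<sigma> = \<sigma> ** \<gamma>" by (rule conj_adj22(4)[OF \<sigma>(1)])
  have nz: "cocycle \<sigma> z \<noteq> 0" "cocycle \<gamma> z \<noteq> 0" using \<sigma> assms by simp_all
  have "moebius \<sigma> (moebius \<gamma> z) = moebius (?g ** \<sigma>) z" unfolding g using nz by (simp add: moebius_mult)
  also have "\<dots> = moebius ?g (moebius \<sigma> z)" by (rule moebius_mult[OF nz(1)])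
  also have "\<dots> = moebius \<sigma> z + of_real (of_int l * h)"
    using l by (elim disjE) (simp_all only: moebius_uminus moebius_translation)
  finally have 1: "moebius \<sigma> (moebius \<gamma> z) = moebius \<sigma> z + of_real (of_int l * h)" .
  have "cocycle \<sigma> (moebius \<gamma> z) * cocycle \<gamma> z = cocycle (?g ** \<sigma>) z"
    unfolding g by (rule cocycle_mult[OF nz(2), symmetric])
  also have "\<dots> = cocycle ?g (moebius \<sigma> z) * cocycle \<sigma> z" by (rule cocycle_mult[OF nz(1)])
  finally have "(cocycle \<sigma> (moebius \<gamma> z) * cocycle \<gamma> z)\<^sup>2 = (cocycle ?g (moebius \<sigma> z))\<^sup>2 * (cocycle \<sigma> z)\<^sup>2"
    by (simp only: power_mult_distrib)
  moreover have "(cocycle ?g (moebius \<sigma> z))\<^sup>2 = 1"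
    using l
  proof
    assume "?g = translation (of_int l * h)"
    then show ?thesis by (simp only: cocycle_translation power_one)
  next
    assume "?g = - translation (of_int l * h)"
    moreover have "cocycle (- translation (of_int l * h)) w = - 1" for w by (simp add: cocycle_def)
    ultimately show ?thesis by simp
  qed
  ultimately have "(cocycle \<sigma> (moebius \<gamma> z) * cocycle \<gamma> z)\<^sup>2 = (cocycle \<sigma> z)\<^sup>2" by simp
  then show ?thesis by (rule that[OF 1])
qed

lemma translation_from_stab:
  assumes "cusp_scaling \<Gamma> x \<sigma> h" "z \<in> \<H>" "z' \<in> \<H>"
    "moebius \<sigma> z' = moebius \<sigma> z + of_real (of_int l * h)"
  obtains \<gamma> where "\<gamma> \<in> \<Gamma>" "emoebius \<gamma> x = x" "z' = moebius \<gamma> z"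
proof -
  have \<sigma>: "\<sigma> \<in> SL" "emoebius \<sigma> x = Infty" using assms(1) by (auto simp: cusp_scaling_iff)
  have "translation (of_int l * h) \<in> {g. \<exists>l::int. g = translation (of_int l * h) \<or> g = - translation (of_int l * h)}"
    by blast
  then have "translation (of_int l * h) \<in> conj_group \<sigma>"
    using assms(1) unfolding cusp_scaling_iff by blast
  then obtain \<gamma> where \<gamma>: "\<gamma> \<in> \<Gamma>" and
    g: "translation (of_int l * h) = \<sigma> ** \<gamma> ** adj22 \<sigma> \<or> translation (of_int l * h) = - (\<sigma> ** \<gamma> ** adj22 \<sigma>)"
    unfolding conj_group_def by blast
  let ?g = "\<sigma> ** \<gamma> ** adj22 \<sigma>"
  have "?g$2$1 = translation (of_int l * h)$2$1 \<or> ?g$2$1 = - translation (of_int l * h)$2$1"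
    using g by (metis minus_minus vector_uminus_component)
  then have stab: "emoebius \<gamma> x = x"
    using stab_conj[OF \<sigma> \<gamma>] by simp
  have nz: "cocycle \<sigma> z \<noteq> 0" "cocycle \<gamma> z \<noteq> 0" using \<sigma> \<gamma> assms by simp_all
  have "moebius \<sigma> (moebius \<gamma> z) = moebius (?g ** \<sigma>) z"
    unfolding conj_adj22(4)[OF \<sigma>(1)] using nz by (simp add: moebius_mult)
  also have "\<dots> = moebius ?g (moebius \<sigma> z)" by (rule moebius_mult[OF nz(1)])
  also have "\<dots> = moebius (translation (of_int l * h)) (moebius \<sigma> z)"
    using g by (elim disjE) (simp_all only: moebius_uminus)
  also have "\<dots> = moebius \<sigma> z'" unfolding assms(4) by (rule moebius_translation)
  finally have "moebius (adj22 \<sigma>) (moebius \<sigma> (moebius \<gamma> z)) = moebius (adj22 \<sigma>) (moebius \<sigma> z')" by simp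
  then have "z' = moebius \<gamma> z" using \<sigma>(1) \<gamma> assms(2,3) by simp
  then show ?thesis using that \<gamma> stab by blast
qed

text \<open>Two points of a high horoball in the same orbit differ by a translation by a multiple of \<open>h\<close> in the
  coordinate \<open>\<sigma> z\<close>, which the exponential does not see.\<close>

lemma cusp_chart_exists:
  assumes x: "x \<in> cusps \<Gamma>" and sc: "cusp_scaling \<Gamma> x \<sigma> h"
  obtains T U \<phi> where "cusp_chart x \<sigma> h T U \<phi>"
proof -
  have h: "h > 0" using sc by (simp add: cusp_scaling_iff)
  obtain T where T: "T > 0" "\<And>\<gamma> z. \<gamma> \<in> \<Gamma> \<Longrightarrow> z \<in> \<H> \<Longrightarrow> Im (moebius \<sigma> z) > T \<Longrightarrow>
      Im (moebius \<sigma> (moebius \<gamma> z)) > T \<Longrightarrow> emoebius \<gamma> x = x"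
    using precisely_invariant_horoball[OF sc] by blast
  let ?N = "{z \<in> \<H>. Im (moebius \<sigma> z) > T}" and ?o = "\<lambda>z. orbit \<Gamma> (Fin z)"
  let ?U = "insert (orbit \<Gamma> x) (?o ` ?N)"
  define \<phi> where "\<phi> = (\<lambda>a. if a \<in> ?o ` ?N then qexp h (moebius \<sigma> (SOME z. z \<in> ?N \<and> a = ?o z))
     else if a = orbit \<Gamma> x then 0 else undefined)"
  have \<phi>: "\<phi> (?o z) = qexp h (moebius \<sigma> z)" if z: "z \<in> ?N" for z
  proof -
    let ?w = "SOME w. w \<in> ?N \<and> ?o z = ?o w"
    have w: "?w \<in> ?N \<and> ?o z = ?o ?w" by (rule someI[of _ z]) (use z in simp)
    have zH: "z \<in> \<H>" using z by blast
    obtain \<gamma> where \<gamma>: "\<gamma> \<in> \<Gamma>" "?w = moebius \<gamma> z"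
      using w orbit_H_eq_iff[OF zH] by blast
    have fixed: "emoebius \<gamma> x = x" using T(2)[OF \<gamma>(1) zH] z w unfolding \<gamma>(2)[symmetric] by blast
    obtain l :: int where l: "moebius \<sigma> (moebius \<gamma> z) = moebius \<sigma> z + of_real (of_int l * h)"
      using stab_cusp_translation[OF sc \<gamma>(1) fixed zH] by blast
    have "qexp h (moebius \<sigma> z) = qexp h (moebius \<sigma> ?w)"
      unfolding qexp_eq_iff[OF h] \<gamma>(2) l by blast
    moreover have inU: "?o z \<in> ?o ` ?N" using z by blast
    have "\<phi> (?o z) = qexp h (moebius \<sigma> ?w)" unfolding \<phi>_def by (simp only: inU if_True)
    ultimately show ?thesis by simp
  qed
  have ne: "orbit \<Gamma> x \<notin> ?o ` ?N" using orbit_cusp_not_H[OF cusps_boundary[OF x]] by blast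
  have "cusp_chart x \<sigma> h T ?U \<phi>"
    unfolding cusp_chart_def
  proof (intro conjI ballI impI)
    show "\<phi> (orbit \<Gamma> x) = 0" using ne by (simp add: \<phi>_def)
    show "\<phi> \<in> extensional ?U" by (auto simp: extensional_def \<phi>_def)
  qed (use x sc T \<phi> in auto)
  then show ?thesis by (rule that)
qed

text \<open>The coordinate of a chart as a function on the part \<open>chart_dom\<close> of \<open>\<H>\<close> that lies over the chart.\<close>

definition lift :: "(point \<Rightarrow> complex) \<Rightarrow> complex \<Rightarrow> complex" where
  "lift \<phi> = (\<lambda>w. \<phi> (orbit \<Gamma> (Fin w)))"

definition chart_dom :: "point set \<Rightarrow> complex set" where
  "chart_dom U = {z \<in> \<H>. orbit \<Gamma> (Fin z) \<in> U}"

text \<open>What the two kinds of charts have in common.  On the set \<open>N\<close> of representatives the lifted coordinate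
  is given by an explicit formula; its derivative can vanish only over the centre, where the
  coordinate is \<open>0\<close>.  The centre need not lie under \<open>N\<close>, since it may be a cusp.\<close>

definition chart_data :: "point set \<Rightarrow> (point \<Rightarrow> complex) \<Rightarrow> complex set \<Rightarrow> real \<Rightarrow> bool" where
  "chart_data U \<phi> N \<rho> \<longleftrightarrow> open N \<and> N \<subseteq> \<H> \<and>
     (\<forall>z\<in>N. orbit \<Gamma> (Fin z) \<in> U) \<and> (\<forall>a\<in>U. \<phi> a \<noteq> 0 \<longrightarrow> (\<exists>z\<in>N. a = orbit \<Gamma> (Fin z))) \<and>
     (\<forall>z\<in>\<H>. orbit \<Gamma> (Fin z) \<in> U \<longrightarrow> (\<exists>y\<in>N. orbit \<Gamma> (Fin z) = orbit \<Gamma> (Fin y))) \<and>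
     lift \<phi> holomorphic_on N \<and> (\<forall>z\<in>N. lift \<phi> z \<noteq> 0 \<longrightarrow> deriv (lift \<phi>) z \<noteq> 0) \<and>
     inj_on \<phi> U \<and> \<rho> > 0 \<and> \<phi> ` U = ball 0 \<rho>"

lemma open_cayley_disc:
  assumes "\<xi> \<in> \<H>"
  shows "open {z \<in> \<H>. norm (cayley \<xi> z) < r}"
proof -
  have "{z \<in> \<H>. norm (cayley \<xi> z) < r} = \<H> \<inter> cayley \<xi> -` ball 0 r" by auto
  moreover have "open (\<H> \<inter> cayley \<xi> -` ball 0 r)"
    by (intro continuous_open_preimage holomorphic_on_imp_continuous_on cayley_holomorphic assms) auto
  ultimately show ?thesis by simp
qed

lemma interior_chart_lift:
  assumes c: "interior_chart \<xi> r U \<phi>" and z: "z \<in> \<H>" "norm (cayley \<xi> z) < r"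
  shows "z \<in> chart_dom U" "lift \<phi> z = cayley \<xi> z ^ ellip_order \<Gamma> \<xi>"
    "(lift \<phi> has_field_derivative
       of_nat (ellip_order \<Gamma> \<xi>) * cayley \<xi> z ^ (ellip_order \<Gamma> \<xi> - 1) * deriv (cayley \<xi>) z) (at z)"
proof -
  let ?N = "{z \<in> \<H>. norm (cayley \<xi> z) < r}" and ?e = "ellip_order \<Gamma> \<xi>"
  have a: "\<xi> \<in> \<H>" "U = (\<lambda>z. orbit \<Gamma> (Fin z)) ` ?N"
    "\<And>z. z \<in> ?N \<Longrightarrow> \<phi> (orbit \<Gamma> (Fin z)) = cayley \<xi> z ^ ?e"
    using c unfolding interior_chart_def by blast+
  have zN: "z \<in> ?N" using z by blast
  show "z \<in> chart_dom U" using zN unfolding chart_dom_def a(2) by blast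
  have L: "lift \<phi> w = cayley \<xi> w ^ ?e" if "w \<in> ?N" for w using a(3)[OF that] by (simp add: lift_def)
  then show "lift \<phi> z = cayley \<xi> z ^ ?e" using zN by blast
  have "(cayley \<xi> has_field_derivative deriv (cayley \<xi>) z) (at z)"
    using cayley_holomorphic[OF a(1)] z holomorphic_derivI open_upper_half_plane by blast
  then have "((\<lambda>z. cayley \<xi> z ^ ?e) has_field_derivative
      of_nat ?e * cayley \<xi> z ^ (?e - 1) * deriv (cayley \<xi>) z) (at z)"
    by (auto intro!: derivative_eq_intros)
  then show "(lift \<phi> has_field_derivative of_nat ?e * cayley \<xi> z ^ (?e - 1) * deriv (cayley \<xi>) z) (at z)"
    by (rule has_field_derivative_transform_within_open[OF _ open_cayley_disc[OF a(1)] zN]) (rule L[symmetric])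
qed

lemma open_horoball:
  assumes "\<sigma> \<in> SL"
  shows "open {z \<in> \<H>. Im (moebius \<sigma> z) > T}"
proof -
  have "{z \<in> \<H>. Im (moebius \<sigma> z) > T} = \<H> \<inter> moebius \<sigma> -` {z. Im z > T}" by auto
  moreover have "open (\<H> \<inter> moebius \<sigma> -` {z. Im z > T})"
    by (intro continuous_open_preimage holomorphic_on_imp_continuous_on moebius_holomorphic assms)
       (auto simp: open_halfspace_Im_gt)
  ultimately show ?thesis by simp
qed

lemma cusp_chart_lift:
  assumes c: "cusp_chart x \<sigma> h T U \<phi>" and z: "z \<in> \<H>" "Im (moebius \<sigma> z) > T"
  shows "z \<in> chart_dom U" "lift \<phi> z = qexp h (moebius \<sigma> z)"
    "(lift \<phi> has_field_derivative
       2 * of_real pi * \<i> / of_real h * qexp h (moebius \<sigma> z) * (1 / (cocycle \<sigma> z)\<^sup>2)) (at z)"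
proof -
  let ?N = "{z \<in> \<H>. Im (moebius \<sigma> z) > T}"
  have a: "cusp_scaling \<Gamma> x \<sigma> h" "U = insert (orbit \<Gamma> x) ((\<lambda>z. orbit \<Gamma> (Fin z)) ` ?N)"
    "\<And>z. z \<in> ?N \<Longrightarrow> \<phi> (orbit \<Gamma> (Fin z)) = qexp h (moebius \<sigma> z)"
    using c unfolding cusp_chart_def by blast+
  have \<sigma>: "\<sigma> \<in> SL" "h > 0" using a(1) by (auto simp: cusp_scaling_iff)
  have zN: "z \<in> ?N" using z by blast
  show "z \<in> chart_dom U" using zN unfolding chart_dom_def a(2) by blast
  have L: "lift \<phi> w = qexp h (moebius \<sigma> w)" if "w \<in> ?N" for w using a(3)[OF that] by (simp add: lift_def)
  then show "lift \<phi> z = qexp h (moebius \<sigma> z)" using zN by blast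
  have "((\<lambda>z. qexp h (moebius \<sigma> z)) has_field_derivative
      2 * of_real pi * \<i> / of_real h * qexp h (moebius \<sigma> z) * (1 / (cocycle \<sigma> z)\<^sup>2)) (at z)"
    by (rule DERIV_chain2[OF has_field_derivative_qexp[OF \<sigma>(2)] has_field_derivative_moebius[OF \<sigma>(1)]])
       (use z \<sigma>(1) in auto)
  then show "(lift \<phi> has_field_derivative
      2 * of_real pi * \<i> / of_real h * qexp h (moebius \<sigma> z) * (1 / (cocycle \<sigma> z)\<^sup>2)) (at z)"
    by (rule has_field_derivative_transform_within_open[OF _ open_horoball[OF \<sigma>(1)] zN]) (rule L[symmetric])
qed

text \<open>Equality of powers \<open>w\<^sup>e = w'\<^sup>e\<close> of disc coordinates means that \<open>w' / w\<close> is a root of unity of order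
  dividing \<open>e\<close>; as all of these come from the stabiliser, the coordinate is injective on orbits.\<close>

lemma interior_chart_data:
  assumes "interior_chart \<xi> r U \<phi>"
  shows "chart_data U \<phi> {z \<in> \<H>. norm (cayley \<xi> z) < r} (r ^ ellip_order \<Gamma> \<xi>)"
proof -
  let ?N = "{z \<in> \<H>. norm (cayley \<xi> z) < r}" and ?e = "ellip_order \<Gamma> \<xi>"
  have a: "\<xi> \<in> \<H>" "0 < r" "r \<le> 1" "U = (\<lambda>z. orbit \<Gamma> (Fin z)) ` ?N"
    "\<And>z. z \<in> ?N \<Longrightarrow> \<phi> (orbit \<Gamma> (Fin z)) = cayley \<xi> z ^ ?e"
    using assms unfolding interior_chart_def by blast+
  have e: "?e > 0" by (rule rotations_of_stab(1)[OF a(1)])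
  have op: "open ?N" by (rule open_cayley_disc[OF a(1)])
  note L = interior_chart_lift(2)[OF assms] and D = interior_chart_lift(3)[OF assms]
  have inj: "inj_on \<phi> U"
  proof (rule inj_onI)
    fix s t assume st: "s \<in> U" "t \<in> U" "\<phi> s = \<phi> t"
    then obtain z w where zw: "z \<in> ?N" "w \<in> ?N" "s = orbit \<Gamma> (Fin z)" "t = orbit \<Gamma> (Fin w)"
      unfolding a(4) by blast
    have p: "cayley \<xi> z ^ ?e = cayley \<xi> w ^ ?e" using st(3) a(5) zw by simp
    have H: "z \<in> \<H>" "w \<in> \<H>" using zw by auto
    show "s = t"
    proof (cases "cayley \<xi> z = 0")
      case True
      then have "cayley \<xi> w = 0" using p e by (simp add: power_0_left)
      then have "z = w" using True cayley_eq_0 H a(1) by simp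
      then show ?thesis using zw by simp
    next
      case False
      then have "(cayley \<xi> w / cayley \<xi> z) ^ ?e = 1" by (simp add: power_divide p[symmetric])
      then have "cayley \<xi> w / cayley \<xi> z \<in> rotation_factor \<xi> ` stab \<Gamma> (Fin \<xi>)"
        unfolding rotations_of_stab(2)[OF a(1)] by simp
      then obtain \<gamma> where \<gamma>: "\<gamma> \<in> \<Gamma>" "moebius \<gamma> \<xi> = \<xi>" "cayley \<xi> w / cayley \<xi> z = rotation_factor \<xi> \<gamma>"
        unfolding stab_H[OF a(1)] by blast
      have "cayley \<xi> (moebius \<gamma> z) = cayley \<xi> w"
        unfolding cayley_moebius[OF mem_SL[OF \<gamma>(1)] a(1) \<gamma>(2) H(1)] \<gamma>(3)[symmetric] using False by simp
      then have "moebius \<gamma> z = w" using cayley_inject H a(1) \<gamma>(1) by simp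
      then show ?thesis using zw orbit_moebius[OF \<gamma>(1) H(1)] by simp
    qed
  qed
  have im: "\<phi> ` U = ball 0 (r ^ ?e)"
  proof (intro equalityI subsetI)
    fix u assume "u \<in> \<phi> ` U"
    then obtain z where "z \<in> ?N" "u = cayley \<xi> z ^ ?e" unfolding a(4) using a(5) by auto
    then show "u \<in> ball 0 (r ^ ?e)" using e by (auto simp: norm_power intro!: power_strict_mono)
  next
    fix u :: complex assume u: "u \<in> ball 0 (r ^ ?e)"
    obtain v where v: "u = v ^ ?e" using exists_complex_root[of ?e u] e by auto
    have "norm v ^ ?e < r ^ ?e" using u by (simp add: v norm_power)
    then have vr: "norm v < r" by (rule power_less_imp_less_base) (use a(2) in simp)
    then obtain z where "z \<in> \<H>" "cayley \<xi> z = v" using cayley_surj[OF a(1), of v] a(3) by auto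
    then have "z \<in> ?N" "\<phi> (orbit \<Gamma> (Fin z)) = u" using vr a(5) v by auto
    then show "u \<in> \<phi> ` U" unfolding a(4) by blast
  qed
  show ?thesis unfolding chart_data_def
  proof (intro conjI ballI impI)
    show "lift \<phi> holomorphic_on ?N" unfolding holomorphic_on_open[OF op] using D by blast
    show "deriv (lift \<phi>) z \<noteq> 0" if "z \<in> ?N" "lift \<phi> z \<noteq> 0" for z
    proof -
      have z: "z \<in> \<H>" "norm (cayley \<xi> z) < r" using that(1) by auto
      have "cayley \<xi> z \<noteq> 0" using L[OF z] that(2) e by auto
      moreover have "deriv (cayley \<xi>) z \<noteq> 0" using z(1) a(1) deriv_cayley_nonzero by blast
      ultimately show ?thesis using DERIV_imp_deriv[OF D[OF z]] e by simp
    qed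
  qed (use op a inj im in auto)
qed

lemma cusp_chart_data:
  assumes "cusp_chart x \<sigma> h T U \<phi>"
  shows "chart_data U \<phi> {z \<in> \<H>. Im (moebius \<sigma> z) > T} (exp (- (2 * pi * T / h)))"
proof -
  let ?N = "{z \<in> \<H>. Im (moebius \<sigma> z) > T}"
  have a: "x \<in> cusps \<Gamma>" "cusp_scaling \<Gamma> x \<sigma> h" "T > 0" "U = insert (orbit \<Gamma> x) ((\<lambda>z. orbit \<Gamma> (Fin z)) ` ?N)"
    "\<phi> (orbit \<Gamma> x) = 0" "\<And>z. z \<in> ?N \<Longrightarrow> \<phi> (orbit \<Gamma> (Fin z)) = qexp h (moebius \<sigma> z)"
    using assms unfolding cusp_chart_def by blast+
  have \<sigma>: "\<sigma> \<in> SL" "h > 0" using a(2) by (auto simp: cusp_scaling_iff)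
  have op: "open ?N" by (rule open_horoball[OF \<sigma>(1)])
  note D = cusp_chart_lift(3)[OF assms]
  have inj: "inj_on \<phi> U"
  proof (rule inj_onI)
    fix s t assume st: "s \<in> U" "t \<in> U" "\<phi> s = \<phi> t"
    have nz: "\<phi> b \<noteq> 0" if "b \<in> U" "b \<noteq> orbit \<Gamma> x" for b using that a(6) unfolding a(4) by auto
    show "s = t"
    proof (cases "s = orbit \<Gamma> x \<or> t = orbit \<Gamma> x")
      case True
      then show ?thesis using st nz a(5) by metis
    next
      case False
      then obtain z w where zw: "z \<in> ?N" "w \<in> ?N" "s = orbit \<Gamma> (Fin z)" "t = orbit \<Gamma> (Fin w)"
        using st(1,2) unfolding a(4) by blast
      have H: "z \<in> \<H>" "w \<in> \<H>" using zw by auto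
      have "qexp h (moebius \<sigma> z) = qexp h (moebius \<sigma> w)" using st(3) a(6) zw by simp
      then obtain l :: int where "moebius \<sigma> w = moebius \<sigma> z + of_real (of_int l * h)"
        unfolding qexp_eq_iff[OF \<sigma>(2)] by blast
      then obtain \<gamma> where "\<gamma> \<in> \<Gamma>" "w = moebius \<gamma> z"
        using translation_from_stab[OF a(2) H] by blast
      then show ?thesis using zw orbit_moebius[OF _ H(1)] by simp
    qed
  qed
  have im: "\<phi> ` U = ball 0 (exp (- (2 * pi * T / h)))"
  proof (intro equalityI subsetI)
    fix u assume "u \<in> \<phi> ` U"
    then consider "u = 0" | z where "z \<in> ?N" "u = qexp h (moebius \<sigma> z)" unfolding a(4) using a(5,6) by auto
    then show "u \<in> ball 0 (exp (- (2 * pi * T / h)))"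
    proof cases
      case 2
      then show ?thesis using \<sigma>(2) by (simp add: norm_qexp divide_strict_right_mono)
    qed simp
  next
    fix u :: complex assume u: "u \<in> ball 0 (exp (- (2 * pi * T / h)))"
    show "u \<in> \<phi> ` U"
    proof (cases "u = 0")
      case True
      then show ?thesis using a(4,5) by (metis image_eqI insertI1)
    next
      case False
      then obtain \<zeta> where \<zeta>: "qexp h \<zeta> = u" "Im \<zeta> > T" using qexp_surj[OF \<sigma>(2) False, of T] u by auto
      then have "\<zeta> \<in> \<H>" using a(3) by (simp add: upper_half_plane_iff)
      then have z: "moebius (adj22 \<sigma>) \<zeta> \<in> ?N" "moebius \<sigma> (moebius (adj22 \<sigma>) \<zeta>) = \<zeta>" using \<sigma>(1) \<zeta> by simp_all
      then have "\<phi> (orbit \<Gamma> (Fin (moebius (adj22 \<sigma>) \<zeta>))) = u" using a(6)[OF z(1)] \<zeta>(1) by simp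
      then show ?thesis using z(1) unfolding a(4) by blast
    qed
  qed
  have xb: "x \<in> boundary" by (rule cusps_boundary[OF a(1)])
  show ?thesis unfolding chart_data_def
  proof (intro conjI ballI impI)
    show "lift \<phi> holomorphic_on ?N" unfolding holomorphic_on_open[OF op] using D by blast
    show "deriv (lift \<phi>) z \<noteq> 0" if "z \<in> ?N" "lift \<phi> z \<noteq> 0" for z
    proof -
      have z: "z \<in> \<H>" "Im (moebius \<sigma> z) > T" using that(1) by auto
      show ?thesis using DERIV_imp_deriv[OF D[OF z]] \<sigma> z(1) by simp
    qed
    show "\<exists>y\<in>?N. orbit \<Gamma> (Fin z) = orbit \<Gamma> (Fin y)" if "z \<in> \<H>" "orbit \<Gamma> (Fin z) \<in> U" for z
      using that orbit_cusp_not_H[OF xb that(1)] unfolding a(4) by auto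
    show "\<exists>z\<in>?N. b = orbit \<Gamma> (Fin z)" if "b \<in> U" "\<phi> b \<noteq> 0" for b
      using that a(5) unfolding a(4) by auto
  qed (use op a inj im in auto)
qed

lemma chart_data_exists:
  assumes "(U, \<phi>) \<in> atlas \<Gamma>"
  obtains N \<rho> where "chart_data U \<phi> N \<rho>"
  using assms by (rule atlas_cases) (use interior_chart_data cusp_chart_data that in blast)+

end

section \<open>Coordinate changes\<close>

context discrete_group
begin

lemma chart_dom_subset: "chart_dom U \<subseteq> \<H>"
  by (auto simp: chart_dom_def)

lemma lift_moebius: "\<gamma> \<in> \<Gamma> \<Longrightarrow> z \<in> \<H> \<Longrightarrow> lift \<phi> (moebius \<gamma> z) = lift \<phi> z"
  by (simp add: lift_def orbit_moebius)

lemma chart_dom_moebius: "\<gamma> \<in> \<Gamma> \<Longrightarrow> z \<in> \<H> \<Longrightarrow> moebius \<gamma> z \<in> chart_dom U \<longleftrightarrow> z \<in> chart_dom U"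
  by (simp add: chart_dom_def orbit_moebius)

context
  fixes U \<phi> N \<rho>
  assumes data: "chart_data U \<phi> N \<rho>"
begin

lemma chart_N: "open N" "N \<subseteq> \<H>" "N \<subseteq> chart_dom U"
  and chart_inj: "inj_on \<phi> U" and chart_image: "\<phi> ` U = ball 0 \<rho>" "\<rho> > 0"
  using data unfolding chart_data_def chart_dom_def by auto

lemma chart_dom_move:
  assumes "z \<in> chart_dom U"
  obtains \<gamma> where "\<gamma> \<in> \<Gamma>" "moebius \<gamma> z \<in> N"
proof -
  have z: "z \<in> \<H>" "orbit \<Gamma> (Fin z) \<in> U" using assms by (auto simp: chart_dom_def)
  then obtain y where y: "y \<in> N" "orbit \<Gamma> (Fin z) = orbit \<Gamma> (Fin y)" using data unfolding chart_data_def by blast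
  then obtain \<gamma> where "\<gamma> \<in> \<Gamma>" "y = moebius \<gamma> z" using orbit_H_eq_iff[OF z(1)] by blast
  then show ?thesis using that y(1) by blast
qed

lemma open_chart_dom: "open (chart_dom U)"
proof -
  have "chart_dom U = (\<Union>\<gamma>\<in>\<Gamma>. \<H> \<inter> moebius \<gamma> -` N)"
  proof (intro equalityI subsetI)
    fix z assume z: "z \<in> chart_dom U"
    then obtain \<gamma> where "\<gamma> \<in> \<Gamma>" "moebius \<gamma> z \<in> N" by (rule chart_dom_move)
    then show "z \<in> (\<Union>\<gamma>\<in>\<Gamma>. \<H> \<inter> moebius \<gamma> -` N)" using z chart_dom_subset by blast
  next
    fix z assume "z \<in> (\<Union>\<gamma>\<in>\<Gamma>. \<H> \<inter> moebius \<gamma> -` N)"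
    then obtain \<gamma> where "\<gamma> \<in> \<Gamma>" "z \<in> \<H>" "moebius \<gamma> z \<in> N" by blast
    then show "z \<in> chart_dom U" using chart_N(3) chart_dom_moebius by blast
  qed
  moreover have "open (\<Union>\<gamma>\<in>\<Gamma>. \<H> \<inter> moebius \<gamma> -` N)"
    by (intro open_UN ballI continuous_open_preimage holomorphic_on_imp_continuous_on moebius_holomorphic
      mem_SL chart_N(1) open_upper_half_plane)
  ultimately show ?thesis by (simp only:)
qed

text \<open>All properties of a lifted coordinate are known on \<open>N\<close> and carried to the rest of its domain by the
  group, under which it is invariant.\<close>

lemma lift_derivative_move:
  assumes z: "z \<in> \<H>" and \<gamma>: "\<gamma> \<in> \<Gamma>" "moebius \<gamma> z \<in> N"
  shows "(lift \<phi> has_field_derivative deriv (lift \<phi>) (moebius \<gamma> z) * (1 / (cocycle \<gamma> z)\<^sup>2)) (at z)"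
proof -
  have hol: "lift \<phi> holomorphic_on N" using data unfolding chart_data_def by blast
  have "(lift \<phi> has_field_derivative deriv (lift \<phi>) (moebius \<gamma> z)) (at (moebius \<gamma> z))"
    by (rule holomorphic_derivI[OF hol chart_N(1) \<gamma>(2)])
  then have "((\<lambda>w. lift \<phi> (moebius \<gamma> w)) has_field_derivative deriv (lift \<phi>) (moebius \<gamma> z) * (1 / (cocycle \<gamma> z)\<^sup>2)) (at z)"
    by (rule DERIV_chain2[OF _ has_field_derivative_moebius]) (use z \<gamma> in auto)
  then show ?thesis
    by (rule has_field_derivative_transform_within_open[OF _ open_upper_half_plane z]) (rule lift_moebius[OF \<gamma>(1)])
qed

lemma lift_holomorphic: "lift \<phi> holomorphic_on chart_dom U"
  unfolding holomorphic_on_open[OF open_chart_dom]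
  using chart_dom_move lift_derivative_move chart_dom_subset by (metis subsetD)

lemma lift_deriv: "z \<in> chart_dom U \<Longrightarrow> (lift \<phi> has_field_derivative deriv (lift \<phi>) z) (at z)"
  using lift_holomorphic open_chart_dom holomorphic_derivI by blast

lemma deriv_lift_nonzero:
  assumes "z \<in> chart_dom U" "lift \<phi> z \<noteq> 0"
  shows "deriv (lift \<phi>) z \<noteq> 0"
proof -
  have z: "z \<in> \<H>" using assms chart_dom_subset by blast
  obtain \<gamma> where \<gamma>: "\<gamma> \<in> \<Gamma>" "moebius \<gamma> z \<in> N" using chart_dom_move[OF assms(1)] .
  have "lift \<phi> (moebius \<gamma> z) \<noteq> 0" using assms(2) lift_moebius[OF \<gamma>(1) z] by simp
  then have "deriv (lift \<phi>) (moebius \<gamma> z) \<noteq> 0" using data \<gamma>(2) unfolding chart_data_def by blast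
  then show ?thesis using DERIV_imp_deriv[OF lift_derivative_move[OF z \<gamma>]] z \<gamma>(1) by simp
qed

lemma deriv_lift_moebius:
  assumes "z \<in> chart_dom U" "\<gamma> \<in> \<Gamma>"
  shows "deriv (lift \<phi>) (moebius \<gamma> z) = (cocycle \<gamma> z)\<^sup>2 * deriv (lift \<phi>) z"
proof -
  have z: "z \<in> \<H>" using assms chart_dom_subset by blast
  have "(lift \<phi> has_field_derivative deriv (lift \<phi>) (moebius \<gamma> z)) (at (moebius \<gamma> z))"
    by (rule lift_deriv) (use assms z chart_dom_moebius in blast)
  then have "((\<lambda>w. lift \<phi> (moebius \<gamma> w)) has_field_derivative deriv (lift \<phi>) (moebius \<gamma> z) * (1 / (cocycle \<gamma> z)\<^sup>2)) (at z)"
    by (rule DERIV_chain2[OF _ has_field_derivative_moebius]) (use z assms in auto)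
  then have "(lift \<phi> has_field_derivative deriv (lift \<phi>) (moebius \<gamma> z) * (1 / (cocycle \<gamma> z)\<^sup>2)) (at z)"
    by (rule has_field_derivative_transform_within_open[OF _ open_upper_half_plane z]) (rule lift_moebius[OF assms(2)])
  then have "deriv (lift \<phi>) z = deriv (lift \<phi>) (moebius \<gamma> z) * (1 / (cocycle \<gamma> z)\<^sup>2)"
    by (rule DERIV_imp_deriv)
  then show ?thesis using z assms(2) by simp
qed

lemma lift_image: "z \<in> chart_dom U \<Longrightarrow> lift \<phi> z \<in> ball 0 \<rho>"
  using chart_image unfolding lift_def chart_dom_def by blast

lemma lift_surj:
  assumes "u \<in> ball 0 \<rho>" "u \<noteq> 0"
  obtains z where "z \<in> N" "lift \<phi> z = u"
proof -
  obtain a where a: "a \<in> U" "\<phi> a = u" using assms chart_image by (metis imageE)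
  then obtain z where "z \<in> N" "a = orbit \<Gamma> (Fin z)" using assms(2) data unfolding chart_data_def by metis
  then show ?thesis using a that by (simp add: lift_def)
qed

lemma lift_eq_imp_orbit:
  assumes "z \<in> chart_dom U" "w \<in> chart_dom U" "lift \<phi> z = lift \<phi> w"
  obtains \<gamma> where "\<gamma> \<in> \<Gamma>" "w = moebius \<gamma> z"
proof -
  have "orbit \<Gamma> (Fin z) = orbit \<Gamma> (Fin w)"
    using assms chart_inj unfolding lift_def chart_dom_def inj_on_def by blast
  then show ?thesis using that orbit_H_eq_iff assms(1) chart_dom_subset by blast
qed

lemma inv_lift: "z \<in> chart_dom U \<Longrightarrow> inv_into U \<phi> (lift \<phi> z) = orbit \<Gamma> (Fin z)"
  unfolding lift_def chart_dom_def by (simp add: chart_inj)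

end

lemma interior_chart_small:
  assumes c: "interior_chart \<xi> r U \<phi>" and S: "open S" "\<xi> \<in> S"
  obtains \<delta> where "\<delta> > 0"
    "\<And>u. norm u < \<delta> \<Longrightarrow> \<exists>z\<in>\<H> \<inter> S. norm (cayley \<xi> z) < r \<and> lift \<phi> z = u"
proof -
  have i: "\<xi> \<in> \<H>" "0 < r" "r \<le> 1" using c unfolding interior_chart_def by blast+
  let ?e = "ellip_order \<Gamma> \<xi>"
  have e: "?e > 0" by (rule rotations_of_stab(1)[OF i(1)])
  obtain s where s: "s > 0" "s < 1" "\<And>z. z \<in> \<H> \<Longrightarrow> norm (cayley \<xi> z) < s \<Longrightarrow> z \<in> S"
    using cayley_nbhd[OF i(1) S] by blast
  let ?d = "min r s"
  have "\<exists>z\<in>\<H> \<inter> S. norm (cayley \<xi> z) < r \<and> lift \<phi> z = u" if u: "norm u < ?d ^ ?e" for u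
  proof -
    obtain v where v: "u = v ^ ?e" using exists_complex_root[of ?e u] e by auto
    have "norm v ^ ?e < ?d ^ ?e" using u by (simp add: v norm_power)
    then have vr: "norm v < ?d" by (rule power_less_imp_less_base) (use i(2) s(1) in simp)
    then obtain z where z: "z \<in> \<H>" "cayley \<xi> z = v" using cayley_surj[OF i(1), of v] i(3) by auto
    have zr: "norm (cayley \<xi> z) < r" using vr z(2) by simp
    have "z \<in> S" using s(3)[OF z(1)] vr z(2) by simp
    moreover have "lift \<phi> z = u" using interior_chart_lift(2)[OF c z(1) zr] z(2) v by simp
    ultimately show ?thesis using z(1) zr by blast
  qed
  moreover have "?d ^ ?e > 0" using i(2) s(1) by simp
  ultimately show ?thesis by (rule that[rotated])
qed

text \<open>Near the centre of a chart, small coordinates belong to points close to its representative.  If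
  that is a cusp, the other chart is centred at an equivalent cusp, and the element that relates the two
  scalings fixes \<open>\<infinity>\<close>, hence multiplies imaginary parts by a constant \<open>k > 0\<close>.\<close>

lemma transition_continuous_at_center:
  assumes A: "(U, \<phi>) \<in> atlas \<Gamma>" "(V, \<psi>) \<in> atlas \<Gamma>"
    and a: "a \<in> U" "a \<in> V" "\<phi> a = 0" and eps: "\<epsilon> > 0"
  obtains \<delta> where "\<delta> > 0"
    "\<And>u. norm u < \<delta> \<Longrightarrow> u \<noteq> 0 \<Longrightarrow> \<exists>z\<in>chart_dom U \<inter> chart_dom V. lift \<phi> z = u \<and> norm (lift \<psi> z - \<psi> a) < \<epsilon>"
  using A(1)
proof (cases rule: atlas_cases)
  case (1 \<xi> r)
  have i: "\<xi> \<in> \<H>" "0 < r" "r \<le> 1" "U = (\<lambda>z. orbit \<Gamma> (Fin z)) ` {z \<in> \<H>. norm (cayley \<xi> z) < r}"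
    "\<And>z. z \<in> \<H> \<Longrightarrow> norm (cayley \<xi> z) < r \<Longrightarrow> \<phi> (orbit \<Gamma> (Fin z)) = cayley \<xi> z ^ ellip_order \<Gamma> \<xi>"
    using 1 unfolding interior_chart_def by blast+
  let ?e = "ellip_order \<Gamma> \<xi>"
  have e: "?e > 0" by (rule rotations_of_stab(1)[OF i(1)])
  obtain z0 where z0: "z0 \<in> \<H>" "norm (cayley \<xi> z0) < r" "a = orbit \<Gamma> (Fin z0)" using a(1) unfolding i(4) by blast
  have "cayley \<xi> z0 ^ ?e = 0" using a(3) i(5)[OF z0(1,2)] z0(3) by simp
  then have "z0 = \<xi>" using cayley_eq_0[OF z0(1) i(1)] by simp
  then have a\<xi>: "a = orbit \<Gamma> (Fin \<xi>)" using z0 by simp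
  obtain N \<rho> where dV: "chart_data V \<psi> N \<rho>" using chart_data_exists[OF A(2)] .
  let ?O = "chart_dom V \<inter> lift \<psi> -` ball (\<psi> a) \<epsilon>"
  have "open ?O"
    by (intro continuous_open_preimage holomorphic_on_imp_continuous_on lift_holomorphic[OF dV] open_chart_dom[OF dV]) auto
  moreover have "\<xi> \<in> ?O" using a(2) i(1) eps by (simp add: a\<xi> chart_dom_def lift_def)
  ultimately obtain \<delta> where \<delta>: "\<delta> > 0"
      "\<And>u. norm u < \<delta> \<Longrightarrow> \<exists>z\<in>\<H> \<inter> ?O. norm (cayley \<xi> z) < r \<and> lift \<phi> z = u"
    using interior_chart_small[OF 1] by blast
  show ?thesis
  proof (rule that[OF \<delta>(1)])
    fix u :: complex assume "norm u < \<delta>"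
    then obtain z where z: "z \<in> \<H>" "z \<in> ?O" "norm (cayley \<xi> z) < r" "lift \<phi> z = u" using \<delta>(2) by blast
    then show "\<exists>z\<in>chart_dom U \<inter> chart_dom V. lift \<phi> z = u \<and> norm (lift \<psi> z - \<psi> a) < \<epsilon>"
      using interior_chart_lift(1)[OF 1 z(1,3)] by (auto simp: dist_norm norm_minus_commute)
  qed
next
  case (2 x \<sigma> h T)
  have i: "x \<in> cusps \<Gamma>" "cusp_scaling \<Gamma> x \<sigma> h" "T > 0"
    "U = insert (orbit \<Gamma> x) ((\<lambda>z. orbit \<Gamma> (Fin z)) ` {z \<in> \<H>. Im (moebius \<sigma> z) > T})"
    "\<And>z. z \<in> \<H> \<Longrightarrow> Im (moebius \<sigma> z) > T \<Longrightarrow> \<phi> (orbit \<Gamma> (Fin z)) = qexp h (moebius \<sigma> z)"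
    using 2 unfolding cusp_chart_def by blast+
  have \<sigma>: "\<sigma> \<in> SL" "emoebius \<sigma> x = Infty" "h > 0" using i(2) by (auto simp: cusp_scaling_iff)
  have xb: "x \<in> boundary" by (rule cusps_boundary[OF i(1)])
  have ax: "a = orbit \<Gamma> x" using a(1,3) i(5) unfolding i(4) by auto
  obtain x' \<sigma>' h' T' where c': "cusp_chart x' \<sigma>' h' T' V \<psi>"
    using A(2)
  proof (cases rule: atlas_cases)
    case (1 \<xi> r)
    then have "V = (\<lambda>z. orbit \<Gamma> (Fin z)) ` {z \<in> \<H>. norm (cayley \<xi> z) < r}" unfolding interior_chart_def by blast
    then show ?thesis using a(2) ax orbit_cusp_not_H[OF xb] by auto
  qed (use that in blast)
  have j: "x' \<in> cusps \<Gamma>" "cusp_scaling \<Gamma> x' \<sigma>' h'" "T' > 0"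
    "V = insert (orbit \<Gamma> x') ((\<lambda>z. orbit \<Gamma> (Fin z)) ` {z \<in> \<H>. Im (moebius \<sigma>' z) > T'})" "\<psi> (orbit \<Gamma> x') = 0"
    "\<And>z. z \<in> \<H> \<Longrightarrow> Im (moebius \<sigma>' z) > T' \<Longrightarrow> \<psi> (orbit \<Gamma> (Fin z)) = qexp h' (moebius \<sigma>' z)"
    using c' unfolding cusp_chart_def by blast+
  have \<sigma>': "\<sigma>' \<in> SL" "emoebius \<sigma>' x' = Infty" "h' > 0" using j(2) by (auto simp: cusp_scaling_iff)
  have ax': "orbit \<Gamma> x = orbit \<Gamma> x'"
    using a(2) orbit_cusp_not_H[OF xb] unfolding ax j(4) by blast
  then obtain \<gamma> where \<gamma>: "\<gamma> \<in> \<Gamma>" "x' = emoebius \<gamma> x" unfolding orbit_eq_iff by blast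
  define g where "g = \<sigma>' ** (\<gamma> ** adj22 \<sigma>)"
  have gSL: "g \<in> SL" using \<sigma> \<sigma>' \<gamma> by (simp add: g_def)
  have "emoebius (adj22 \<sigma>) Infty = x" using emoebius_adj22(1)[OF \<sigma>(1), of x] \<sigma>(2) by simp
  then have "emoebius g Infty = Infty"
    using \<sigma> \<sigma>' \<gamma> by (simp add: g_def emoebius_mult del: emoebius.simps)
  then have g21: "g$2$1 = 0" by (metis ecomplex.distinct(1) emoebius.simps(2))
  then have ad: "g$1$1 * g$2$2 = 1" using gSL by (simp add: SL_iff)
  define k where "k = 1 / (g$2$2)\<^sup>2"
  have "g$2$2 \<noteq> 0" using ad by auto
  then have k: "k > 0" by (simp add: k_def)
  have Im_g: "Im (moebius \<sigma>' (moebius \<gamma> z)) = k * Im (moebius \<sigma> z)" if z: "z \<in> \<H>" for z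
  proof -
    have "moebius g (moebius \<sigma> z) = moebius \<sigma>' (moebius \<gamma> z)"
      using z \<sigma> \<sigma>' \<gamma> by (simp add: g_def moebius_mult)
    moreover have "Im (moebius g (moebius \<sigma> z)) = Im (moebius \<sigma> z) / (norm (cocycle g (moebius \<sigma> z)))\<^sup>2"
      using moebius_in_H[OF \<sigma>(1) z] by (intro Im_moebius gSL) (simp add: upper_half_plane_iff)
    moreover have "(norm (cocycle g (moebius \<sigma> z)))\<^sup>2 = (g$2$2)\<^sup>2" by (simp add: cocycle_def g21)
    ultimately show ?thesis by (simp add: k_def)
  qed
  \<comment> \<open>Above this height, a point lies in both horoballs and its second coordinate is below \<open>\<epsilon>\<close>.\<close>
  define Y where "Y = max T (max (T' / k) (- (h' * ln \<epsilon>) / (2 * pi * k)))"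
  show ?thesis
  proof (rule that[of "exp (- (2 * pi * Y / h))"])
    fix u :: complex assume u: "norm u < exp (- (2 * pi * Y / h))" "u \<noteq> 0"
    obtain \<zeta> where \<zeta>: "qexp h \<zeta> = u" "Im \<zeta> > Y" using qexp_surj[OF \<sigma>(3) u(2,1)] .
    have "Y \<ge> T" by (simp add: Y_def)
    then have \<zeta>H: "\<zeta> \<in> \<H>" using \<zeta>(2) i(3) by (simp add: upper_half_plane_iff)
    define z where "z = moebius (adj22 \<sigma>) \<zeta>"
    have z: "z \<in> \<H>" "moebius \<sigma> z = \<zeta>" using \<sigma>(1) \<zeta>H by (simp_all add: z_def)
    have T: "Im (moebius \<sigma> z) > T" using z(2) \<zeta>(2) \<open>Y \<ge> T\<close> by simp
    have "T' / k < Im \<zeta>" using \<zeta>(2) by (simp add: Y_def)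
    then have T': "Im (moebius \<sigma>' (moebius \<gamma> z)) > T'"
      unfolding Im_g[OF z(1)] z(2) using k by (simp add: pos_divide_less_eq mult.commute)
    have gz: "moebius \<gamma> z \<in> \<H>" using \<gamma>(1) z(1) by simp
    have "z \<in> chart_dom U" using z(1) T unfolding chart_dom_def i(4) by blast
    moreover have "moebius \<gamma> z \<in> chart_dom V" using gz T' unfolding chart_dom_def j(4) by blast
    then have "z \<in> chart_dom V" using chart_dom_moebius \<gamma>(1) z(1) by blast
    moreover have "lift \<phi> z = u" using i(5)[OF z(1) T] z(2) \<zeta>(1) by (simp add: lift_def)
    moreover have "norm (lift \<psi> z - \<psi> a) < \<epsilon>"
    proof -
      have "lift \<psi> z = qexp h' (moebius \<sigma>' (moebius \<gamma> z))"
        using j(6)[OF gz T'] orbit_moebius[OF \<gamma>(1) z(1)] by (simp add: lift_def)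
      then have n: "norm (lift \<psi> z - \<psi> a) = exp (- (2 * pi * (k * Im \<zeta>) / h'))"
        using ax ax' j(5) Im_g[OF z(1)] z(2) by (simp add: norm_qexp)
      have "- (h' * ln \<epsilon>) / (2 * pi * k) < Im \<zeta>" using \<zeta>(2) by (simp add: Y_def)
      then have "- (h' * ln \<epsilon>) < Im \<zeta> * (2 * pi * k)" using k by (subst (asm) pos_divide_less_eq) simp_all
      then have "- ln \<epsilon> < 2 * pi * (k * Im \<zeta>) / h'"
        using \<sigma>'(3) by (subst pos_less_divide_eq) (simp_all add: mult_ac)
      then have "exp (- (2 * pi * (k * Im \<zeta>) / h')) < exp (ln \<epsilon>)" by simp
      then show ?thesis using n eps by simp
    qed
    ultimately show "\<exists>z\<in>chart_dom U \<inter> chart_dom V. lift \<phi> z = u \<and> norm (lift \<psi> z - \<psi> a) < \<epsilon>" by blast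
  qed simp
qed

definition transition :: "point chart \<Rightarrow> point chart \<Rightarrow> complex \<Rightarrow> complex" where
  "transition c d = (\<lambda>w. snd d (inv_into (fst c) (snd c) w))"

lemma transition_lift:
  assumes "(U, \<phi>) \<in> atlas \<Gamma>" "z \<in> chart_dom U"
  shows "transition (U, \<phi>) (V, \<psi>) (lift \<phi> z) = lift \<psi> z"
proof -
  obtain N \<rho> where "chart_data U \<phi> N \<rho>" using chart_data_exists[OF assms(1)] .
  then show ?thesis using inv_lift assms(2) by (simp add: transition_def lift_def)
qed

text \<open>Away from the centre, a coordinate change is locally a lifted coordinate composed with the inverse of
  another one.  At the centre it is continuous, so the singularity there is removable.  The derivative
  does not vanish because coordinate changes are injective.\<close>

lemma transition_props:
  assumes A: "(U, \<phi>) \<in> atlas \<Gamma>" "(V, \<psi>) \<in> atlas \<Gamma>"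
  defines "S \<equiv> \<phi> ` (U \<inter> V)" and "T \<equiv> transition (U, \<phi>) (V, \<psi>)"
  shows "open S" "T holomorphic_on S" "\<And>u. u \<in> S \<Longrightarrow> deriv T u \<noteq> 0"
    "\<And>a. a \<in> U \<Longrightarrow> T (\<phi> a) = \<psi> a"
proof -
  obtain N \<rho> where dU: "chart_data U \<phi> N \<rho>" using chart_data_exists[OF A(1)] .
  obtain N' \<rho>' where dV: "chart_data V \<psi> N' \<rho>'" using chart_data_exists[OF A(2)] .
  show Ta: "T (\<phi> a) = \<psi> a" if "a \<in> U" for a
    using that chart_inj[OF dU] by (simp add: T_def transition_def)
  define P where "P = chart_dom U \<inter> chart_dom V \<inter> lift \<phi> -` (- {0})"
  have opP: "open P"
  proof -
    have "open (chart_dom U \<inter> lift \<phi> -` (- {0}))"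
      by (intro continuous_open_preimage holomorphic_on_imp_continuous_on lift_holomorphic[OF dU] open_chart_dom[OF dU]) auto
    moreover have "P = (chart_dom U \<inter> lift \<phi> -` (- {0})) \<inter> chart_dom V" by (auto simp: P_def)
    ultimately show ?thesis using open_chart_dom[OF dV] by (metis open_Int)
  qed
  have "P \<subseteq> chart_dom U" "P \<subseteq> chart_dom V" unfolding P_def by blast+
  then have hol: "lift \<phi> holomorphic_on P" "lift \<psi> holomorphic_on P"
    using lift_holomorphic[OF dU] lift_holomorphic[OF dV] holomorphic_on_subset by blast+
  have nz: "deriv (lift \<phi>) z \<noteq> 0" if "z \<in> P" for z
    using that deriv_lift_nonzero[OF dU, of z] by (simp add: P_def)
  have TP: "T (lift \<phi> z) = lift \<psi> z" if "z \<in> P" for z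
    using that transition_lift[OF A(1), of z] by (simp add: P_def T_def)
  have desc: "open (lift \<phi> ` P)" "T holomorphic_on lift \<phi> ` P"
    by (rule holomorphic_descend[OF opP hol(1) nz hol(2) TP], assumption+)+
  have S: "lift \<phi> ` P = S - {0}"
  proof (intro equalityI subsetI)
    fix u assume "u \<in> lift \<phi> ` P"
    then show "u \<in> S - {0}" by (auto simp: P_def S_def chart_dom_def lift_def)
  next
    fix u assume u: "u \<in> S - {0}"
    then obtain a where a: "a \<in> U" "a \<in> V" "u = \<phi> a" unfolding S_def by blast
    then have "\<phi> a \<noteq> 0" using u by blast
    then obtain z where "z \<in> N" "a = orbit \<Gamma> (Fin z)" using dU a(1) unfolding chart_data_def by blast
    then have "z \<in> P" "u = lift \<phi> z" using a u chart_N(2)[OF dU] by (auto simp: P_def chart_dom_def lift_def)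
    then show "u \<in> lift \<phi> ` P" by blast
  qed
  have center: "\<exists>\<delta>>0. \<forall>u. norm u < \<delta> \<longrightarrow> u \<in> S \<and> norm (T u - T 0) < \<epsilon>" if 0: "0 \<in> S" and \<epsilon>: "\<epsilon> > 0" for \<epsilon>
  proof -
    from 0 obtain a where "a \<in> U \<inter> V" "0 = \<phi> a" unfolding S_def by (rule imageE)
    then have a: "a \<in> U" "a \<in> V" "\<phi> a = 0" by auto
    have T0: "T 0 = \<psi> a" using Ta[OF a(1)] a(3) by simp
    obtain \<delta> where \<delta>: "\<delta> > 0" "\<And>u. norm u < \<delta> \<Longrightarrow> u \<noteq> 0 \<Longrightarrow>
        \<exists>z\<in>chart_dom U \<inter> chart_dom V. lift \<phi> z = u \<and> norm (lift \<psi> z - \<psi> a) < \<epsilon>"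
      using transition_continuous_at_center[OF A a \<epsilon>] by blast
    have "u \<in> S \<and> norm (T u - T 0) < \<epsilon>" if un: "norm u < \<delta>" for u
    proof (cases "u = 0")
      case False
      then obtain z where z: "z \<in> chart_dom U" "z \<in> chart_dom V" "lift \<phi> z = u" "norm (lift \<psi> z - \<psi> a) < \<epsilon>"
        using \<delta>(2)[OF un] by blast
      have "T u = lift \<psi> z" using transition_lift[OF A(1) z(1), of V \<psi>] z(3) by (simp add: T_def)
      moreover have "u \<in> S" using z by (auto simp: S_def chart_dom_def lift_def)
      ultimately show ?thesis using z(4) T0 by simp
    qed (use 0 \<epsilon> in simp)
    then show ?thesis using \<delta>(1) by blast
  qed
  show opS: "open S"
  proof (cases "0 \<in> S")
    case True
    then obtain \<delta> where \<delta>: "\<delta> > 0" "\<And>u. norm u < \<delta> \<Longrightarrow> u \<in> S" using center[of 1] by auto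
    have "S = lift \<phi> ` P \<union> ball 0 \<delta>" using S \<delta> by auto
    then show ?thesis using desc(1) by (metis open_Un open_ball)
  next
    case False
    then have "S = lift \<phi> ` P" using S by auto
    then show ?thesis using desc(1) by simp
  qed
  show hol: "T holomorphic_on S"
  proof (rule no_isolated_singularity[where K = "{0}", OF _ _ opS])
    show "T holomorphic_on S - {0}" using desc(2) S by simp
    show "continuous_on S T"
    proof (intro continuous_at_imp_continuous_on ballI)
      fix u assume u: "u \<in> S"
      show "isCont T u"
      proof (cases "u = 0")
        case True
        show ?thesis unfolding True continuous_at_eps_delta
        proof (intro allI impI)
          fix \<epsilon> :: real assume "\<epsilon> > 0"
          then obtain \<delta> where "\<delta> > 0" "\<forall>u. norm u < \<delta> \<longrightarrow> u \<in> S \<and> norm (T u - T 0) < \<epsilon>"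
            using center u True by blast
          then show "\<exists>d>0. \<forall>x'. dist x' 0 < d \<longrightarrow> dist (T x') (T 0) < \<epsilon>"
            by (intro exI[of _ \<delta>]) (simp add: dist_norm)
        qed
      next
        case False
        then have "u \<in> lift \<phi> ` P" using S u by blast
        then show ?thesis using desc holomorphic_on_imp_continuous_on continuous_on_eq_continuous_at by blast
      qed
    qed
  qed simp
  have "inj_on T S"
  proof (rule inj_onI)
    fix u v assume uv: "u \<in> S" "v \<in> S" "T u = T v"
    then obtain a b where ab: "a \<in> U \<inter> V" "b \<in> U \<inter> V" "u = \<phi> a" "v = \<phi> b" unfolding S_def by blast
    then have "\<psi> a = \<psi> b" using uv(3) Ta by simp
    then show "u = v" using ab chart_inj[OF dV] unfolding inj_on_def by blast
  qed
  then show "deriv T u \<noteq> 0" if "u \<in> S" for u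
    by (rule holomorphic_injective_imp_regular[OF hol opS _ that])
qed

lemma deriv_lift_transition:
  assumes A: "(U, \<phi>) \<in> atlas \<Gamma>" "(V, \<psi>) \<in> atlas \<Gamma>" and z: "z \<in> chart_dom U" "z \<in> chart_dom V"
  shows "deriv (lift \<psi>) z = deriv (transition (U, \<phi>) (V, \<psi>)) (lift \<phi> z) * deriv (lift \<phi>) z"
proof -
  let ?T = "transition (U, \<phi>) (V, \<psi>)"
  obtain N \<rho> where dU: "chart_data U \<phi> N \<rho>" using chart_data_exists[OF A(1)] .
  have "lift \<phi> z \<in> \<phi> ` (U \<inter> V)" using z by (auto simp: lift_def chart_dom_def)
  then have "(?T has_field_derivative deriv ?T (lift \<phi> z)) (at (lift \<phi> z))"
    using transition_props(1,2)[OF A] holomorphic_derivI by blast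
  from DERIV_chain2[OF this lift_deriv[OF dU z(1)]]
  have "((\<lambda>w. ?T (lift \<phi> w)) has_field_derivative deriv ?T (lift \<phi> z) * deriv (lift \<phi>) z) (at z)" .
  then have "(lift \<psi> has_field_derivative deriv ?T (lift \<phi> z) * deriv (lift \<phi>) z) (at z)"
    by (rule has_field_derivative_transform_within_open[OF _ open_chart_dom[OF dU] z(1)])
       (rule transition_lift[OF A(1)])
  then show ?thesis by (rule DERIV_imp_deriv)
qed

lemma atlas_covers_H:
  assumes "z \<in> \<H>"
  obtains U \<phi> where "(U, \<phi>) \<in> atlas \<Gamma>" "z \<in> chart_dom U"
proof -
  obtain r U \<phi> where c: "interior_chart z r U \<phi>" using interior_chart_exists[OF assms] .
  have "U = (\<lambda>z. orbit \<Gamma> (Fin z)) ` {w \<in> \<H>. norm (cayley z w) < r}" "0 < r"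
    using c unfolding interior_chart_def by blast+
  then have "z \<in> chart_dom U" using assms unfolding chart_dom_def by auto
  then show ?thesis by (rule that[OF interior_chart_atlas[OF c]])
qed

end

section \<open>Differentials and their pull-backs\<close>

text \<open>The difference of two meromorphic functions that vanishes at points arbitrarily close to \<open>u\<close> vanishes
  near \<open>u\<close>, and a nicely meromorphic function is determined at \<open>u\<close> by its values near \<open>u\<close>.\<close>

lemma nicely_meromorphic_eq_at:
  assumes "f nicely_meromorphic_on A" "g nicely_meromorphic_on A" "u \<in> A"
    and "\<exists>\<^sub>F w in at u. f w = g w"
  shows "f u = g u"
proof -
  have fm: "f meromorphic_on {u}" "g meromorphic_on {u}"
    using assms(1-3) unfolding nicely_meromorphic_on_def by (auto intro: meromorphic_on_subset)
  then have "(\<lambda>w. f w - g w) meromorphic_on {u}" by (intro meromorphic_intros)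
  moreover have "\<exists>\<^sub>F w in at u. f w - g w = 0" using assms(4) by simp
  ultimately have "\<forall>\<^sub>F w in at u. f w - g w = 0"
    by (intro not_essential_frequently_0_imp_eventually_0 meromorphic_on_isolated_singularity meromorphic_on_not_essential)
  then have ev: "\<forall>\<^sub>F w in at u. f w = g w" by simp
  have f: "(is_pole f u \<and> f u = 0) \<or> f \<midarrow>u\<rightarrow> f u" and g: "(is_pole g u \<and> g u = 0) \<or> g \<midarrow>u\<rightarrow> g u"
    using assms(1-3) unfolding nicely_meromorphic_on_def by blast+
  have pole: "is_pole f u \<longleftrightarrow> is_pole g u" by (rule is_pole_cong[OF ev refl])
  show ?thesis
  proof (cases "is_pole f u")
    case True
    then have "is_pole g u" using pole by simp
    then show ?thesis using f g True not_tendsto_and_filterlim_at_infinity[of "at u"]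
      unfolding is_pole_def by (metis trivial_limit_at)
  next
    case False
    then have "f \<midarrow>u\<rightarrow> f u" "g \<midarrow>u\<rightarrow> g u" using f g pole by auto
    moreover have "g \<midarrow>u\<rightarrow> f u" by (rule Lim_transform_eventually[OF calculation(1) ev])
    ultimately show ?thesis using tendsto_unique[OF trivial_limit_at] by blast
  qed
qed

context discrete_group
begin

lemma mem_meromorphic_differentials:
  assumes "\<omega> \<in> meromorphic_differentials (atlas \<Gamma>) l"
  shows "c \<notin> atlas \<Gamma> \<Longrightarrow> \<omega> c = (\<lambda>_. 0)"
    "(U, \<phi>) \<in> atlas \<Gamma> \<Longrightarrow> \<omega> (U, \<phi>) nicely_meromorphic_on \<phi> ` U"
    "(U, \<phi>) \<in> atlas \<Gamma> \<Longrightarrow> u \<notin> \<phi> ` U \<Longrightarrow> \<omega> (U, \<phi>) u = 0"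
    "(U, \<phi>) \<in> atlas \<Gamma> \<Longrightarrow> (V, \<psi>) \<in> atlas \<Gamma> \<Longrightarrow> u \<in> \<phi> ` (U \<inter> V) \<Longrightarrow>
      \<omega> (U, \<phi>) u = \<omega> (V, \<psi>) (transition (U, \<phi>) (V, \<psi>) u) * deriv (transition (U, \<phi>) (V, \<psi>)) u ^ l"
proof -
  note D0 = assms[unfolded meromorphic_differentials_def mem_Collect_eq]
  note D = conjunct1[OF D0] conjunct1[OF conjunct2[OF D0]] conjunct2[OF conjunct2[OF D0]]
  show "c \<notin> atlas \<Gamma> \<Longrightarrow> \<omega> c = (\<lambda>_. 0)" using D(1) by blast
  show "(U, \<phi>) \<in> atlas \<Gamma> \<Longrightarrow> \<omega> (U, \<phi>) nicely_meromorphic_on \<phi> ` U" using D(2) by blast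
  show "(U, \<phi>) \<in> atlas \<Gamma> \<Longrightarrow> u \<notin> \<phi> ` U \<Longrightarrow> \<omega> (U, \<phi>) u = 0" using D(2) by blast
  assume A: "(U, \<phi>) \<in> atlas \<Gamma>" "(V, \<psi>) \<in> atlas \<Gamma>" and u: "u \<in> \<phi> ` (U \<inter> V)"
  show "\<omega> (U, \<phi>) u = \<omega> (V, \<psi>) (transition (U, \<phi>) (V, \<psi>) u) * deriv (transition (U, \<phi>) (V, \<psi>)) u ^ l"
    unfolding transition_def fst_conv snd_conv
    by (rule bspec[OF bspec[OF bspec[OF D(3) A(1), unfolded prod.case] A(2), unfolded prod.case] u])
qed

lemma chart_image_ball:
  assumes "(U, \<phi>) \<in> atlas \<Gamma>"
  obtains \<rho> where "\<rho> > 0" "\<phi> ` U = ball 0 \<rho>"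
proof -
  obtain N \<rho> where "chart_data U \<phi> N \<rho>" using chart_data_exists[OF assms] .
  then show ?thesis using that chart_image by blast
qed

lemma open_chart_image: "(U, \<phi>) \<in> atlas \<Gamma> \<Longrightarrow> open (\<phi> ` U)"
  using chart_image_ball by (metis open_ball)

lemma H_spaceI:
  assumes "\<And>c. c \<notin> atlas \<Gamma> \<Longrightarrow> \<omega> c = (\<lambda>_. 0)"
    and hol: "\<And>U \<phi>. (U, \<phi>) \<in> atlas \<Gamma> \<Longrightarrow> \<omega> (U, \<phi>) holomorphic_on \<phi> ` U"
    and "\<And>U \<phi> u. (U, \<phi>) \<in> atlas \<Gamma> \<Longrightarrow> u \<notin> \<phi> ` U \<Longrightarrow> \<omega> (U, \<phi>) u = 0"
    and "\<And>U \<phi> V \<psi> u. (U, \<phi>) \<in> atlas \<Gamma> \<Longrightarrow> (V, \<psi>) \<in> atlas \<Gamma> \<Longrightarrow> u \<in> \<phi> ` (U \<inter> V) \<Longrightarrow>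
      \<omega> (U, \<phi>) u = \<omega> (V, \<psi>) (transition (U, \<phi>) (V, \<psi>) u) * deriv (transition (U, \<phi>) (V, \<psi>)) u ^ l"
  shows "\<omega> \<in> H_space \<Gamma> l"
proof -
  have "\<omega> (U, \<phi>) nicely_meromorphic_on \<phi> ` U" if "(U, \<phi>) \<in> atlas \<Gamma>" for U \<phi>
    using hol[OF that] open_chart_image[OF that]
    by (intro analytic_on_imp_nicely_meromorphic_on) (simp add: analytic_on_open)
  then have "\<forall>(U, \<phi>)\<in>atlas \<Gamma>. \<omega> (U, \<phi>) nicely_meromorphic_on \<phi> ` U \<and> (\<forall>z. z \<notin> \<phi> ` U \<longrightarrow> \<omega> (U, \<phi>) z = 0)"
    using assms(3) by blast
  moreover have "\<forall>(U, \<phi>)\<in>atlas \<Gamma>. \<forall>(V, \<psi>)\<in>atlas \<Gamma>. \<forall>z\<in>\<phi> ` (U \<inter> V). \<omega> (U, \<phi>) z =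
        \<omega> (V, \<psi>) (\<psi> (inv_into U \<phi> z)) * deriv (\<lambda>w. \<psi> (inv_into U \<phi> w)) z ^ l"
    using assms(4) unfolding transition_def fst_conv snd_conv by blast
  moreover have "\<forall>(U, \<phi>)\<in>atlas \<Gamma>. \<omega> (U, \<phi>) holomorphic_on \<phi> ` U" using hol by blast
  ultimately show ?thesis
    unfolding holomorphic_differentials_def meromorphic_differentials_def mem_Collect_eq
    using assms(1) by blast
qed

lemma H_space_mero: "\<omega> \<in> H_space \<Gamma> l \<Longrightarrow> \<omega> \<in> meromorphic_differentials (atlas \<Gamma>) l"
  by (simp add: holomorphic_differentials_def)

lemma H_space_holomorphic:
  assumes "\<omega> \<in> H_space \<Gamma> l" "(U, \<phi>) \<in> atlas \<Gamma>"
  shows "\<omega> (U, \<phi>) holomorphic_on \<phi> ` U"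
  using assms unfolding holomorphic_differentials_def by blast

lemmas H_space_mem = mem_meromorphic_differentials[OF H_space_mero]

lemma H_space_linear:
  assumes "\<omega> \<in> H_space \<Gamma> l" "\<eta> \<in> H_space \<Gamma> l"
  shows "\<omega> + \<eta> \<in> H_space \<Gamma> l"
  by (rule H_spaceI)
     (use H_space_mem[OF assms(1)] H_space_mem[OF assms(2)] H_space_holomorphic[OF assms(1)] H_space_holomorphic[OF assms(2)]
      in \<open>auto simp: plus_fun_def distrib_right intro!: holomorphic_on_add\<close>)

lemma H_space_dscale:
  assumes "\<omega> \<in> H_space \<Gamma> l"
  shows "dscale c \<omega> \<in> H_space \<Gamma> l"
  by (rule H_spaceI)
     (use H_space_mem[OF assms] H_space_holomorphic[OF assms]
      in \<open>auto simp: dscale_def intro!: holomorphic_on_mult\<close>)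

lemma H_space_zero: "0 \<in> H_space \<Gamma> l"
  by (rule H_spaceI) (auto simp: zero_fun_def)

lemma H_space_subspace: "dspace.subspace (H_space \<Gamma> l)"
  unfolding dspace.subspace_def using H_space_zero H_space_linear H_space_dscale by blast

text \<open>The form that a differential induces on \<open>\<H>\<close>, computed in an arbitrary chart around the orbit of \<open>z\<close>.\<close>

definition pullback :: "nat \<Rightarrow> point differential \<Rightarrow> complex \<Rightarrow> complex" where
  "pullback l \<omega> z = (if z \<in> \<H> then
     (let (U, \<phi>) = (SOME c. c \<in> atlas \<Gamma> \<and> z \<in> chart_dom (fst c)) in \<omega> (U, \<phi>) (lift \<phi> z) * deriv (lift \<phi>) z ^ l)
     else 0)"

text \<open>Compatibility of the local expressions of a differential is exactly what the chain rule for the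
  lifted coordinates requires.\<close>

lemma pullback_chart:
  assumes \<omega>: "\<omega> \<in> meromorphic_differentials (atlas \<Gamma>) l" and A: "(U, \<phi>) \<in> atlas \<Gamma>" "z \<in> chart_dom U"
  shows "pullback l \<omega> z = \<omega> (U, \<phi>) (lift \<phi> z) * deriv (lift \<phi>) z ^ l"
proof -
  have z: "z \<in> \<H>" using A(2) chart_dom_subset by blast
  define c where "c = (SOME c. c \<in> atlas \<Gamma> \<and> z \<in> chart_dom (fst c))"
  have c: "c \<in> atlas \<Gamma> \<and> z \<in> chart_dom (fst c)"
    unfolding c_def by (rule someI[of _ "(U, \<phi>)"]) (use A in simp)
  obtain V \<psi> where V: "c = (V, \<psi>)" by (cases c)
  have B: "(V, \<psi>) \<in> atlas \<Gamma>" "z \<in> chart_dom V" using c V by auto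
  have "pullback l \<omega> z = \<omega> (V, \<psi>) (lift \<psi> z) * deriv (lift \<psi>) z ^ l"
    using z by (simp add: pullback_def c_def[symmetric] V)
  also have "lift \<psi> z = transition (U, \<phi>) (V, \<psi>) (lift \<phi> z)" using transition_lift[OF A] by simp
  also have "deriv (lift \<psi>) z = deriv (transition (U, \<phi>) (V, \<psi>)) (lift \<phi> z) * deriv (lift \<phi>) z"
    by (rule deriv_lift_transition[OF A(1) B(1) A(2) B(2)])
  also have "\<omega> (V, \<psi>) (transition (U, \<phi>) (V, \<psi>) (lift \<phi> z)) * (\<dots>) ^ l =
      \<omega> (U, \<phi>) (lift \<phi> z) * deriv (lift \<phi>) z ^ l"
  proof -
    have "lift \<phi> z \<in> \<phi> ` (U \<inter> V)" using A(2) B(2) by (auto simp: lift_def chart_dom_def)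
    then show ?thesis
      using mem_meromorphic_differentials(4)[OF \<omega> A(1) B(1), of "lift \<phi> z"] by (simp add: power_mult_distrib)
  qed
  finally show ?thesis .
qed

lemma has_pullback_pullback:
  assumes \<omega>: "\<omega> \<in> meromorphic_differentials (atlas \<Gamma>) l"
  shows "has_pullback \<Gamma> l \<omega> (pullback l \<omega>)"
  unfolding has_pullback_def
proof (intro ballI, clarify)
  fix U \<phi> assume A: "(U, \<phi>) \<in> atlas \<Gamma>"
  obtain N \<rho> where "chart_data U \<phi> N \<rho>" using chart_data_exists[OF A] .
  then have "\<forall>\<^sub>\<approx>z \<in> chart_dom U. z \<in> chart_dom U"
    using open_chart_dom eventually_in_cosparse by blast
  then show "\<forall>\<^sub>\<approx>z \<in> {z \<in> \<H>. orbit \<Gamma> (Fin z) \<in> U}.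
      \<omega> (U, \<phi>) (\<phi> (orbit \<Gamma> (Fin z))) * deriv (\<lambda>w. \<phi> (orbit \<Gamma> (Fin w))) z ^ l = pullback l \<omega> z"
    unfolding chart_dom_def[symmetric]
    by eventually_elim (simp add: pullback_chart[OF \<omega> A] lift_def)
qed

text \<open>A coordinate \<open>v \<noteq> 0\<close> is the image of a point of \<open>\<H>\<close> near which the lifted coordinate is injective.
  Equality of the pull-backs near that point therefore gives equality of the local expressions at
  coordinates arbitrarily close to \<open>v\<close>.  The centre is a limit of such \<open>v\<close>.\<close>

lemma pullback_unique:
  assumes \<omega>: "\<omega> \<in> meromorphic_differentials (atlas \<Gamma>) l" "\<eta> \<in> meromorphic_differentials (atlas \<Gamma>) l"
    and p: "has_pullback \<Gamma> l \<omega> f" "has_pullback \<Gamma> l \<eta> f"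
  shows "\<omega> = \<eta>"
proof (rule ext, rule ext)
  fix c u
  show "\<omega> c u = \<eta> c u"
  proof (cases "c \<in> atlas \<Gamma>")
    case False
    then show ?thesis using mem_meromorphic_differentials(1)[OF \<omega>(1)] mem_meromorphic_differentials(1)[OF \<omega>(2)] by simp
  next
    case True
    obtain U \<phi> where c: "c = (U, \<phi>)" by (cases c)
    then have A: "(U, \<phi>) \<in> atlas \<Gamma>" using True by simp
    obtain N \<rho> where d: "chart_data U \<phi> N \<rho>" using chart_data_exists[OF A] .
    note im = chart_image[OF d]
    have nice: "\<omega> (U, \<phi>) nicely_meromorphic_on \<phi> ` U" "\<eta> (U, \<phi>) nicely_meromorphic_on \<phi> ` U"
      using mem_meromorphic_differentials(2)[OF \<omega>(1) A] mem_meromorphic_differentials(2)[OF \<omega>(2) A] .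
    have off: "\<omega> (U, \<phi>) v = \<eta> (U, \<phi>) v" if v: "v \<in> \<phi> ` U" "v \<noteq> 0" for v
    proof (rule nicely_meromorphic_eq_at[OF nice v(1)])
      obtain z where z: "z \<in> N" "lift \<phi> z = v" using lift_surj[OF d, of v] v im by auto
      have zU: "z \<in> chart_dom U" using chart_N(3)[OF d] z by blast
      have "\<forall>\<^sub>F w in at z. \<omega> (U, \<phi>) (lift \<phi> w) * deriv (lift \<phi>) w ^ l = f w"
        "\<forall>\<^sub>F w in at z. \<eta> (U, \<phi>) (lift \<phi> w) * deriv (lift \<phi>) w ^ l = f w"
        using p A zU eventually_cosparse_imp_eventually_at[of _ "chart_dom U" z UNIV]
        unfolding has_pullback_def chart_dom_def lift_def by fastforce+
      moreover have "isCont (lift \<phi>) z" using lift_deriv[OF d zU] DERIV_isCont by blast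
      then have lim: "(lift \<phi> \<longlongrightarrow> v) (at z)" using z(2) by (simp add: isCont_def)
      then have "\<forall>\<^sub>F w in at z. lift \<phi> w \<noteq> 0" using v(2) by (rule tendsto_imp_eventually_ne)
      moreover have "\<forall>\<^sub>F w in at z. w \<in> chart_dom U"
        using eventually_at_in_open'[OF open_chart_dom[OF d] zU] .
      ultimately have eq: "\<forall>\<^sub>F w in at z. \<omega> (U, \<phi>) (lift \<phi> w) = \<eta> (U, \<phi>) (lift \<phi> w)"
      proof eventually_elim
        case (elim w)
        have "deriv (lift \<phi>) w \<noteq> 0" using deriv_lift_nonzero[OF d] elim by blast
        then show ?case using elim by (metis mult_right_cancel power_not_zero)
      qed
      have dz: "deriv (lift \<phi>) z \<noteq> 0" using deriv_lift_nonzero[OF d zU] z(2) v(2) by simp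
      obtain r where r: "r > 0" "inj_on (lift \<phi>) (ball z r)"
        using has_complex_derivative_locally_injective[OF lift_holomorphic[OF d] zU open_chart_dom[OF d] dz] by metis
      have "\<forall>\<^sub>F w in at z. lift \<phi> w \<noteq> v"
      proof -
        have "\<forall>\<^sub>F w in at z. w \<in> ball z r - {z}" using r(1) by (intro eventually_at_in_open) auto
        then show ?thesis
        proof eventually_elim
          case (elim w)
          then show ?case using r inj_onD[OF r(2), of w z] z(2) by auto
        qed
      qed
      then have fl: "filterlim (lift \<phi>) (at v) (at z)" using lim by (simp add: filterlim_at)
      show "\<exists>\<^sub>F w in at v. \<omega> (U, \<phi>) w = \<eta> (U, \<phi>) w"
      proof (rule ccontr)
        assume "\<not> ?thesis"
        then have "\<forall>\<^sub>F w in at v. \<omega> (U, \<phi>) w \<noteq> \<eta> (U, \<phi>) w" by (simp add: frequently_def)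
        then have "\<forall>\<^sub>F w in at z. \<omega> (U, \<phi>) (lift \<phi> w) \<noteq> \<eta> (U, \<phi>) (lift \<phi> w)"
          using fl by (rule eventually_compose_filterlim)
        with eq have "\<forall>\<^sub>F w in at z. False" by eventually_elim simp
        then show False by simp
      qed
    qed
    show ?thesis
    proof (cases "u \<in> \<phi> ` U")
      case False
      then show ?thesis unfolding c
        using mem_meromorphic_differentials(3)[OF \<omega>(1) A] mem_meromorphic_differentials(3)[OF \<omega>(2) A] by simp
    next
      case u: True
      show ?thesis
      proof (cases "u = 0")
        case False
        then show ?thesis unfolding c using off u by blast
      next
        case 0: True
        show ?thesis unfolding c
        proof (rule nicely_meromorphic_eq_at[OF nice u])
          have "\<forall>\<^sub>F w in at 0. w \<in> \<phi> ` U - {0}"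
            unfolding im(1) using im(2) by (intro eventually_at_in_open) auto
          then have "\<forall>\<^sub>F w in at u. \<omega> (U, \<phi>) w = \<eta> (U, \<phi>) w"
            unfolding 0 by eventually_elim (use off in blast)
          then show "\<exists>\<^sub>F w in at u. \<omega> (U, \<phi>) w = \<eta> (U, \<phi>) w"
            by (rule eventually_frequently[OF trivial_limit_at])
        qed
      qed
    qed
  qed
qed

lemma form_differential_pullback:
  assumes "\<omega> \<in> meromorphic_differentials (atlas \<Gamma>) l"
  shows "form_differential \<Gamma> (2 * l) (pullback l \<omega>) = \<omega>"
  unfolding form_differential_def
  using assms has_pullback_pullback[OF assms] pullback_unique[OF _ assms]
  by (intro the_equality) auto

lemma pullback_inj:
  assumes "\<omega> \<in> H_space \<Gamma> l" "\<eta> \<in> H_space \<Gamma> l" "pullback l \<omega> = pullback l \<eta>"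
  shows "\<omega> = \<eta>"
  using pullback_unique[of \<omega> l \<eta> "pullback l \<omega>"] has_pullback_pullback assms H_space_mero by metis

lemma pullback_off_H: "z \<notin> \<H> \<Longrightarrow> pullback l \<omega> z = 0"
  by (simp add: pullback_def)

lemma pullback_add: "pullback l (\<omega> + \<eta>) = pullback l \<omega> + pullback l \<eta>"
  by (auto simp: pullback_def fun_eq_iff distrib_right split: prod.split)

lemma pullback_dscale: "pullback l (dscale c \<omega>) = fscale c (pullback l \<omega>)"
  by (auto simp: pullback_def fun_eq_iff dscale_def fscale_def split: prod.split)

lemma pullback_sum: "pullback l (\<Sum>i\<in>I. dscale (c i) (\<omega> i)) = (\<Sum>i\<in>I. fscale (c i) (pullback l (\<omega> i)))"
proof (induction I rule: infinite_finite_induct)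
  case (insert i I)
  have "(\<Sum>i\<in>insert i I. dscale (c i) (\<omega> i)) = dscale (c i) (\<omega> i) + (\<Sum>i\<in>I. dscale (c i) (\<omega> i))"
    "(\<Sum>i\<in>insert i I. fscale (c i) (pullback l (\<omega> i))) =
       fscale (c i) (pullback l (\<omega> i)) + (\<Sum>i\<in>I. fscale (c i) (pullback l (\<omega> i)))"
    by (rule sum.insert[OF insert.hyps])+
  then show ?case unfolding insert.IH[symmetric] by (simp only: pullback_add pullback_dscale)
qed (auto simp: pullback_def fun_eq_iff split: prod.split)

lemma pullback_moebius:
  assumes \<omega>: "\<omega> \<in> meromorphic_differentials (atlas \<Gamma>) l" and z: "z \<in> \<H>" and \<gamma>: "\<gamma> \<in> \<Gamma>"
  shows "pullback l \<omega> (moebius \<gamma> z) = cocycle \<gamma> z ^ (2 * l) * pullback l \<omega> z"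
proof -
  obtain U \<phi> where A: "(U, \<phi>) \<in> atlas \<Gamma>" "z \<in> chart_dom U" using atlas_covers_H[OF z] .
  obtain N \<rho> where d: "chart_data U \<phi> N \<rho>" using chart_data_exists[OF A(1)] .
  have "moebius \<gamma> z \<in> chart_dom U" using A(2) chart_dom_moebius[OF \<gamma> z] by blast
  then show ?thesis
    using pullback_chart[OF \<omega> A] pullback_chart[OF \<omega> A(1)] lift_moebius[OF \<gamma> z, of \<phi>] deriv_lift_moebius[OF d A(2) \<gamma>]
    by (simp add: power_mult_distrib power_mult)
qed

lemma pullback_holomorphic:
  assumes \<omega>: "\<omega> \<in> H_space \<Gamma> l"
  shows "pullback l \<omega> holomorphic_on \<H>"
proof -
  have "\<exists>S. open S \<and> z \<in> S \<and> pullback l \<omega> holomorphic_on S" if z: "z \<in> \<H>" for z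
  proof -
    obtain U \<phi> where A: "(U, \<phi>) \<in> atlas \<Gamma>" "z \<in> chart_dom U" using atlas_covers_H[OF z] .
    obtain N \<rho> where d: "chart_data U \<phi> N \<rho>" using chart_data_exists[OF A(1)] .
    have "\<omega> (U, \<phi>) \<circ> lift \<phi> holomorphic_on chart_dom U"
      by (rule holomorphic_on_compose_gen[OF lift_holomorphic[OF d] H_space_holomorphic[OF \<omega> A(1)]])
         (auto simp: lift_def chart_dom_def)
    then have "(\<lambda>w. (\<omega> (U, \<phi>) \<circ> lift \<phi>) w * deriv (lift \<phi>) w ^ l) holomorphic_on chart_dom U"
      by (intro holomorphic_on_mult holomorphic_on_power holomorphic_deriv lift_holomorphic[OF d] open_chart_dom[OF d])
    then have "pullback l \<omega> holomorphic_on chart_dom U"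
      by (rule holomorphic_transform) (simp add: pullback_chart[OF H_space_mero[OF \<omega>] A(1)])
    then show ?thesis using open_chart_dom[OF d] A(2) by blast
  qed
  then show ?thesis
    unfolding holomorphic_on_open[OF open_upper_half_plane]
    by (metis holomorphic_on_open)
qed

section \<open>Expansions at cusps\<close>

text \<open>Written with \<open>\<sigma> w\<close> in place of the variable, the expansion avoids the inverse of \<open>\<sigma>\<close>.\<close>

lemma cusp_expansion_iff:
  assumes "\<sigma> \<in> SL"
  shows "cusp_expansion m f \<sigma> h a \<longleftrightarrow>
    (\<forall>w\<in>\<H>. (\<lambda>n. a n * qexp h (moebius \<sigma> w) ^ n) sums (f w * cocycle \<sigma> w ^ m))"
proof -
  have s: "slash m f (matrix_inv \<sigma>) (moebius \<sigma> w) = f w * cocycle \<sigma> w ^ m" if w: "w \<in> \<H>" for w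
  proof -
    have nz: "cocycle \<sigma> w \<noteq> 0" using assms w by simp
    have "cocycle (adj22 \<sigma> ** \<sigma>) w = cocycle (adj22 \<sigma>) (moebius \<sigma> w) * cocycle \<sigma> w" by (rule cocycle_mult[OF nz])
    then have "cocycle (adj22 \<sigma>) (moebius \<sigma> w) * cocycle \<sigma> w = 1"
      unfolding adj22_mult(1)[OF assms] by (simp add: cocycle_def)
    then have "cocycle (adj22 \<sigma>) (moebius \<sigma> w) = 1 / cocycle \<sigma> w" using nz by (simp add: eq_divide_eq)
    then show ?thesis
      using assms w by (simp add: slash_def matrix_inv_SL power_divide power_one_over)
  qed
  show ?thesis
  proof
    assume c: "cusp_expansion m f \<sigma> h a"
    show "\<forall>w\<in>\<H>. (\<lambda>n. a n * qexp h (moebius \<sigma> w) ^ n) sums (f w * cocycle \<sigma> w ^ m)"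
    proof
      fix w assume w: "w \<in> \<H>"
      then have "moebius \<sigma> w \<in> \<H>" using assms by simp
      then show "(\<lambda>n. a n * qexp h (moebius \<sigma> w) ^ n) sums (f w * cocycle \<sigma> w ^ m)"
        using c unfolding cusp_expansion_def s[OF w, symmetric] qexp_power by blast
    qed
  next
    assume c: "\<forall>w\<in>\<H>. (\<lambda>n. a n * qexp h (moebius \<sigma> w) ^ n) sums (f w * cocycle \<sigma> w ^ m)"
    show "cusp_expansion m f \<sigma> h a"
      unfolding cusp_expansion_def
    proof
      fix z assume z: "z \<in> \<H>"
      then have w: "moebius (adj22 \<sigma>) z \<in> \<H>" "moebius \<sigma> (moebius (adj22 \<sigma>) z) = z" using assms by simp_all
      show "(\<lambda>n. a n * exp (2 * complex_of_real pi * \<i> * complex_of_nat n * z / complex_of_real h)) sums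
          slash m f (matrix_inv \<sigma>) z"
        using bspec[OF c w(1)] s[OF w(1)] unfolding w(2) qexp_power by simp
    qed
  qed
qed

text \<open>Expansions at cusps converge for \<open>q \<noteq> 0\<close> only, so the constant term is first obtained as a limit.\<close>

lemma powser_zero_off_0_imp_zero:
  fixes d :: "nat \<Rightarrow> complex"
  assumes "\<And>q. q \<noteq> 0 \<Longrightarrow> norm q < 1 \<Longrightarrow> (\<lambda>n. d n * q ^ n) sums 0"
  shows "d n = 0"
proof -
  have "((\<lambda>_. 0) \<longlongrightarrow> d 0) (at (0::complex))"
    by (rule powser_limit_0_strong[where s = 1 and a = d]) (use assms in auto)
  then have d0: "d 0 = 0" using tendsto_unique[OF trivial_limit_at _ tendsto_const] by metis
  have s: "(\<lambda>n. d n * q ^ n) sums 0" if "norm q < 1" for q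
    using assms that powser_sums_zero[of d] d0 by (cases "q = 0") auto
  show ?thesis
  proof (cases "n = 0")
    case False
    show ?thesis
    proof (rule ccontr)
      assume dn: "d n \<noteq> 0"
      show False
      proof (rule powser_0_nonzero[of 1 0 d "\<lambda>_. 0" n])
        fix r :: real assume "r > 0" and nz: "\<And>z. z \<in> cball 0 r - {0::complex} \<Longrightarrow> (0::complex) \<noteq> 0"
        then have "of_real r \<in> cball 0 r - {0::complex}" by simp
        then show False using nz by blast
      qed (use s dn False in auto)
    qed
  qed (use d0 in simp)
qed

lemma cusp_expansion_unique:
  assumes \<sigma>: "\<sigma> \<in> SL" and h: "h > 0" and a: "cusp_expansion m f \<sigma> h a" "cusp_expansion m f \<sigma> h b"
  shows "a = b"
proof
  fix n
  have "a n - b n = 0"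
  proof (rule powser_zero_off_0_imp_zero)
    fix q :: complex assume q: "q \<noteq> 0" "norm q < 1"
    obtain \<zeta> where \<zeta>: "qexp h \<zeta> = q" "Im \<zeta> > 0" using qexp_surj[OF h q(1), of 0] q(2) by auto
    then have "\<zeta> \<in> \<H>" by (simp add: upper_half_plane_iff)
    then have w: "moebius (adj22 \<sigma>) \<zeta> \<in> \<H>" "moebius \<sigma> (moebius (adj22 \<sigma>) \<zeta>) = \<zeta>"
      using \<sigma> by simp_all
    show "(\<lambda>n. (a n - b n) * q ^ n) sums 0"
      using sums_diff[OF bspec[OF iffD1[OF cusp_expansion_iff[OF \<sigma>] a(1)] w(1)]
          bspec[OF iffD1[OF cusp_expansion_iff[OF \<sigma>] a(2)] w(1)]]
      unfolding w(2) \<zeta>(1) by (simp add: left_diff_distrib)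
  qed
  then show "a n = b n" by simp
qed

text \<open>The order at a cusp is defined by means of a chosen representative and scaling.  Everything that
  concerns this order is computed for this choice.\<close>

lemma cusp_order_expansion:
  assumes "b \<in> cusp_points \<Gamma>"
  obtains x \<sigma> h where "x \<in> cusps \<Gamma>" "b = orbit \<Gamma> x" "cusp_scaling \<Gamma> x \<sigma> h"
    "\<And>m f a. cusp_expansion m f \<sigma> h a \<Longrightarrow> cusp_order \<Gamma> m f b = (LEAST n. a n \<noteq> 0)"
proof -
  define P where "P = (\<lambda>(x, \<sigma>, h). x \<in> cusps \<Gamma> \<and> x \<in> b \<and> cusp_scaling \<Gamma> x \<sigma> h)"
  obtain x0 where x0: "x0 \<in> cusps \<Gamma>" "b = orbit \<Gamma> x0" using assms by (auto simp: cusp_points_def)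
  obtain \<sigma>0 h0 where s0: "cusp_scaling \<Gamma> x0 \<sigma>0 h0" using cusp_scaling_exists[OF x0(1)] .
  obtain x \<sigma> h where E: "Eps P = (x, \<sigma>, h)" by (cases "Eps P")
  have "P (Eps P)" by (rule someI[of P "(x0, \<sigma>0, h0)"]) (use x0 s0 in \<open>auto simp: P_def\<close>)
  then have P: "x \<in> cusps \<Gamma>" "x \<in> b" "cusp_scaling \<Gamma> x \<sigma> h" unfolding E by (auto simp: P_def)
  have "b = orbit \<Gamma> x"
  proof -
    obtain \<gamma> where "\<gamma> \<in> \<Gamma>" "x = emoebius \<gamma> x0" using P(2) unfolding x0(2) orbit_def by blast
    then show ?thesis unfolding x0(2) orbit_eq_iff by blast
  qed
  moreover have "cusp_order \<Gamma> m f b = (LEAST n. a n \<noteq> 0)" if a: "cusp_expansion m f \<sigma> h a" for m f a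
  proof -
    have "\<sigma> \<in> SL" "h > 0" using P(3) by (auto simp: cusp_scaling_iff)
    then have "(THE a. cusp_expansion m f \<sigma> h a) = a" using a cusp_expansion_unique by blast
    then show ?thesis unfolding cusp_order_def P_def[symmetric] E by simp
  qed
  ultimately show ?thesis using that P by blast
qed

text \<open>A form is periodic in the coordinate \<open>\<sigma> w\<close>, because the translation by \<open>h\<close> comes, up to sign,
  from the group.\<close>

lemma form_periodic_at_cusp:
  assumes sc: "cusp_scaling \<Gamma> x \<sigma> h" and hol: "f holomorphic_on \<H>"
    and mod: "\<And>\<gamma> z. \<gamma> \<in> \<Gamma> \<Longrightarrow> z \<in> \<H> \<Longrightarrow> f (moebius \<gamma> z) = cocycle \<gamma> z ^ (2 * l) * f z"
  obtains K where "K holomorphic_on ball 0 1 - {0}"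
    "\<And>w. w \<in> \<H> \<Longrightarrow> K (qexp h (moebius \<sigma> w)) = f w * cocycle \<sigma> w ^ (2 * l)"
proof -
  have \<sigma>: "\<sigma> \<in> SL" "h > 0" using sc by (auto simp: cusp_scaling_iff)
  define F where "F = (\<lambda>\<zeta>. f (moebius (adj22 \<sigma>) \<zeta>) * cocycle \<sigma> (moebius (adj22 \<sigma>) \<zeta>) ^ (2 * l))"
  have F: "F (moebius \<sigma> w) = f w * cocycle \<sigma> w ^ (2 * l)" if "w \<in> \<H>" for w
    using that \<sigma> by (simp add: F_def)
  have H: "{z. Im z > 0} = \<H>" by (simp add: upper_half_plane_def)
  have "f \<circ> moebius (adj22 \<sigma>) holomorphic_on \<H>"
    by (rule holomorphic_on_compose_gen[OF moebius_holomorphic hol]) (use \<sigma> in auto)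
  moreover have "cocycle \<sigma> \<circ> moebius (adj22 \<sigma>) holomorphic_on \<H>"
    by (rule holomorphic_on_compose_gen[OF moebius_holomorphic, of _ _ \<H>])
       (use \<sigma> in \<open>auto simp: cocycle_def[abs_def] intro!: holomorphic_intros\<close>)
  ultimately have "F holomorphic_on \<H>"
    unfolding F_def comp_def by (intro holomorphic_intros)
  moreover have "F (z + of_real h) = F z" if "z \<in> \<H>" for z
  proof -
    define w where "w = moebius (adj22 \<sigma>) z"
    define w' where "w' = moebius (adj22 \<sigma>) (z + of_real h)"
    have zh: "z + of_real h \<in> \<H>" using that by (simp add: upper_half_plane_iff)
    have w: "w \<in> \<H>" "w' \<in> \<H>" "moebius \<sigma> w = z" "moebius \<sigma> w' = z + of_real h"
      using that zh \<sigma> by (simp_all add: w_def w'_def)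
    have "moebius \<sigma> w' = moebius \<sigma> w + of_real (of_int 1 * h)" using w by simp
    then obtain \<gamma> where \<gamma>: "\<gamma> \<in> \<Gamma>" "emoebius \<gamma> x = x" "w' = moebius \<gamma> w"
      by (rule translation_from_stab[OF sc w(1,2)])
    have sq: "(cocycle \<sigma> w' * cocycle \<gamma> w)\<^sup>2 = (cocycle \<sigma> w)\<^sup>2"
      using stab_cusp_translation[OF sc \<gamma>(1,2) w(1)] \<gamma>(3) by metis
    have "F (z + of_real h) = f w' * cocycle \<sigma> w' ^ (2 * l)" using F[OF w(2)] w(4) by simp
    also have "\<dots> = f w * ((cocycle \<sigma> w' * cocycle \<gamma> w)\<^sup>2) ^ l"
      unfolding \<gamma>(3) mod[OF \<gamma>(1) w(1)] by (simp add: power_mult_distrib power_mult[symmetric] mult_ac)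
    also have "\<dots> = F z" unfolding sq using F[OF w(1)] w(3) by (simp add: power_mult)
    finally show ?thesis .
  qed
  ultimately obtain K where K: "K holomorphic_on ball 0 1 - {0}" "\<And>z. Im z > 0 \<Longrightarrow> K (qexp h z) = F z"
    using periodic_descend[OF \<sigma>(2), of F] unfolding H by (auto simp: upper_half_plane_iff)
  show ?thesis
  proof (rule that[OF K(1)])
    fix w assume w: "w \<in> \<H>"
    then have "moebius \<sigma> w \<in> \<H>" using \<sigma> by simp
    then show "K (qexp h (moebius \<sigma> w)) = f w * cocycle \<sigma> w ^ (2 * l)"
      using K(2) F[OF w] by (simp add: upper_half_plane_iff)
  qed
qed

lemma higher_deriv_power_mult:
  assumes "open S" "0 \<in> S" "g holomorphic_on S"
  shows "n < l \<Longrightarrow> (deriv ^^ n) (\<lambda>u. u ^ l * g u) 0 = 0"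
    "(deriv ^^ l) (\<lambda>u. u ^ l * g u) 0 = fact l * g 0"
proof -
  have *: "(deriv ^^ n) (\<lambda>u. u ^ l * g u) 0 =
      (\<Sum>i = 0..n. of_nat (n choose i) * (deriv ^^ i) (\<lambda>u. u ^ l) 0 * (deriv ^^ (n - i)) g 0)" for n
    by (rule higher_deriv_mult) (use assms in \<open>auto intro!: holomorphic_intros\<close>)
  have p: "(deriv ^^ i) (\<lambda>u. u ^ l) 0 = pochhammer (of_nat (Suc l - i)) i * (0::complex) ^ (l - i)" for i
    using higher_deriv_power[of i 0 l 0] by simp
  show "(deriv ^^ n) (\<lambda>u. u ^ l * g u) 0 = 0" if "n < l"
    unfolding * p using that by (intro sum.neutral) auto
  have "(deriv ^^ l) (\<lambda>u. u ^ l * g u) 0 =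
      (\<Sum>i\<in>{l}. of_nat (l choose i) * (deriv ^^ i) (\<lambda>u. u ^ l) 0 * (deriv ^^ (l - i)) g 0)"
    unfolding * by (rule sum.mono_neutral_right) (auto simp: p)
  also have "\<dots> = fact l * g 0" by (simp add: p pochhammer_fact)
  finally show "(deriv ^^ l) (\<lambda>u. u ^ l * g u) 0 = fact l * g 0" .
qed

text \<open>By periodicity, the form is a function \<open>K\<close> of the coordinate \<open>q\<close> on the whole punctured unit disc.
  Near \<open>0\<close>, where the chart is defined, it equals \<open>(c q)\<^sup>l G(q)\<close> with the local expression \<open>G\<close> of the
  differential and the constant \<open>c\<close> in \<open>dq = c q d\<zeta>\<close>, so it extends holomorphically over \<open>0\<close> with a zero of
  order at least \<open>l\<close>.\<close>

lemma pullback_cusp_expansion: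
  assumes \<omega>: "\<omega> \<in> H_space \<Gamma> l" and l: "l \<ge> 1" and c: "cusp_chart x \<sigma> h T U \<phi>"
  obtains a where "cusp_expansion (2 * l) (pullback l \<omega>) \<sigma> h a" "\<And>n. n < l \<Longrightarrow> a n = 0"
    "a l = (2 * of_real pi * \<i> / of_real h) ^ l * \<omega> (U, \<phi>) 0"
proof -
  let ?f = "pullback l \<omega>" and ?c = "2 * of_real pi * \<i> / of_real h :: complex" and ?G = "\<omega> (U, \<phi>)"
  let ?R = "exp (- (2 * pi * T / h))"
  have sc: "cusp_scaling \<Gamma> x \<sigma> h" and T: "T > 0" using c by (auto simp: cusp_chart_def)
  have \<sigma>: "\<sigma> \<in> SL" "h > 0" using sc by (auto simp: cusp_scaling_iff)
  have A: "(U, \<phi>) \<in> atlas \<Gamma>" by (rule cusp_chart_atlas[OF c])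
  have im: "\<phi> ` U = ball 0 ?R" using chart_image(1)[OF cusp_chart_data[OF c]] .
  have G: "?G holomorphic_on ball 0 ?R" using H_space_holomorphic[OF \<omega> A] unfolding im .
  obtain K where K: "K holomorphic_on ball 0 1 - {0}"
    "\<And>w. w \<in> \<H> \<Longrightarrow> K (qexp h (moebius \<sigma> w)) = ?f w * cocycle \<sigma> w ^ (2 * l)"
    using form_periodic_at_cusp[OF sc pullback_holomorphic[OF \<omega>], of l] pullback_moebius[OF H_space_mero[OF \<omega>]] by metis
  have near: "K u = u ^ l * (?c ^ l * ?G u)" if u: "u \<noteq> 0" "norm u < ?R" for u
  proof -
    obtain \<zeta> where \<zeta>: "qexp h \<zeta> = u" "Im \<zeta> > T" using qexp_surj[OF \<sigma>(2) u] .
    define w where "w = moebius (adj22 \<sigma>) \<zeta>"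
    have "\<zeta> \<in> \<H>" using \<zeta>(2) T by (simp add: upper_half_plane_iff)
    then have w: "w \<in> \<H>" "moebius \<sigma> w = \<zeta>" using \<sigma> by (simp_all add: w_def)
    have wT: "Im (moebius \<sigma> w) > T" using w \<zeta> by simp
    define B where "B = (cocycle \<sigma> w)\<^sup>2"
    have B: "B \<noteq> 0" using \<sigma> w(1) by (simp add: B_def)
    have "?f w = ?G u * (?c * u * (1 / B)) ^ l"
      using pullback_chart[OF H_space_mero[OF \<omega>] A cusp_chart_lift(1)[OF c w(1) wT]]
        cusp_chart_lift(2)[OF c w(1) wT] DERIV_imp_deriv[OF cusp_chart_lift(3)[OF c w(1) wT]] w \<zeta>
      by (simp add: B_def)
    moreover have "K u = ?f w * B ^ l"
      using K(2)[OF w(1)] unfolding w(2) \<zeta>(1) by (simp only: B_def power_mult)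
    ultimately have "K u = ?G u * (?c * u * (1 / B) * B) ^ l"
      by (simp only: power_mult_distrib mult.assoc)
    also have "?c * u * (1 / B) * B = ?c * u" using B by simp
    finally show ?thesis by (simp only: power_mult_distrib mult_ac)
  qed
  define K0 where "K0 = (\<lambda>u. if u = 0 then 0 else K u)"
  have K0: "K0 u = u ^ l * (?c ^ l * ?G u)" if "u \<in> ball 0 ?R" for u
    using that near[of u] l by (simp add: K0_def)
  have g: "(\<lambda>u. ?c ^ l * ?G u) holomorphic_on ball 0 ?R" by (intro holomorphic_intros G)
  have K0R: "K0 holomorphic_on ball 0 ?R"
    by (rule holomorphic_transform[of "\<lambda>u. u ^ l * (?c ^ l * ?G u)"]) (use K0 g in \<open>auto intro!: holomorphic_intros\<close>)
  have "(K \<longlongrightarrow> 0) (at 0)"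
  proof (rule Lim_transform_eventually)
    have "continuous_on (ball 0 ?R) K0" by (rule holomorphic_on_imp_continuous_on[OF K0R])
    then have "isCont K0 0" by (simp add: continuous_on_eq_continuous_at)
    then show "(K0 \<longlongrightarrow> 0) (at 0)" by (simp add: isCont_def K0_def)
    show "\<forall>\<^sub>F u in at 0. K0 u = K u" by (auto simp: eventually_at_filter K0_def)
  qed
  then have hK0: "K0 holomorphic_on ball 0 1" unfolding K0_def by (rule holomorphic_fill_puncture[OF K(1)])
  define a where "a = (\<lambda>n. (deriv ^^ n) K0 0 / fact n)"
  have d: "(deriv ^^ n) K0 0 = (deriv ^^ n) (\<lambda>u. u ^ l * (?c ^ l * ?G u)) 0" for n
    by (rule higher_deriv_transform_within_open[OF K0R _ open_ball])
       (use K0 g in \<open>auto intro!: holomorphic_intros\<close>)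
  show ?thesis
  proof (rule that[of a])
    show "cusp_expansion (2 * l) ?f \<sigma> h a"
      unfolding cusp_expansion_iff[OF \<sigma>(1)]
    proof
      fix w assume w: "w \<in> \<H>"
      then have "moebius \<sigma> w \<in> \<H>" using \<sigma> by simp
      then have "norm (qexp h (moebius \<sigma> w)) < 1" using \<sigma> by (simp add: norm_qexp upper_half_plane_iff)
      then have "(\<lambda>n. a n * (qexp h (moebius \<sigma> w) - 0) ^ n) sums K0 (qexp h (moebius \<sigma> w))"
        unfolding a_def by (intro holomorphic_power_series[OF hK0]) simp
      moreover have "K0 (qexp h (moebius \<sigma> w)) = ?f w * cocycle \<sigma> w ^ (2 * l)"
        unfolding K0_def using K(2)[OF w] by simp
      ultimately show "(\<lambda>n. a n * qexp h (moebius \<sigma> w) ^ n) sums (?f w * cocycle \<sigma> w ^ (2 * l))" by simp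
    qed
    show "a n = 0" if "n < l" for n
      using higher_deriv_power_mult(1)[OF open_ball _ g that] by (simp add: a_def d)
    show "a l = ?c ^ l * ?G 0"
      using higher_deriv_power_mult(2)[OF open_ball _ g] by (simp add: a_def d)
  qed
qed

end

section \<open>Holomorphic differentials and forms\<close>

context discrete_group
begin

lemma countable_group: "countable \<Gamma>"
proof -
  have "\<Gamma> \<subseteq> (\<Union>n. {\<gamma> \<in> \<Gamma>. entries_le (of_nat n) \<gamma>})"
  proof
    fix \<gamma> assume "\<gamma> \<in> \<Gamma>"
    moreover obtain n :: nat where n: "norm \<gamma> \<le> of_nat n" using real_arch_simple by blast
    have "entries_le (of_nat n) \<gamma>"
      using entries_le_norm[of \<gamma>] n unfolding entries_le_def by (elim conjE, intro conjI) linarith+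
    ultimately show "\<gamma> \<in> (\<Union>n. {\<gamma> \<in> \<Gamma>. entries_le (of_nat n) \<gamma>})" by blast
  qed
  moreover have "countable (\<Union>n. {\<gamma> \<in> \<Gamma>. entries_le (of_nat n) \<gamma>})"
    by (rule countable_UN) (simp_all add: countable_finite finite_entries_le)
  ultimately show ?thesis by (rule countable_subset)
qed

text \<open>The zeros of a lifted coordinate form a single orbit, and orbits are countable.\<close>

lemma frequently_lift_nonzero:
  assumes A: "(U, \<phi>) \<in> atlas \<Gamma>" and z: "z \<in> chart_dom U"
  shows "\<exists>\<^sub>F w in at z. lift \<phi> w \<noteq> 0"
proof (rule ccontr)
  assume "\<not> ?thesis"
  then have "\<forall>\<^sub>F w in at z. lift \<phi> w = 0" by (simp add: frequently_def)
  then obtain d where d: "d > 0" "\<And>w. w \<noteq> z \<Longrightarrow> dist w z < d \<Longrightarrow> lift \<phi> w = 0"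
    unfolding eventually_at by auto
  obtain N \<rho> where dd: "chart_data U \<phi> N \<rho>" using chart_data_exists[OF A] .
  obtain d' where d': "d' > 0" "ball z d' \<subseteq> chart_dom U"
    using open_chart_dom[OF dd] z open_contains_ball by blast
  let ?r = "min d d'"
  have r: "?r > 0" using d d' by simp
  define p where "p = z + of_real (?r / 2)"
  have p: "p \<noteq> z" "dist p z < ?r" using r by (auto simp: p_def dist_norm)
  have pU: "p \<in> chart_dom U" using p d' by (auto simp: dist_commute)
  have "ball z ?r \<subseteq> insert z ((\<lambda>\<gamma>. moebius \<gamma> p) ` \<Gamma>)"
  proof
    fix w assume w: "w \<in> ball z ?r"
    show "w \<in> insert z ((\<lambda>\<gamma>. moebius \<gamma> p) ` \<Gamma>)"
    proof (cases "w = z")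
      case False
      have "w \<in> chart_dom U" using w d' by auto
      moreover have "lift \<phi> p = lift \<phi> w" using d(2)[of p] d(2)[of w] p w False by (simp add: dist_commute)
      ultimately show ?thesis using lift_eq_imp_orbit[OF dd pU] by blast
    qed simp
  qed
  moreover have "countable (insert z ((\<lambda>\<gamma>. moebius \<gamma> p) ` \<Gamma>))" using countable_group by simp
  ultimately show False using uncountable_ball[OF r, of z] countable_subset by blast
qed

lemma pullback_zero: "pullback l 0 = 0"
  by (auto simp: pullback_def fun_eq_iff split: prod.split)

text \<open>A local expression that vanishes near one point vanishes on its chart, hence the pull-back vanishes on
  an open subset of the connected set \<open>\<H>\<close>.\<close>

lemma chart_expression_nonzero:
  assumes \<omega>: "\<omega> \<in> H_space \<Gamma> l" "\<omega> \<noteq> 0" and A: "(U, \<phi>) \<in> atlas \<Gamma>" and u: "u \<in> \<phi> ` U"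
  shows "\<exists>\<^sub>F v in at u. \<omega> (U, \<phi>) v \<noteq> 0"
proof (rule ccontr)
  assume "\<not> ?thesis"
  then have "\<forall>\<^sub>F v in at u. \<omega> (U, \<phi>) v = 0" by (simp add: frequently_def)
  then obtain d where d: "d > 0" "\<And>v. v \<noteq> u \<Longrightarrow> dist v u < d \<Longrightarrow> \<omega> (U, \<phi>) v = 0"
    unfolding eventually_at by auto
  obtain N \<rho> where dd: "chart_data U \<phi> N \<rho>" using chart_data_exists[OF A] .
  note im = chart_image[OF dd]
  have G: "\<omega> (U, \<phi>) holomorphic_on ball 0 \<rho>" using H_space_holomorphic[OF \<omega>(1) A] unfolding im(1) .
  obtain d' where d': "d' > 0" "ball u d' \<subseteq> ball 0 \<rho>" using u unfolding im(1) by (meson open_ball open_contains_ball)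
  let ?r = "min d d'"
  have G0: "\<omega> (U, \<phi>) v = 0" if v: "v \<in> ball 0 \<rho>" for v
  proof (rule analytic_continuation[OF G open_ball connected_ball, of "ball u ?r - {u}" u])
    show "ball u ?r - {u} \<subseteq> ball 0 \<rho>" using d' by auto
    show "u \<in> ball 0 \<rho>" using u unfolding im(1) .
    have "u islimpt ball u ?r" using d(1) d'(1) by (simp add: islimpt_ball)
    then show "u islimpt ball u ?r - {u}" by (simp only: islimpt_punctured[symmetric])
    show "\<omega> (U, \<phi>) w = 0" if "w \<in> ball u ?r - {u}" for w using that d(2)[of w] by (simp add: dist_commute)
  qed (rule v)
  have P0: "pullback l \<omega> z = 0" if z: "z \<in> chart_dom U" for z
    unfolding pullback_chart[OF H_space_mero[OF \<omega>(1)] A z] using G0[OF lift_image[OF dd z]] by simp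
  obtain p where p: "p \<in> N" "lift \<phi> p = of_real (\<rho> / 2)" using lift_surj[OF dd, of "of_real (\<rho> / 2)"] im(2) by auto
  have pU: "p \<in> chart_dom U" using chart_N(3)[OF dd] p by blast
  have "pullback l \<omega> z = 0" if z: "z \<in> \<H>" for z
  proof (rule analytic_continuation[OF pullback_holomorphic[OF \<omega>(1)] open_upper_half_plane connected_upper_half_plane, of "chart_dom U" p])
    show "chart_dom U \<subseteq> \<H>" by (rule chart_dom_subset)
    show "p \<in> \<H>" using pU chart_dom_subset by blast
    show "p islimpt chart_dom U" using pU open_chart_dom[OF dd] by (intro interior_limit_point) (simp add: interior_open)
  qed (use P0 z in auto)
  then have "pullback l \<omega> = pullback l 0" unfolding pullback_zero using pullback_off_H by (auto simp: fun_eq_iff)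
  then show False using pullback_inj[OF \<omega>(1) H_space_zero] \<omega>(2) by blast
qed

text \<open>The coordinate is \<open>w\<^sup>e\<close> with a coordinate \<open>w\<close> of \<open>\<H>\<close> at \<open>\<xi>\<close>, and \<open>d(w\<^sup>e) = e w\<^sup>e\<^sup>-\<^sup>1 dw\<close>.  A differential
  of order \<open>k\<close> thus pulls back to a form of order \<open>e k + l (e - 1)\<close>.\<close>

lemma zorder_pullback:
  assumes \<omega>: "\<omega> \<in> H_space \<Gamma> l" "\<omega> \<noteq> 0" and c: "interior_chart \<xi> r U \<phi>"
  obtains k :: nat where
    "zorder (pullback l \<omega>) \<xi> = int (ellip_order \<Gamma> \<xi> * k + l * (ellip_order \<Gamma> \<xi> - 1))"
proof -
  let ?e = "ellip_order \<Gamma> \<xi>" and ?G = "\<omega> (U, \<phi>)" and ?f = "pullback l \<omega>"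
  have i: "\<xi> \<in> \<H>" "0 < r" using c unfolding interior_chart_def by blast+
  have e: "?e > 0" by (rule rotations_of_stab(1)[OF i(1)])
  have A: "(U, \<phi>) \<in> atlas \<Gamma>" by (rule interior_chart_atlas[OF c])
  have im: "\<phi> ` U = ball 0 (r ^ ?e)" using chart_image(1)[OF interior_chart_data[OF c]] .
  have G: "?G holomorphic_on ball 0 (r ^ ?e)" using H_space_holomorphic[OF \<omega>(1) A] unfolding im .
  have R: "(0::complex) \<in> ball 0 (r ^ ?e)" using i(2) by simp
  have "\<exists>\<^sub>F v in at 0. ?G v \<noteq> 0" by (rule chart_expression_nonzero[OF \<omega> A]) (use im R in simp)
  moreover have "\<forall>\<^sub>F v in at (0::complex). v \<in> ball 0 (r ^ ?e)" by (rule eventually_at_in_open'[OF open_ball R])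
  ultimately have "\<exists>\<^sub>F v in at 0. ?G v \<noteq> 0 \<and> v \<in> ball 0 (r ^ ?e)" by (rule frequently_eventually_frequently)
  then have ex: "\<exists>v\<in>ball 0 (r ^ ?e). ?G v \<noteq> 0" using frequently_ex by blast
  define k where "k = nat (zorder ?G 0)"
  define g where "g = zor_poly ?G 0"
  note zz = conjunct2[OF zorder_exist_zero[OF G open_ball connected_ball R ex], folded k_def g_def]
  from zz obtain s where s: "s > 0" "cball (0::complex) s \<subseteq> ball 0 (r ^ ?e)" "g holomorphic_on cball 0 s"
    and s': "\<forall>v\<in>cball 0 s. ?G v = g v * (v - 0) ^ k \<and> g v \<noteq> 0"
    by (elim exE conjE) (rule that)
  note s = s bspec[OF s']
  define M where "M = ?e * k + l * (?e - 1)"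
  define D where "D = {z \<in> \<H>. norm (cayley \<xi> z) < r}"
  have D: "open D" "\<xi> \<in> D" using open_cayley_disc[OF i(1)] i by (simp_all add: D_def)
  have DH: "D \<subseteq> \<H>" by (auto simp: D_def)
  define S where "S = D \<inter> (\<lambda>z. cayley \<xi> z ^ ?e) -` ball 0 s"
  have hc: "cayley \<xi> holomorphic_on D" using cayley_holomorphic[OF i(1)] DH by (rule holomorphic_on_subset)
  have S: "open S" "\<xi> \<in> S"
  proof -
    show "open S" unfolding S_def
      by (intro continuous_open_preimage holomorphic_on_imp_continuous_on holomorphic_on_power hc D(1) open_ball)
    show "\<xi> \<in> S" using D(2) s(1) e by (simp add: S_def power_0_left)
  qed
  define h where "h = (\<lambda>z. g (cayley \<xi> z ^ ?e) * of_nat ?e ^ l * deriv (cayley \<xi>) z ^ l * (1 / (z - cnj \<xi>)) ^ M)"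
  have "zorder ?f \<xi> = int M"
  proof (rule zorder_eqI[OF S, of h])
    have "g \<circ> (\<lambda>z. cayley \<xi> z ^ ?e) holomorphic_on S"
      by (rule holomorphic_on_compose_gen[of _ S g "ball 0 s"])
         (use hc s(3) in \<open>auto simp: S_def intro!: holomorphic_on_power elim: holomorphic_on_subset\<close>)
    moreover have "deriv (cayley \<xi>) holomorphic_on S"
      using holomorphic_deriv[OF hc D(1)] by (rule holomorphic_on_subset) (auto simp: S_def)
    moreover have "(\<lambda>z. 1 / (z - cnj \<xi>)) holomorphic_on S"
      using cayley_denom[OF _ i(1)] DH by (intro holomorphic_intros) (auto simp: S_def)
    ultimately show "h holomorphic_on S" unfolding h_def comp_def
      by (intro holomorphic_on_mult holomorphic_on_power holomorphic_on_const)
    have "g 0 \<noteq> 0" using s(1) s(4)[of 0] by simp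
    then show "h \<xi> \<noteq> 0"
      using deriv_cayley_nonzero[OF i(1,1)] cayley_denom[OF i(1,1)] e by (simp add: h_def power_0_left)
  next
    fix z assume z: "z \<in> S" "z \<noteq> \<xi>"
    have zD: "z \<in> \<H>" "norm (cayley \<xi> z) < r" using z(1) by (auto simp: S_def D_def)
    let ?w = "cayley \<xi> z"
    have "?w ^ ?e \<in> cball 0 s" using z(1) by (auto simp: S_def)
    then have Gw: "?G (?w ^ ?e) = g (?w ^ ?e) * (?w ^ ?e) ^ k" using s(4) by simp
    have "?f z = ?G (?w ^ ?e) * (of_nat ?e * ?w ^ (?e - 1) * deriv (cayley \<xi>) z) ^ l"
      using pullback_chart[OF H_space_mero[OF \<omega>(1)] A interior_chart_lift(1)[OF c zD]]
        interior_chart_lift(2)[OF c zD] DERIV_imp_deriv[OF interior_chart_lift(3)[OF c zD]] by simp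
    also have "\<dots> = g (?w ^ ?e) * of_nat ?e ^ l * deriv (cayley \<xi>) z ^ l * ?w ^ M"
      unfolding Gw M_def by (simp add: power_mult_distrib power_add power_mult[symmetric] mult_ac)
    also have "?w ^ M = (1 / (z - cnj \<xi>)) ^ M * (z - \<xi>) ^ M"
      unfolding power_mult_distrib[symmetric] by (simp add: cayley_def)
    finally show "?f z = h z * (z - \<xi>) powi int M" by (simp add: h_def mult.assoc)
  qed
  then show ?thesis using that unfolding M_def by blast
qed

lemma not_cusp_point_interior:
  assumes "a \<in> surface \<Gamma>" "a \<notin> cusp_points \<Gamma>"
  shows "interior_rep a \<in> \<H>" "a = orbit \<Gamma> (Fin (interior_rep a))"
proof -
  obtain z where z: "z \<in> \<H>" "a = orbit \<Gamma> (Fin z)"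
    using assms by (auto simp: surface_def extended_half_plane_def cusp_points_def)
  have *: "interior_rep a \<in> \<H> \<and> Fin (interior_rep a) \<in> a"
    unfolding interior_rep_def by (rule someI[of _ z]) (use z in simp)
  then show "interior_rep a \<in> \<H>" by blast
  have "Fin (interior_rep a) \<in> orbit \<Gamma> (Fin z)" using * z(2) by simp
  then have "\<exists>\<gamma>\<in>\<Gamma>. Fin (interior_rep a) = emoebius \<gamma> (Fin z)" unfolding orbit_def by blast
  then show "a = orbit \<Gamma> (Fin (interior_rep a))" unfolding z(2) orbit_eq_iff .
qed

lemma cusp_point_not_elliptic: "b \<in> cusp_points \<Gamma> \<Longrightarrow> b \<notin> elliptic_points \<Gamma>"
  using orbit_cusp_not_H[OF cusps_boundary] by (auto simp: cusp_points_def elliptic_points_def)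

text \<open>At an elliptic point the fractional part subtracted from the divisor of the form and the integral part
  required of it add up to \<open>l (1 - 1 / e)\<close>; at other points \<open>e = 1\<close> and this is \<open>0\<close>.\<close>

lemma divisor_diff_interior:
  assumes "a \<in> surface \<Gamma>" "a \<notin> cusp_points \<Gamma>"
  shows "c_divisor \<Gamma> (2 * l) f a - SH_divisor \<Gamma> (2 * l) a =
    (of_int (zorder f (interior_rep a)) - of_nat (l * (point_order \<Gamma> a - 1))) / of_nat (point_order \<Gamma> a)"
proof -
  let ?\<xi> = "interior_rep a" and ?e = "point_order \<Gamma> a"
  note \<xi> = not_cusp_point_interior[OF assms]
  have e: "?e > 0" unfolding point_order_def by (rule rotations_of_stab(1)[OF \<xi>(1)])
  have w: "elliptic_weight \<Gamma> (2 * l) a = of_nat (l * (?e - 1)) / of_nat ?e"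
    using e by (simp add: elliptic_weight_def of_nat_diff field_simps)
  have "c_divisor \<Gamma> (2 * l) f a - SH_divisor \<Gamma> (2 * l) a = div_form \<Gamma> (2 * l) f a - elliptic_weight \<Gamma> (2 * l) a"
  proof (cases "a \<in> elliptic_points \<Gamma>")
    case False
    have "?e = 1"
    proof (rule ccontr)
      assume "?e \<noteq> 1"
      then have "ellip_order \<Gamma> ?\<xi> > 1" using e by (simp add: point_order_def)
      then have "orbit \<Gamma> (Fin ?\<xi>) \<in> elliptic_points \<Gamma>" unfolding elliptic_points_def using \<xi>(1) by blast
      then show False using False \<xi>(2) by simp
    qed
    then show ?thesis using assms False by (simp add: c_divisor_def c'_divisor_def SH_divisor_def elliptic_weight_def)
  qed (use assms in \<open>simp add: c_divisor_def c'_divisor_def SH_divisor_def\<close>)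
  also have "div_form \<Gamma> (2 * l) f a = of_int (zorder f ?\<xi>) / of_nat ?e"
    using assms(2) by (simp add: div_form_def)
  finally show ?thesis unfolding w by (simp add: diff_divide_distrib)
qed

lemma divisor_diff_cusp:
  assumes "b \<in> cusp_points \<Gamma>"
  shows "c_divisor \<Gamma> (2 * l) f b - SH_divisor \<Gamma> (2 * l) b = of_nat (cusp_order \<Gamma> (2 * l) f b) - of_nat l"
  using assms cusp_point_not_elliptic[OF assms]
  by (simp add: c_divisor_def c'_divisor_def SH_divisor_def div_form_def)

lemma cusp_chart_through:
  assumes "cusp_scaling \<Gamma> x \<sigma> h" "x \<in> cusps \<Gamma>"
  obtains T U \<phi> where "cusp_chart x \<sigma> h T U \<phi>" "(U, \<phi>) \<in> atlas \<Gamma>" "orbit \<Gamma> x \<in> U" "\<phi> (orbit \<Gamma> x) = 0"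
proof -
  obtain T U \<phi> where c: "cusp_chart x \<sigma> h T U \<phi>" using cusp_chart_exists[OF assms(2,1)] .
  then have "orbit \<Gamma> x \<in> U" "\<phi> (orbit \<Gamma> x) = 0" unfolding cusp_chart_def by blast+
  then show ?thesis using that[OF c cusp_chart_atlas[OF c]] by blast
qed

lemma cusp_expansion_nonzero:
  assumes "\<sigma> \<in> SL" "cusp_expansion m f \<sigma> h a" "f \<noteq> 0" "\<And>z. z \<notin> \<H> \<Longrightarrow> f z = 0"
  shows "\<exists>n. a n \<noteq> 0"
proof (rule ccontr)
  assume "\<nexists>n. a n \<noteq> 0"
  then have a: "a = (\<lambda>_. 0)" by auto
  have "f w = 0" for w
  proof (cases "w \<in> \<H>")
    case True
    have "(\<lambda>n. 0) sums (f w * cocycle \<sigma> w ^ m)"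
      using iffD1[OF cusp_expansion_iff[OF assms(1)] assms(2)] True by (simp add: a)
    then have "f w * cocycle \<sigma> w ^ m = 0" using sums_unique2 sums_zero by blast
    then show ?thesis using assms(1) True by simp
  qed (rule assms(4))
  then show False using assms(3) by auto
qed

text \<open>At a cusp, the exponential coordinate \<open>q\<close> satisfies \<open>d\<zeta> = c dq / q\<close> with a constant \<open>c\<close>, so that
  the order of a form of weight \<open>2l\<close> exceeds that of its differential by \<open>l\<close>.\<close>

lemma cusp_order_pullback:
  assumes \<omega>: "\<omega> \<in> H_space \<Gamma> l" "\<omega> \<noteq> 0" and l: "l \<ge> 1" and b: "b \<in> cusp_points \<Gamma>"
  shows "cusp_order \<Gamma> (2 * l) (pullback l \<omega>) b \<ge> l"
    "\<exists>U \<phi>. (U, \<phi>) \<in> atlas \<Gamma> \<and> b \<in> U \<and>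
       (cusp_order \<Gamma> (2 * l) (pullback l \<omega>) b > l \<longleftrightarrow> \<omega> (U, \<phi>) (\<phi> b) = 0)"
proof -
  obtain x \<sigma> h where x: "x \<in> cusps \<Gamma>" "b = orbit \<Gamma> x" "cusp_scaling \<Gamma> x \<sigma> h"
    and ord: "\<And>m f a. cusp_expansion m f \<sigma> h a \<Longrightarrow> cusp_order \<Gamma> m f b = (LEAST n. a n \<noteq> 0)"
    using cusp_order_expansion[OF b] by metis
  have \<sigma>: "\<sigma> \<in> SL" "h > 0" using x(3) by (auto simp: cusp_scaling_iff)
  obtain T U \<phi> where c: "cusp_chart x \<sigma> h T U \<phi>" "(U, \<phi>) \<in> atlas \<Gamma>" "orbit \<Gamma> x \<in> U" "\<phi> (orbit \<Gamma> x) = 0"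
    using cusp_chart_through[OF x(3,1)] .
  obtain a where a: "cusp_expansion (2 * l) (pullback l \<omega>) \<sigma> h a" "\<And>n. n < l \<Longrightarrow> a n = 0"
    "a l = (2 * of_real pi * \<i> / of_real h) ^ l * \<omega> (U, \<phi>) 0"
    using pullback_cusp_expansion[OF \<omega>(1) l c(1)] by metis
  have "pullback l \<omega> \<noteq> 0" using pullback_inj[OF \<omega>(1) H_space_zero] \<omega>(2) pullback_zero by metis
  then have ex: "\<exists>n. a n \<noteq> 0" using cusp_expansion_nonzero[OF \<sigma>(1) a(1)] pullback_off_H by blast
  define n where "n = (LEAST n. a n \<noteq> 0)"
  have n: "a n \<noteq> 0" "\<And>k. k < n \<Longrightarrow> a k = 0"
    unfolding n_def using LeastI_ex[OF ex] not_less_Least by blast+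
  have o: "cusp_order \<Gamma> (2 * l) (pullback l \<omega>) b = n" using ord[OF a(1)] by (simp add: n_def)
  show "cusp_order \<Gamma> (2 * l) (pullback l \<omega>) b \<ge> l" unfolding o using n(1) a(2) not_le by blast
  have "n > l \<longleftrightarrow> a l = 0"
  proof
    assume "a l = 0"
    then have "n \<noteq> l" using n(1) by blast
    moreover have "n \<ge> l" using n(1) a(2) not_le by blast
    ultimately show "n > l" by simp
  qed (use n(2) in blast)
  also have "\<dots> \<longleftrightarrow> \<omega> (U, \<phi>) (\<phi> b) = 0" unfolding a(3) x(2) c(4) using \<sigma>(2) by simp
  finally show "\<exists>U \<phi>. (U, \<phi>) \<in> atlas \<Gamma> \<and> b \<in> U \<and>
       (cusp_order \<Gamma> (2 * l) (pullback l \<omega>) b > l \<longleftrightarrow> \<omega> (U, \<phi>) (\<phi> b) = 0)"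
    unfolding o using c(2,3) x(2) by blast
qed

text \<open>The divisor condition that singles out these forms says that the order of the differential, as
  computed from the order of the form, is non-negative at every point.\<close>

lemma pullback_SH:
  assumes \<omega>: "\<omega> \<in> H_space \<Gamma> l" and l: "l \<ge> 1"
  shows "pullback l \<omega> \<in> SH_forms \<Gamma> (2 * l)"
proof -
  let ?f = "pullback l \<omega>"
  have exp: "\<exists>a. cusp_expansion (2 * l) ?f \<sigma> h a \<and> a 0 = 0" if x: "x \<in> cusps \<Gamma>" "cusp_scaling \<Gamma> x \<sigma> h" for x \<sigma> h
  proof -
    obtain T U \<phi> where c: "cusp_chart x \<sigma> h T U \<phi>" using cusp_chart_exists[OF x] .
    then obtain a where a: "cusp_expansion (2 * l) ?f \<sigma> h a" "\<And>n. n < l \<Longrightarrow> a n = 0"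
      using pullback_cusp_expansion[OF \<omega> l c] by metis
    then have "a 0 = 0" using l by simp
    then show ?thesis using a(1) by blast
  qed
  have "?f \<in> modular_forms \<Gamma> (2 * l)"
    unfolding modular_forms_def
    using pullback_holomorphic[OF \<omega>] pullback_off_H pullback_moebius[OF H_space_mero[OF \<omega>]] exp by blast
  then have cf: "?f \<in> cusp_forms \<Gamma> (2 * l)" unfolding cusp_forms_def using exp by blast
  show ?thesis
  proof (cases "\<omega> = 0")
    case True
    then show ?thesis unfolding SH_forms_def using cf pullback_zero by simp
  next
    case nz: False
    have "divisor_ge \<Gamma> (c_divisor \<Gamma> (2 * l) ?f) (SH_divisor \<Gamma> (2 * l))"
      unfolding divisor_ge_def
    proof
      fix a assume a: "a \<in> surface \<Gamma>"
      have "\<exists>k::nat. c_divisor \<Gamma> (2 * l) ?f a - SH_divisor \<Gamma> (2 * l) a = of_nat k"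
      proof (cases "a \<in> cusp_points \<Gamma>")
        case True
        show ?thesis unfolding divisor_diff_cusp[OF True] using cusp_order_pullback(1)[OF \<omega> nz l True]
          by (metis of_nat_diff)
      next
        case False
        let ?e = "ellip_order \<Gamma> (interior_rep a)"
        note \<xi> = not_cusp_point_interior[OF a False]
        obtain r U \<phi> where c: "interior_chart (interior_rep a) r U \<phi>" using interior_chart_exists[OF \<xi>(1)] .
        obtain k :: nat where "zorder ?f (interior_rep a) = int (?e * k + l * (?e - 1))"
          using zorder_pullback[OF \<omega> nz c] .
        then have "c_divisor \<Gamma> (2 * l) ?f a - SH_divisor \<Gamma> (2 * l) a = of_nat (?e * k) / of_nat ?e"
          unfolding divisor_diff_interior[OF a False] point_order_def by simp
        also have "\<dots> = of_nat k" using rotations_of_stab(1)[OF \<xi>(1)] by simp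
        finally show ?thesis by blast
      qed
      then show "c_divisor \<Gamma> (2 * l) ?f a - SH_divisor \<Gamma> (2 * l) a \<in> \<int> \<and>
          0 \<le> c_divisor \<Gamma> (2 * l) ?f a - SH_divisor \<Gamma> (2 * l) a" by force
    qed
    then show ?thesis unfolding SH_forms_def using cf by blast
  qed
qed

end

section \<open>From forms to differentials\<close>

context discrete_group
begin

context
  fixes f :: "complex \<Rightarrow> complex" and l :: nat
  assumes f_hol: "f holomorphic_on \<H>"
    and f_mod: "\<And>\<gamma> z. \<gamma> \<in> \<Gamma> \<Longrightarrow> z \<in> \<H> \<Longrightarrow> f (moebius \<gamma> z) = cocycle \<gamma> z ^ (2 * l) * f z"
begin

text \<open>The local expression that a differential with pull-back \<open>f\<close> must have: \<open>f / (\<Phi>')\<^sup>l\<close> for the lifted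
  coordinate \<open>\<Phi>\<close>.  By the transformation rules of \<open>f\<close> and \<open>\<Phi>'\<close> it does not depend on the point
  chosen over \<open>u \<noteq> 0\<close>; nothing is claimed about its value at the centre \<open>u = 0\<close>.\<close>

definition local_expr :: "point set \<Rightarrow> (point \<Rightarrow> complex) \<Rightarrow> complex \<Rightarrow> complex" where
  "local_expr U \<phi> u = (let z = (SOME z. z \<in> chart_dom U \<and> lift \<phi> z = u) in f z / deriv (lift \<phi>) z ^ l)"

lemma local_expr_lift:
  assumes A: "(U, \<phi>) \<in> atlas \<Gamma>" and z: "z \<in> chart_dom U" "lift \<phi> z \<noteq> 0"
  shows "local_expr U \<phi> (lift \<phi> z) = f z / deriv (lift \<phi>) z ^ l"
proof -
  obtain N \<rho> where d: "chart_data U \<phi> N \<rho>" using chart_data_exists[OF A] .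
  define w where "w = (SOME w. w \<in> chart_dom U \<and> lift \<phi> w = lift \<phi> z)"
  have w: "w \<in> chart_dom U" "lift \<phi> z = lift \<phi> w"
    using someI[of "\<lambda>w. w \<in> chart_dom U \<and> lift \<phi> w = lift \<phi> z" z] z unfolding w_def by auto
  obtain \<gamma> where \<gamma>: "\<gamma> \<in> \<Gamma>" "w = moebius \<gamma> z" using lift_eq_imp_orbit[OF d z(1) w] .
  have zH: "z \<in> \<H>" using z chart_dom_subset by blast
  have j: "cocycle \<gamma> z ^ (2 * l) \<noteq> 0" using \<gamma>(1) zH by simp
  have "f w / deriv (lift \<phi>) w ^ l =
      (cocycle \<gamma> z ^ (2 * l) * f z) / (cocycle \<gamma> z ^ (2 * l) * deriv (lift \<phi>) z ^ l)"
    unfolding \<gamma>(2) f_mod[OF \<gamma>(1) zH] deriv_lift_moebius[OF d z(1) \<gamma>(1)] by (simp add: power_mult_distrib power_mult)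
  also have "\<dots> = f z / deriv (lift \<phi>) z ^ l" using j by (rule mult_divide_mult_cancel_left)
  finally show ?thesis unfolding local_expr_def w_def[symmetric] by simp
qed

lemma local_expr_holomorphic:
  assumes d: "chart_data U \<phi> N \<rho>" and A: "(U, \<phi>) \<in> atlas \<Gamma>"
  shows "local_expr U \<phi> holomorphic_on ball 0 \<rho> - {0}"
proof -
  define P where "P = chart_dom U \<inter> lift \<phi> -` (- {0})"
  have P: "open P" unfolding P_def
    by (intro continuous_open_preimage holomorphic_on_imp_continuous_on lift_holomorphic[OF d] open_chart_dom[OF d]) auto
  have PU: "P \<subseteq> chart_dom U" by (auto simp: P_def)
  have hol: "lift \<phi> holomorphic_on P" using lift_holomorphic[OF d] PU by (rule holomorphic_on_subset)
  have nz: "deriv (lift \<phi>) z \<noteq> 0" if "z \<in> P" for z using that deriv_lift_nonzero[OF d] by (auto simp: P_def)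
  have "f holomorphic_on P" using f_hol PU chart_dom_subset by (meson holomorphic_on_subset subset_trans)
  then have k: "(\<lambda>z. f z / deriv (lift \<phi>) z ^ l) holomorphic_on P"
    by (intro holomorphic_on_divide holomorphic_on_power holomorphic_deriv hol P) (use nz in auto)
  have "lift \<phi> ` P = ball 0 \<rho> - {0}"
  proof (intro equalityI subsetI)
    fix u :: complex assume "u \<in> lift \<phi> ` P"
    then show "u \<in> ball 0 \<rho> - {0}" using lift_image[OF d] by (auto simp: P_def)
  next
    fix u :: complex assume u: "u \<in> ball 0 \<rho> - {0}"
    then obtain z where "z \<in> N" "lift \<phi> z = u" using lift_surj[OF d, of u] by auto
    then show "u \<in> lift \<phi> ` P" using chart_N(3)[OF d] u by (auto simp: P_def)
  qed
  moreover have expr: "local_expr U \<phi> (lift \<phi> z) = f z / deriv (lift \<phi>) z ^ l" if "z \<in> P" for z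
    using that local_expr_lift[OF A] by (auto simp: P_def)
  have "local_expr U \<phi> holomorphic_on lift \<phi> ` P"
    by (rule holomorphic_descend(2)[OF P hol nz k expr], assumption+)
  ultimately show ?thesis by simp
qed

lemma local_expr_transition:
  assumes A: "(U, \<phi>) \<in> atlas \<Gamma>" "(V, \<psi>) \<in> atlas \<Gamma>" and u: "u \<in> \<phi> ` (U \<inter> V)" "u \<noteq> 0"
    "transition (U, \<phi>) (V, \<psi>) u \<noteq> 0"
  shows "local_expr U \<phi> u =
    local_expr V \<psi> (transition (U, \<phi>) (V, \<psi>) u) * deriv (transition (U, \<phi>) (V, \<psi>)) u ^ l"
proof -
  let ?T = "transition (U, \<phi>) (V, \<psi>)"
  obtain N \<rho> where d: "chart_data U \<phi> N \<rho>" using chart_data_exists[OF A(1)] .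
  obtain b where b: "b \<in> U" "b \<in> V" "u = \<phi> b" using u(1) by blast
  then obtain z where z: "z \<in> N" "b = orbit \<Gamma> (Fin z)" using d u(2) unfolding chart_data_def by blast
  have zU: "z \<in> chart_dom U" and zV: "z \<in> chart_dom V" and zu: "lift \<phi> z = u"
    using z b chart_N(2)[OF d] by (auto simp: chart_dom_def lift_def)
  have T: "?T u = lift \<psi> z" using transition_lift[OF A(1) zU] zu by simp
  have "local_expr U \<phi> u = f z / deriv (lift \<phi>) z ^ l"
    using local_expr_lift[OF A(1) zU] zu u(2) by simp
  moreover have "local_expr V \<psi> (?T u) = f z / deriv (lift \<psi>) z ^ l"
    using local_expr_lift[OF A(2) zV] T u(3) by simp
  moreover have "deriv (lift \<psi>) z = deriv ?T u * deriv (lift \<phi>) z"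
    using deriv_lift_transition[OF A zU zV] zu by simp
  moreover have "deriv ?T u \<noteq> 0" by (rule transition_props(3)[OF A u(1)])
  ultimately show ?thesis by (simp add: power_mult_distrib)
qed

lemma local_expr_limit_transition:
  assumes A: "(U, \<phi>) \<in> atlas \<Gamma>" "(V, \<psi>) \<in> atlas \<Gamma>" and a: "a \<in> U" "a \<in> V" "\<phi> a = 0" "\<psi> a = 0"
    and L: "(local_expr V \<psi> \<longlongrightarrow> L) (at 0)"
  shows "\<exists>L'. (local_expr U \<phi> \<longlongrightarrow> L') (at 0)"
proof -
  let ?T = "transition (U, \<phi>) (V, \<psi>)" and ?S = "\<phi> ` (U \<inter> V)"
  note T = transition_props[OF A]
  have 0: "0 \<in> ?S" using a by (metis IntI image_eqI)
  have T0: "?T 0 = 0" using T(4)[OF a(1)] a(3,4) by simp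
  obtain N \<rho> where dV: "chart_data V \<psi> N \<rho>" using chart_data_exists[OF A(2)] .
  have Tnz: "?T u \<noteq> 0" if u: "u \<in> ?S" "u \<noteq> 0" for u
  proof
    assume Tu: "?T u = 0"
    obtain b where b: "b \<in> U" "b \<in> V" "u = \<phi> b" using u(1) by blast
    have "\<psi> b = \<psi> a" using T(4)[OF b(1)] Tu b(3) a(4) by simp
    then have "b = a" using chart_inj[OF dV] b(2) a(2) unfolding inj_on_def by blast
    then show False using b(3) a(3) u(2) by simp
  qed
  have ev: "\<forall>\<^sub>F u in at 0. u \<in> ?S - {0}" by (rule eventually_at_in_open[OF T(1) 0])
  have "continuous_on ?S ?T" "continuous_on ?S (deriv ?T)"
    using T(1,2) holomorphic_deriv holomorphic_on_imp_continuous_on by blast+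
  then have c: "isCont ?T 0" "isCont (deriv ?T) 0" using T(1) 0 continuous_on_eq_continuous_at by blast+
  have "filterlim ?T (at 0) (at 0)"
    unfolding filterlim_at
  proof
    show "(?T \<longlongrightarrow> 0) (at 0)" using c(1) T0 by (simp add: isCont_def)
    show "\<forall>\<^sub>F u in at 0. ?T u \<in> UNIV \<and> ?T u \<noteq> 0" using ev by eventually_elim (use Tnz in blast)
  qed
  then have "((\<lambda>u. local_expr V \<psi> (?T u)) \<longlongrightarrow> L) (at 0)" using L by (rule filterlim_compose[rotated])
  moreover have "(deriv ?T \<longlongrightarrow> deriv ?T 0) (at 0)" using c(2) by (simp add: isCont_def)
  ultimately have "((\<lambda>u. local_expr V \<psi> (?T u) * deriv ?T u ^ l) \<longlongrightarrow> L * deriv ?T 0 ^ l) (at 0)"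
    by (intro tendsto_intros)
  moreover have "\<forall>\<^sub>F u in at 0. local_expr V \<psi> (?T u) * deriv ?T u ^ l = local_expr U \<phi> u"
    using ev by eventually_elim (use local_expr_transition[OF A] Tnz in \<open>metis DiffE insertI1\<close>)
  ultimately show ?thesis using Lim_transform_eventually by blast
qed

text \<open>Near \<open>\<xi>\<close>, the \<open>l\<close>-th power of the derivative of the lifted coordinate vanishes to order \<open>l (e - 1)\<close>,
  which is at most the order of \<open>f\<close>.\<close>

lemma local_expr_limit_interior:
  assumes c: "interior_chart \<xi> r U \<phi>" and nz: "\<exists>w\<in>\<H>. f w \<noteq> 0"
    and ord: "zorder f \<xi> \<ge> int (l * (ellip_order \<Gamma> \<xi> - 1))"
  shows "\<exists>L. (local_expr U \<phi> \<longlongrightarrow> L) (at 0)"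
proof -
  let ?e = "ellip_order \<Gamma> \<xi>"
  have i: "\<xi> \<in> \<H>" "0 < r" using c unfolding interior_chart_def by blast+
  have e: "?e > 0" by (rule rotations_of_stab(1)[OF i(1)])
  have A: "(U, \<phi>) \<in> atlas \<Gamma>" by (rule interior_chart_atlas[OF c])
  define n where "n = nat (zorder f \<xi>)"
  define f1 where "f1 = zor_poly f \<xi>"
  define M where "M = l * (?e - 1)"
  have "int M \<le> zorder f \<xi>" using ord by (simp only: M_def)
  then have nM: "n \<ge> M" unfolding n_def by linarith
  note zz = conjunct2[OF zorder_exist_zero[OF f_hol open_upper_half_plane connected_upper_half_plane i(1) nz], folded n_def f1_def]
  from zz obtain s where s: "s > 0" "cball \<xi> s \<subseteq> \<H>" "f1 holomorphic_on cball \<xi> s"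
    and s': "\<forall>w\<in>cball \<xi> s. f w = f1 w * (w - \<xi>) ^ n \<and> f1 w \<noteq> 0"
    by (elim exE conjE) (rule that)
  define D where "D = ball \<xi> s"
  have D: "open D" "\<xi> \<in> D" "D \<subseteq> \<H>" "f1 holomorphic_on D"
    using s holomorphic_on_subset[OF s(3) ball_subset_cball] by (auto simp: D_def)
  have f1: "f w = f1 w * (w - \<xi>) ^ n" if "w \<in> D" for w using s' that by (auto simp: D_def)
  define k where "k = (\<lambda>z. f1 z * (z - \<xi>) ^ (n - M) * (z - cnj \<xi>) ^ M / (of_nat ?e * deriv (cayley \<xi>) z) ^ l)"
  have hc: "cayley \<xi> holomorphic_on D" using cayley_holomorphic[OF i(1)] D(3) by (rule holomorphic_on_subset)
  have dnz: "deriv (cayley \<xi>) z \<noteq> 0" if "z \<in> D" for z using that D(3) deriv_cayley_nonzero i(1) by blast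
  have "k holomorphic_on D" unfolding k_def
    by (intro holomorphic_on_divide holomorphic_on_mult holomorphic_on_power holomorphic_on_diff holomorphic_on_ident
        holomorphic_on_const holomorphic_deriv hc D(1,4)) (use e dnz in simp)
  then have kc: "continuous_on D k" by (rule holomorphic_on_imp_continuous_on)
  have expr: "local_expr U \<phi> (lift \<phi> z) = k z" if z: "z \<in> D" "norm (cayley \<xi> z) < r" "lift \<phi> z \<noteq> 0" for z
  proof -
    have zH: "z \<in> \<H>" using z D by blast
    let ?w = "cayley \<xi> z" and ?d = "deriv (cayley \<xi>) z"
    have w0: "?w \<noteq> 0" using z(3) interior_chart_lift(2)[OF c zH z(2)] e by auto
    then have z\<xi>: "z - \<xi> \<noteq> 0" using cayley_eq_0[OF zH i(1)] by simp
    have q: "z - cnj \<xi> \<noteq> 0" by (rule cayley_denom[OF zH i(1)])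
    have wM: "?w ^ M = (z - \<xi>) ^ M / (z - cnj \<xi>) ^ M" by (simp add: cayley_def power_divide)
    have "local_expr U \<phi> (lift \<phi> z) = f z / (of_nat ?e * ?w ^ (?e - 1) * ?d) ^ l"
      using local_expr_lift[OF A interior_chart_lift(1)[OF c zH z(2)] z(3)]
        DERIV_imp_deriv[OF interior_chart_lift(3)[OF c zH z(2)]] by simp
    also have "(of_nat ?e * ?w ^ (?e - 1) * ?d) ^ l = (of_nat ?e * ?d) ^ l * ?w ^ M"
      unfolding M_def by (simp add: power_mult_distrib power_mult[symmetric] mult_ac)
    also have "f z / \<dots> = f1 z * (z - \<xi>) ^ n * (z - cnj \<xi>) ^ M / ((of_nat ?e * ?d) ^ l * (z - \<xi>) ^ M)"
      unfolding wM f1[OF z(1)] using q by simp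
    also have "(z - \<xi>) ^ n = (z - \<xi>) ^ (n - M) * (z - \<xi>) ^ M" using nM by (simp add: power_add[symmetric])
    also have "f1 z * ((z - \<xi>) ^ (n - M) * (z - \<xi>) ^ M) * (z - cnj \<xi>) ^ M / ((of_nat ?e * ?d) ^ l * (z - \<xi>) ^ M) = k z"
      unfolding k_def using z\<xi> by simp
    finally show ?thesis .
  qed
  have "(local_expr U \<phi> \<longlongrightarrow> k \<xi>) (at 0)"
    unfolding tendsto_iff
  proof (intro allI impI)
    fix \<epsilon> :: real assume \<epsilon>: "\<epsilon> > 0"
    let ?O = "D \<inter> k -` ball (k \<xi>) \<epsilon>"
    have "open ?O" by (rule continuous_open_preimage[OF kc D(1) open_ball])
    moreover have "\<xi> \<in> ?O" using D(2) \<epsilon> by simp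
    ultimately obtain \<delta> where \<delta>: "\<delta> > 0" "\<And>u. norm u < \<delta> \<Longrightarrow> \<exists>z\<in>\<H> \<inter> ?O. norm (cayley \<xi> z) < r \<and> lift \<phi> z = u"
      using interior_chart_small[OF c] by blast
    have "dist (local_expr U \<phi> u) (k \<xi>) < \<epsilon>" if u: "u \<noteq> 0" "dist u 0 < \<delta>" for u
    proof -
      obtain z where z: "z \<in> D" "k z \<in> ball (k \<xi>) \<epsilon>" "norm (cayley \<xi> z) < r" "lift \<phi> z = u"
        using \<delta>(2)[of u] u(2) by auto
      then show ?thesis using expr[OF z(1,3)] u(1) by (simp add: dist_commute)
    qed
    then show "\<forall>\<^sub>F u in at 0. dist (local_expr U \<phi> u) (k \<xi>) < \<epsilon>"
      unfolding eventually_at using \<delta>(1) by blast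
  qed
  then show ?thesis by blast
qed

text \<open>The expansion of \<open>f\<close> divided by \<open>(c q)\<^sup>l\<close> is still a power series.\<close>

lemma local_expr_limit_cusp:
  assumes c: "cusp_chart x \<sigma> h T U \<phi>" and a: "cusp_expansion (2 * l) f \<sigma> h a" "\<And>n. n < l \<Longrightarrow> a n = 0"
  shows "\<exists>L. (local_expr U \<phi> \<longlongrightarrow> L) (at 0)"
proof -
  let ?c = "2 * of_real pi * \<i> / of_real h :: complex" and ?R = "exp (- (2 * pi * T / h))"
  have sc: "cusp_scaling \<Gamma> x \<sigma> h" and T: "T > 0" using c by (auto simp: cusp_chart_def)
  have \<sigma>: "\<sigma> \<in> SL" "h > 0" using sc by (auto simp: cusp_scaling_iff)
  have A: "(U, \<phi>) \<in> atlas \<Gamma>" by (rule cusp_chart_atlas[OF c])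
  have cnz: "?c \<noteq> 0" using \<sigma>(2) by simp
  have s: "(\<lambda>n. a (n + l) * u ^ n) sums (?c ^ l * local_expr U \<phi> u)" if u: "u \<noteq> 0" "norm u < ?R" for u
  proof -
    obtain \<zeta> where \<zeta>: "qexp h \<zeta> = u" "Im \<zeta> > T" using qexp_surj[OF \<sigma>(2) u] .
    define w where "w = moebius (adj22 \<sigma>) \<zeta>"
    have "\<zeta> \<in> \<H>" using \<zeta>(2) T by (simp add: upper_half_plane_iff)
    then have w: "w \<in> \<H>" "moebius \<sigma> w = \<zeta>" using \<sigma> by (simp_all add: w_def)
    have wT: "Im (moebius \<sigma> w) > T" using w \<zeta> by simp
    define B where "B = (cocycle \<sigma> w)\<^sup>2"
    have B: "B \<noteq> 0" using \<sigma> w(1) by (simp add: B_def)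
    have lw: "lift \<phi> w = u" using cusp_chart_lift(2)[OF c w(1) wT] w \<zeta> by simp
    have "local_expr U \<phi> u = f w / (?c * u * (1 / B)) ^ l"
      using local_expr_lift[OF A cusp_chart_lift(1)[OF c w(1) wT]] lw u(1)
        DERIV_imp_deriv[OF cusp_chart_lift(3)[OF c w(1) wT]] w \<zeta> by (simp add: B_def)
    then have e: "?c ^ l * local_expr U \<phi> u = f w * B ^ l / u ^ l"
      using cnz B u(1) by (simp add: power_mult_distrib power_divide)
    have "(\<lambda>n. a n * u ^ n) sums (f w * B ^ l)"
      using bspec[OF iffD1[OF cusp_expansion_iff[OF \<sigma>(1)] a(1)] w(1)] unfolding w(2) \<zeta>(1)
      by (simp add: B_def power_mult)
    moreover have "(\<Sum>n<l. a n * u ^ n) = 0" using a(2) by simp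
    ultimately have "(\<lambda>n. a (n + l) * u ^ (n + l)) sums (f w * B ^ l)" by (subst sums_iff_shift) simp
    then have "(\<lambda>n. a (n + l) * u ^ (n + l) / u ^ l) sums (f w * B ^ l / u ^ l)" by (rule sums_divide)
    then show ?thesis unfolding e using u(1) by (simp add: power_add)
  qed
  have "((\<lambda>u. ?c ^ l * local_expr U \<phi> u) \<longlongrightarrow> a (0 + l)) (at 0)"
    by (rule powser_limit_0_strong[where s = ?R and a = "\<lambda>n. a (n + l)"]) (use s in auto)
  then have "((\<lambda>u. (1 / ?c ^ l) * (?c ^ l * local_expr U \<phi> u)) \<longlongrightarrow> (1 / ?c ^ l) * a (0 + l)) (at 0)"
    by (intro tendsto_intros)
  moreover have "(\<lambda>u. (1 / ?c ^ l) * (?c ^ l * local_expr U \<phi> u)) = local_expr U \<phi>"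
    using cnz by (auto simp: fun_eq_iff)
  ultimately show ?thesis by auto
qed

end

lemma chart_point_in_surface:
  assumes "(U, \<phi>) \<in> atlas \<Gamma>" "a \<in> U"
  shows "a \<in> surface \<Gamma>"
  using assms(1)
proof (cases rule: atlas_cases)
  case (1 \<xi> r)
  then show ?thesis using assms(2) unfolding interior_chart_def surface_def extended_half_plane_def by blast
next
  case (2 x \<sigma> h T)
  then have "x \<in> cusps \<Gamma>" "U = insert (orbit \<Gamma> x) ((\<lambda>z. orbit \<Gamma> (Fin z)) ` {z \<in> \<H>. Im (moebius \<sigma> z) > T})"
    unfolding cusp_chart_def by blast+
  then show ?thesis using assms(2) unfolding surface_def extended_half_plane_def by blast
qed

text \<open>Holomorphy at a point has to be checked in one chart only, and the orders in the divisor of a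
  form refer to one representative of each point: it suffices to use the chart around it.\<close>

lemma SH_local_expr_limit:
  assumes f: "f \<in> SH_forms \<Gamma> (2 * l)" "f \<noteq> 0" and a: "a \<in> surface \<Gamma>"
  shows "\<exists>V \<psi> L. (V, \<psi>) \<in> atlas \<Gamma> \<and> a \<in> V \<and> \<psi> a = 0 \<and> (local_expr f l V \<psi> \<longlongrightarrow> L) (at 0)"
proof -
  have mf: "f \<in> modular_forms \<Gamma> (2 * l)" using f(1) unfolding SH_forms_def cusp_forms_def by blast
  have hol: "f holomorphic_on \<H>" and off: "\<And>z. z \<notin> \<H> \<Longrightarrow> f z = 0"
    and mod: "\<And>\<gamma> z. \<gamma> \<in> \<Gamma> \<Longrightarrow> z \<in> \<H> \<Longrightarrow> f (moebius \<gamma> z) = cocycle \<gamma> z ^ (2 * l) * f z"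
    and exp: "\<And>x \<sigma> h. x \<in> cusps \<Gamma> \<Longrightarrow> cusp_scaling \<Gamma> x \<sigma> h \<Longrightarrow> \<exists>a. cusp_expansion (2 * l) f \<sigma> h a"
    using mf unfolding modular_forms_def by blast+
  have "divisor_ge \<Gamma> (c_divisor \<Gamma> (2 * l) f) (SH_divisor \<Gamma> (2 * l))" using f unfolding SH_forms_def by blast
  then have div: "c_divisor \<Gamma> (2 * l) f a - SH_divisor \<Gamma> (2 * l) a \<ge> 0" using a unfolding divisor_ge_def by blast
  show ?thesis
  proof (cases "a \<in> cusp_points \<Gamma>")
    case True
    obtain x \<sigma> h where x: "x \<in> cusps \<Gamma>" "a = orbit \<Gamma> x" "cusp_scaling \<Gamma> x \<sigma> h"
      and ord: "\<And>m f e. cusp_expansion m f \<sigma> h e \<Longrightarrow> cusp_order \<Gamma> m f a = (LEAST n. e n \<noteq> 0)"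
      using cusp_order_expansion[OF True] by metis
    obtain T U \<phi> where c: "cusp_chart x \<sigma> h T U \<phi>" "(U, \<phi>) \<in> atlas \<Gamma>" "orbit \<Gamma> x \<in> U" "\<phi> (orbit \<Gamma> x) = 0"
      using cusp_chart_through[OF x(3,1)] .
    obtain e where e: "cusp_expansion (2 * l) f \<sigma> h e" using exp[OF x(1,3)] by blast
    have "cusp_order \<Gamma> (2 * l) f a \<ge> l" using div unfolding divisor_diff_cusp[OF True] by simp
    then have "l \<le> (LEAST n. e n \<noteq> 0)" using ord[OF e] by simp
    then have "e n = 0" if "n < l" for n using that not_less_Least[of n "\<lambda>n. e n \<noteq> 0"] by auto
    then obtain L where "(local_expr f l U \<phi> \<longlongrightarrow> L) (at 0)"
      using local_expr_limit_cusp[OF hol mod c(1) e] by blast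
    then show ?thesis using c x(2) by blast
  next
    case False
    let ?\<xi> = "interior_rep a"
    note \<xi> = not_cusp_point_interior[OF a False]
    obtain r U \<phi> where c: "interior_chart ?\<xi> r U \<phi>" using interior_chart_exists[OF \<xi>(1)] .
    have e: "ellip_order \<Gamma> ?\<xi> > 0" by (rule rotations_of_stab(1)[OF \<xi>(1)])
    have "(of_int (zorder f ?\<xi>) - of_nat (l * (ellip_order \<Gamma> ?\<xi> - 1)) :: rat) \<ge> 0"
      using div e unfolding divisor_diff_interior[OF a False] point_order_def by (simp add: zero_le_divide_iff)
    then have "(of_int (int (l * (ellip_order \<Gamma> ?\<xi> - 1))) :: rat) \<le> of_int (zorder f ?\<xi>)" by simp
    then have ord: "zorder f ?\<xi> \<ge> int (l * (ellip_order \<Gamma> ?\<xi> - 1))" by (simp only: of_int_le_iff)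
    have "\<exists>w\<in>\<H>. f w \<noteq> 0" using f(2) off by (metis ext zero_fun_def)
    then obtain L where L: "(local_expr f l U \<phi> \<longlongrightarrow> L) (at 0)"
      using local_expr_limit_interior[OF hol mod c _ ord] by blast
    have r: "norm (cayley ?\<xi> ?\<xi>) < r" using c unfolding interior_chart_def by simp
    have "a \<in> U" using interior_chart_lift(1)[OF c \<xi>(1) r] \<xi>(2) by (simp add: chart_dom_def)
    moreover have "\<phi> a = 0" using interior_chart_lift(2)[OF c \<xi>(1) r] \<xi>(2) e by (simp add: lift_def power_0_left)
    ultimately show ?thesis using L interior_chart_atlas[OF c] by blast
  qed
qed

text \<open>In each chart the local expression extends holomorphically over the centre.  The compatibility of
  these extensions holds away from the centres and persists there by continuity.\<close>

lemma SH_is_pullback: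
  assumes f: "f \<in> SH_forms \<Gamma> (2 * l)"
  obtains \<omega> where "\<omega> \<in> H_space \<Gamma> l" "pullback l \<omega> = f"
proof (cases "f = 0")
  case True
  then show ?thesis using that[OF H_space_zero] pullback_zero by simp
next
  case nz: False
  have mf: "f \<in> modular_forms \<Gamma> (2 * l)" using f(1) unfolding SH_forms_def cusp_forms_def by blast
  have hol: "f holomorphic_on \<H>" and off: "\<And>z. z \<notin> \<H> \<Longrightarrow> f z = 0"
    and mod: "\<And>\<gamma> z. \<gamma> \<in> \<Gamma> \<Longrightarrow> z \<in> \<H> \<Longrightarrow> f (moebius \<gamma> z) = cocycle \<gamma> z ^ (2 * l) * f z"
    using mf unfolding modular_forms_def by blast+
  let ?E = "local_expr f l"
  have "\<exists>G. G holomorphic_on \<phi> ` U \<and> (\<forall>u. u \<noteq> 0 \<longrightarrow> G u = ?E U \<phi> u)" if A: "(U, \<phi>) \<in> atlas \<Gamma>" for U \<phi>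
  proof -
    obtain N \<rho> where d: "chart_data U \<phi> N \<rho>" using chart_data_exists[OF A] .
    note im = chart_image[OF d]
    have "0 \<in> \<phi> ` U" unfolding im(1) using im(2) by simp
    then obtain a where a: "a \<in> U" "\<phi> a = 0" by (metis imageE)
    obtain V \<psi> L where V: "(V, \<psi>) \<in> atlas \<Gamma>" "a \<in> V" "\<psi> a = 0" "(?E V \<psi> \<longlongrightarrow> L) (at 0)"
      using SH_local_expr_limit[OF f nz chart_point_in_surface[OF A a(1)]] by blast
    obtain L' where lim: "(?E U \<phi> \<longlongrightarrow> L') (at 0)"
      using local_expr_limit_transition[OF hol mod A V(1) a(1) V(2) a(2) V(3,4)] by blast
    have "?E U \<phi> holomorphic_on ball 0 \<rho> - {0}" by (rule local_expr_holomorphic[OF hol mod d A])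
    from holomorphic_fill_puncture[OF this lim]
    have "(\<lambda>u. if u = 0 then L' else ?E U \<phi> u) holomorphic_on \<phi> ` U" unfolding im(1) .
    then show ?thesis by (intro exI[of _ "\<lambda>u. if u = 0 then L' else ?E U \<phi> u"]) simp
  qed
  then have "\<forall>c\<in>atlas \<Gamma>. \<exists>G. G holomorphic_on snd c ` fst c \<and> (\<forall>u. u \<noteq> 0 \<longrightarrow> G u = ?E (fst c) (snd c) u)"
    by simp
  from bchoice[OF this] obtain G where G0: "\<forall>c\<in>atlas \<Gamma>. G c holomorphic_on snd c ` fst c \<and>
      (\<forall>u. u \<noteq> 0 \<longrightarrow> G c u = ?E (fst c) (snd c) u)" by blast
  have G: "G (U, \<phi>) holomorphic_on \<phi> ` U" "u \<noteq> 0 \<Longrightarrow> G (U, \<phi>) u = ?E U \<phi> u" if "(U, \<phi>) \<in> atlas \<Gamma>" for U \<phi> u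
    using bspec[OF G0 that] by simp_all
  define \<omega> where "\<omega> = (\<lambda>c u. if c \<in> atlas \<Gamma> \<and> u \<in> snd c ` fst c then G c u else 0)"
  have \<omega>G: "\<omega> (U, \<phi>) u = G (U, \<phi>) u" if "(U, \<phi>) \<in> atlas \<Gamma>" "u \<in> \<phi> ` U" for U \<phi> u
    using that by (simp add: \<omega>_def)
  have \<omega>: "\<omega> \<in> H_space \<Gamma> l"
  proof (rule H_spaceI)
    fix U \<phi> assume A: "(U, \<phi>) \<in> atlas \<Gamma>"
    show "\<omega> (U, \<phi>) holomorphic_on \<phi> ` U"
      by (rule holomorphic_transform[OF G(1)[OF A]]) (simp add: \<omega>G[OF A])
  next
    fix U \<phi> V \<psi> u assume A: "(U, \<phi>) \<in> atlas \<Gamma>" "(V, \<psi>) \<in> atlas \<Gamma>" and u: "u \<in> \<phi> ` (U \<inter> V)"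
    let ?T = "transition (U, \<phi>) (V, \<psi>)" and ?S = "\<phi> ` (U \<inter> V)"
    note T = transition_props[OF A]
    have TV: "?T v \<in> \<psi> ` V" if "v \<in> ?S" for v using that T(4) by auto
    obtain N \<rho> where dV: "chart_data V \<psi> N \<rho>" using chart_data_exists[OF A(2)] .
    obtain N' \<rho>' where dU: "chart_data U \<phi> N' \<rho>'" using chart_data_exists[OF A(1)] .
    have hG: "G (U, \<phi>) holomorphic_on ?S" using G(1)[OF A(1)] by (rule holomorphic_on_subset) auto
    have "G (V, \<psi>) \<circ> ?T holomorphic_on ?S"
      by (rule holomorphic_on_compose_gen[OF T(2) G(1)[OF A(2)]]) (use TV in blast)
    then have hT: "(\<lambda>v. G (V, \<psi>) (?T v) * deriv ?T v ^ l) holomorphic_on ?S"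
      unfolding comp_def by (intro holomorphic_on_mult holomorphic_on_power holomorphic_deriv T(1,2))
    have eq: "G (U, \<phi>) v = G (V, \<psi>) (?T v) * deriv ?T v ^ l" if v: "v \<in> ?S" "v \<noteq> 0" "?T v \<noteq> 0" for v
      using local_expr_transition[OF hol mod A v] G(2)[OF A(1) v(2)] G(2)[OF A(2) v(3)] by simp
    have "G (U, \<phi>) u = G (V, \<psi>) (?T u) * deriv ?T u ^ l"
      \<comment> \<open>The equation is known unless \<open>v\<close> is the centre of one of the two charts.  The centre of the
          second chart has at most one coordinate \<open>p\<close> in the first.\<close>
    proof (cases "\<exists>p\<in>?S. ?T p = 0 \<and> p \<noteq> 0")
      case False
      show ?thesis
        by (rule continuous_on_eq_off_point[OF T(1) holomorphic_on_imp_continuous_on[OF hG]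
              holomorphic_on_imp_continuous_on[OF hT] _ u, of 0]) (use False eq in blast)
    next
      case True
      then obtain p where p: "p \<in> ?S" "?T p = 0" "p \<noteq> 0" by blast
      have uniq: "v = p" if v: "v \<in> ?S" "?T v = 0" for v
      proof -
        obtain b b' where b: "b \<in> U" "b \<in> V" "v = \<phi> b" "b' \<in> U" "b' \<in> V" "p = \<phi> b'" using v(1) p(1) by blast
        then have "\<psi> b = \<psi> b'" using T(4)[OF b(1)] T(4)[OF b(4)] v(2) p(2) by simp
        then show ?thesis using chart_inj[OF dV] b unfolding inj_on_def by blast
      qed
      have off0: "G (U, \<phi>) v = G (V, \<psi>) (?T v) * deriv ?T v ^ l" if v: "v \<in> ?S - {0}" for v
      proof (rule continuous_on_eq_off_point[of "?S - {0}" _ _ p, OF _ _ _ _ v])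
        show "open (?S - {0})" by (rule open_delete[OF T(1)])
        show "continuous_on (?S - {0}) (G (U, \<phi>))"
          using holomorphic_on_imp_continuous_on[OF hG] by (rule continuous_on_subset) auto
        show "continuous_on (?S - {0}) (\<lambda>v. G (V, \<psi>) (?T v) * deriv ?T v ^ l)"
          using holomorphic_on_imp_continuous_on[OF hT] by (rule continuous_on_subset) auto
      qed (use eq uniq in blast)
      show ?thesis
        by (rule continuous_on_eq_off_point[OF T(1) holomorphic_on_imp_continuous_on[OF hG]
              holomorphic_on_imp_continuous_on[OF hT] _ u, of 0]) (use off0 in blast)
    qed
    then show "\<omega> (U, \<phi>) u = \<omega> (V, \<psi>) (?T u) * deriv ?T u ^ l"
      using \<omega>G[OF A(1), of u] \<omega>G[OF A(2) TV[OF u]] u by auto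
  qed (auto simp: \<omega>_def)
  have "pullback l \<omega> z = f z" for z
  proof (cases "z \<in> \<H>")
    case True
    obtain U \<phi> where A: "(U, \<phi>) \<in> atlas \<Gamma>" "z \<in> chart_dom U" using atlas_covers_H[OF True] .
    obtain N \<rho> where d: "chart_data U \<phi> N \<rho>" using chart_data_exists[OF A(1)] .
    have eq: "pullback l \<omega> w = f w" if w: "w \<in> chart_dom U" "lift \<phi> w \<noteq> 0" for w
    proof -
      have "pullback l \<omega> w = ?E U \<phi> (lift \<phi> w) * deriv (lift \<phi>) w ^ l"
        using pullback_chart[OF H_space_mero[OF \<omega>] A(1) w(1)] \<omega>G[OF A(1)] G(2)[OF A(1) w(2)] w(1)
        by (simp add: lift_def chart_dom_def)
      then show ?thesis using local_expr_lift[OF hol mod A(1) w] deriv_lift_nonzero[OF d w] by simp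
    qed
    have "isCont (pullback l \<omega>) z" "isCont f z"
      using holomorphic_on_imp_continuous_on[OF pullback_holomorphic[OF \<omega>]] holomorphic_on_imp_continuous_on[OF hol]
        True continuous_on_eq_continuous_at[OF open_upper_half_plane] by blast+
    then have lim: "((\<lambda>w. pullback l \<omega> w - f w) \<longlongrightarrow> pullback l \<omega> z - f z) (at z)"
      unfolding isCont_def by (intro tendsto_diff)
    show ?thesis
    proof (rule ccontr)
      assume "pullback l \<omega> z \<noteq> f z"
      then have "\<forall>\<^sub>F w in at z. pullback l \<omega> w - f w \<noteq> 0"
        by (intro tendsto_imp_eventually_ne[OF lim]) simp
      moreover have "\<forall>\<^sub>F w in at z. w \<in> chart_dom U" by (rule eventually_at_in_open'[OF open_chart_dom[OF d] A(2)])
      ultimately have "\<forall>\<^sub>F w in at z. lift \<phi> w = 0" by eventually_elim (use eq in force)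
      then show False using frequently_lift_nonzero[OF A] by (simp add: frequently_def)
    qed
  qed (use off pullback_off_H in simp)
  then show ?thesis using that[OF \<omega>] by blast
qed

end

section \<open>Wronskians of differentials\<close>

context discrete_group
begin

text \<open>The Wronskian of \<open>t\<close> differentials of degree \<open>l\<close> has degree \<open>l t + t (t - 1) / 2\<close>, half the weight of the
  Wronskian of the forms.\<close>

lemma wronskian_weight:
  fixes t l :: nat
  assumes "t \<ge> 1"
  shows "t * (2 * l + t - 1) = 2 * (l * t + t * (t - 1) div 2)"
proof -
  have "even (t * (t - 1))" by auto
  then have "2 * (t * (t - 1) div 2) = t * (t - 1)" by simp
  moreover have "t * (2 * l + t - 1) = 2 * (l * t) + t * (t - 1)"
    using assms by (cases t) (auto simp: algebra_simps)
  ultimately show ?thesis by simp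
qed

lemma differential_wronskian_chart:
  assumes A: "(U, \<phi>) \<in> atlas \<Gamma>" and u: "u \<in> \<phi> ` U"
  shows "differential_wronskian (atlas \<Gamma>) t \<omega> (U, \<phi>) u = local_wronskian t (\<lambda>j. \<omega> j (U, \<phi>)) u"
  using A u by (simp add: differential_wronskian_def)

lemma differential_wronskian_H:
  assumes \<omega>: "\<And>j. j < t \<Longrightarrow> \<omega> j \<in> H_space \<Gamma> l"
  shows "differential_wronskian (atlas \<Gamma>) t \<omega> \<in> H_space \<Gamma> (l * t + t * (t - 1) div 2)"
proof (rule H_spaceI)
  fix U \<phi> assume A: "(U, \<phi>) \<in> atlas \<Gamma>"
  have "local_wronskian t (\<lambda>j. \<omega> j (U, \<phi>)) holomorphic_on \<phi> ` U"
    by (rule local_wronskian_holomorphic[OF open_chart_image[OF A] H_space_holomorphic[OF \<omega> A]])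
  then show "differential_wronskian (atlas \<Gamma>) t \<omega> (U, \<phi>) holomorphic_on \<phi> ` U"
    by (rule holomorphic_transform) (simp add: differential_wronskian_def A)
next
  fix U \<phi> V \<psi> u assume A: "(U, \<phi>) \<in> atlas \<Gamma>" "(V, \<psi>) \<in> atlas \<Gamma>" and u: "u \<in> \<phi> ` (U \<inter> V)"
  let ?T = "transition (U, \<phi>) (V, \<psi>)" and ?S = "\<phi> ` (U \<inter> V)"
  note T = transition_props[OF A]
  have TV: "?T ` ?S \<subseteq> \<psi> ` V" using T(4) by auto
  have uU: "u \<in> \<phi> ` U" using u by blast
  have "local_wronskian t (\<lambda>j. \<omega> j (U, \<phi>)) u =
      local_wronskian t (\<lambda>j w. deriv ?T w ^ l * \<omega> j (V, \<psi>) (?T w)) u"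
    by (rule local_wronskian_cong[OF T(1) u])
       (use H_space_mem(4)[OF \<omega> A] in \<open>simp add: mult.commute\<close>)
  also have "\<dots> = (deriv ?T u ^ l) ^ t * deriv ?T u ^ (t * (t - 1) div 2) * local_wronskian t (\<lambda>j. \<omega> j (V, \<psi>)) (?T u)"
    by (rule local_wronskian_mult_compose[OF T(1) _ T(2) open_chart_image[OF A(2)] H_space_holomorphic[OF \<omega> A(2)] TV u])
       (intro holomorphic_on_power holomorphic_deriv T(1,2))
  also have "\<dots> = local_wronskian t (\<lambda>j. \<omega> j (V, \<psi>)) (?T u) * deriv ?T u ^ (l * t + t * (t - 1) div 2)"
    by (simp add: power_add power_mult)
  finally have eq: "local_wronskian t (\<lambda>j. \<omega> j (U, \<phi>)) u =
      local_wronskian t (\<lambda>j. \<omega> j (V, \<psi>)) (?T u) * deriv ?T u ^ (l * t + t * (t - 1) div 2)" .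
  have "?T u \<in> \<psi> ` V" using TV u by blast
  then show "differential_wronskian (atlas \<Gamma>) t \<omega> (U, \<phi>) u =
      differential_wronskian (atlas \<Gamma>) t \<omega> (V, \<psi>) (?T u) * deriv ?T u ^ (l * t + t * (t - 1) div 2)"
    using differential_wronskian_chart[OF A(1) uU] differential_wronskian_chart[OF A(2)] eq by simp
qed (auto simp: differential_wronskian_def fun_eq_iff)

text \<open>The rule that describes coordinate changes also describes the pull-back to \<open>\<H>\<close>, which is a
  composition with the lifted coordinate.\<close>

lemma pullback_differential_wronskian:
  assumes \<omega>: "\<And>j. j < t \<Longrightarrow> \<omega> j \<in> H_space \<Gamma> l"
  shows "pullback (l * t + t * (t - 1) div 2) (differential_wronskian (atlas \<Gamma>) t \<omega>) =
    modular_wronskian t (\<lambda>j. pullback l (\<omega> j))"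
proof
  fix z
  let ?\<Omega> = "differential_wronskian (atlas \<Gamma>) t \<omega>" and ?w = "l * t + t * (t - 1) div 2"
  show "pullback ?w ?\<Omega> z = modular_wronskian t (\<lambda>j. pullback l (\<omega> j)) z"
  proof (cases "z \<in> \<H>")
    case True
    obtain U \<phi> where A: "(U, \<phi>) \<in> atlas \<Gamma>" "z \<in> chart_dom U" using atlas_covers_H[OF True] .
    obtain N \<rho> where d: "chart_data U \<phi> N \<rho>" using chart_data_exists[OF A(1)] .
    have L: "lift \<phi> ` chart_dom U \<subseteq> \<phi> ` U" by (auto simp: lift_def chart_dom_def)
    have "local_wronskian t (\<lambda>j. pullback l (\<omega> j)) z =
        local_wronskian t (\<lambda>j w. deriv (lift \<phi>) w ^ l * \<omega> j (U, \<phi>) (lift \<phi> w)) z"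
      by (rule local_wronskian_cong[OF open_chart_dom[OF d] A(2)])
         (simp add: pullback_chart[OF H_space_mero[OF \<omega>] A(1)] mult.commute)
    also have "\<dots> = (deriv (lift \<phi>) z ^ l) ^ t * deriv (lift \<phi>) z ^ (t * (t - 1) div 2) *
        local_wronskian t (\<lambda>j. \<omega> j (U, \<phi>)) (lift \<phi> z)"
      by (rule local_wronskian_mult_compose[OF open_chart_dom[OF d] _ lift_holomorphic[OF d]
            open_chart_image[OF A(1)] H_space_holomorphic[OF \<omega> A(1)] L A(2)])
         (intro holomorphic_on_power holomorphic_deriv lift_holomorphic[OF d] open_chart_dom[OF d])
    also have "\<dots> = ?\<Omega> (U, \<phi>) (lift \<phi> z) * deriv (lift \<phi>) z ^ ?w"
      using A L by (simp add: differential_wronskian_def power_add power_mult image_subset_iff)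
    also have "\<dots> = pullback ?w ?\<Omega> z"
      using pullback_chart[OF H_space_mero[OF differential_wronskian_H[OF \<omega>]] A] by simp
    finally show ?thesis using True by (simp add: modular_wronskian_def)
  qed (simp add: pullback_off_H modular_wronskian_def)
qed

lemma H_space_power:
  assumes "\<alpha> \<in> H_space \<Gamma> 1" "l \<ge> 1"
  shows "(\<lambda>c z. \<alpha> c z ^ l) \<in> H_space \<Gamma> l"
  by (rule H_spaceI)
     (use H_space_mem[OF assms(1)] H_space_holomorphic[OF assms(1)] assms(2)
      in \<open>auto simp: power_0_left power_mult_distrib intro!: holomorphic_on_power\<close>)

text \<open>The value of the Wronskian at a point is a determinant of derivatives of order below \<open>t\<close> there, so
  it vanishes if and only if a non-trivial combination of the basis vanishes there to order \<open>t\<close>.\<close>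

lemma weierstrass_iff_wronskian:
  assumes basis: "dspace.indexed_basis t \<omega> (H_space \<Gamma> l)" and dim: "dspace.dim (H_space \<Gamma> l) = t"
    and a: "(U0, \<phi>0) \<in> atlas \<Gamma>" "a \<in> U0"
  shows "weierstrass_point (atlas \<Gamma>) l a \<longleftrightarrow> differential_wronskian (atlas \<Gamma>) t \<omega> (U0, \<phi>0) (\<phi>0 a) = 0"
proof -
  let ?\<Omega> = "differential_wronskian (atlas \<Gamma>) t \<omega>"
  have inj: "inj_on \<omega> {..<t}" and ind: "dspace.independent (\<omega> ` {..<t})"
    and span: "dspace.span (\<omega> ` {..<t}) = H_space \<Gamma> l"
    using basis unfolding dspace.indexed_basis_def by auto
  have \<omega>: "\<omega> j \<in> H_space \<Gamma> l" if "j < t" for j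
    unfolding span[symmetric] using that by (intro dspace.span_base) auto
  define c where "c = (SOME c. c \<in> atlas \<Gamma> \<and> a \<in> fst c)"
  have c: "c \<in> atlas \<Gamma> \<and> a \<in> fst c" unfolding c_def by (rule someI[of _ "(U0, \<phi>0)"]) (use a in simp)
  obtain U \<phi> where U: "c = (U, \<phi>)" by (cases c)
  have A: "(U, \<phi>) \<in> atlas \<Gamma>" "a \<in> U" using c U by auto
  have au: "\<phi> a \<in> \<phi> ` U" using A by blast
  have ord: "differential_order (atlas \<Gamma>) \<eta> a = zorder (\<eta> (U, \<phi>)) (\<phi> a)" for \<eta>
    unfolding differential_order_def c_def[symmetric] U by simp
  have lin: "dspace.span (\<omega> ` {..<t}) = {\<eta>. \<exists>c. \<eta> = (\<Sum>j<t. dscale (c j) (\<omega> j))}"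
  proof (intro equalityI subsetI)
    fix \<eta> assume "\<eta> \<in> dspace.span (\<omega> ` {..<t})"
    then have "\<eta> \<in> range (\<lambda>b. \<Sum>v\<in>\<omega> ` {..<t}. dscale (b v) v)"
      by (simp only: dspace.span_finite[OF finite_imageI[OF finite_lessThan]])
    then obtain b where "\<eta> = (\<Sum>v\<in>\<omega> ` {..<t}. dscale (b v) v)" by (rule rangeE)
    also have "\<dots> = (\<Sum>j<t. dscale (b (\<omega> j)) (\<omega> j))" by (rule sum.reindex_cong[OF inj refl refl])
    finally show "\<eta> \<in> {\<eta>. \<exists>c. \<eta> = (\<Sum>j<t. dscale (c j) (\<omega> j))}" by (intro CollectI exI)
  next
    fix \<eta> assume "\<eta> \<in> {\<eta>. \<exists>c. \<eta> = (\<Sum>j<t. dscale (c j) (\<omega> j))}"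
    then obtain c where \<eta>: "\<eta> = (\<Sum>j<t. dscale (c j) (\<omega> j))" by blast
    show "\<eta> \<in> dspace.span (\<omega> ` {..<t})"
      unfolding \<eta> by (intro dspace.span_sum dspace.span_scale dspace.span_base imageI)
  qed
  have val: "(\<Sum>j<n. dscale (c j) (\<omega> j)) (U, \<phi>) = (\<lambda>w. \<Sum>j<n. c j * \<omega> j (U, \<phi>) w)" for c n
    by (induction n) (auto simp: fun_eq_iff dscale_def)
  have zero: "(\<Sum>j<t. dscale (c j) (\<omega> j)) = 0 \<longleftrightarrow> (\<forall>j<t. c j = 0)" for c
  proof
    assume 0: "(\<Sum>j<t. dscale (c j) (\<omega> j)) = 0"
    let ?b = "\<lambda>v. c (the_inv_into {..<t} \<omega> v)"
    have "(\<Sum>v\<in>\<omega> ` {..<t}. dscale (?b v) v) = (\<Sum>j<t. dscale (?b (\<omega> j)) (\<omega> j))"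
      by (rule sum.reindex_cong[OF inj refl refl])
    also have "\<dots> = (\<Sum>j<t. dscale (c j) (\<omega> j))"
      by (rule sum.cong) (use the_inv_into_f_f[OF inj] in auto)
    finally have s0: "(\<Sum>v\<in>\<omega> ` {..<t}. dscale (?b v) v) = 0" using 0 by simp
    have "?b v = 0" if v: "v \<in> \<omega> ` {..<t}" for v
      by (rule dspace.independentD[where u = ?b, OF ind finite_imageI[OF finite_lessThan] subset_refl s0 v])
    then show "\<forall>j<t. c j = 0" using the_inv_into_f_f[OF inj] by force
  next
    assume "\<forall>j<t. c j = 0"
    then show "(\<Sum>j<t. dscale (c j) (\<omega> j)) = 0" by (intro sum.neutral) (simp add: dscale_def fun_eq_iff)
  qed
  have "weierstrass_point (atlas \<Gamma>) l a \<longleftrightarrow>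
      (\<exists>\<eta>\<in>H_space \<Gamma> l. \<eta> \<noteq> 0 \<and> (\<forall>i<t. (deriv ^^ i) (\<eta> (U, \<phi>)) (\<phi> a) = 0))"
    unfolding weierstrass_point_def dim ord
  proof (intro bex_cong refl conj_cong)
    fix \<eta> assume \<eta>: "\<eta> \<in> H_space \<Gamma> l" "\<eta> \<noteq> 0"
    show "zorder (\<eta> (U, \<phi>)) (\<phi> a) \<ge> int t \<longleftrightarrow> (\<forall>i<t. (deriv ^^ i) (\<eta> (U, \<phi>)) (\<phi> a) = 0)"
      by (rule zorder_ge_iff_higher_deriv[OF open_chart_image[OF A(1)] au H_space_holomorphic[OF \<eta>(1) A(1)]
            chart_expression_nonzero[OF \<eta> A(1) au]])
  qed
  also have "\<dots> \<longleftrightarrow> (\<exists>c. (\<exists>j<t. c j \<noteq> 0) \<and> (\<forall>i<t. (deriv ^^ i) (\<lambda>w. \<Sum>j<t. c j * \<omega> j (U, \<phi>) w) (\<phi> a) = 0))"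
  proof -
    have "(\<exists>\<eta>\<in>H_space \<Gamma> l. \<eta> \<noteq> 0 \<and> P (\<eta> (U, \<phi>))) \<longleftrightarrow>
        (\<exists>c. (\<exists>j<t. c j \<noteq> 0) \<and> P (\<lambda>w. \<Sum>j<t. c j * \<omega> j (U, \<phi>) w))" for P
    proof
      assume "\<exists>\<eta>\<in>H_space \<Gamma> l. \<eta> \<noteq> 0 \<and> P (\<eta> (U, \<phi>))"
      then obtain \<eta> where \<eta>: "\<eta> \<in> H_space \<Gamma> l" "\<eta> \<noteq> 0" "P (\<eta> (U, \<phi>))" by (elim bexE conjE) (rule that)
      then obtain c where c: "\<eta> = (\<Sum>j<t. dscale (c j) (\<omega> j))"
        unfolding span[symmetric] lin mem_Collect_eq by (elim exE) (rule that)
      have "\<exists>j<t. c j \<noteq> 0" using \<eta>(2) zero[of c] unfolding c[symmetric] by blast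
      moreover have "P (\<lambda>w. \<Sum>j<t. c j * \<omega> j (U, \<phi>) w)" using \<eta>(3) unfolding c val .
      ultimately show "\<exists>c. (\<exists>j<t. c j \<noteq> 0) \<and> P (\<lambda>w. \<Sum>j<t. c j * \<omega> j (U, \<phi>) w)" by (rule exI[where x = c, OF conjI])
    next
      assume "\<exists>c. (\<exists>j<t. c j \<noteq> 0) \<and> P (\<lambda>w. \<Sum>j<t. c j * \<omega> j (U, \<phi>) w)"
      then obtain c where c: "\<exists>j<t. c j \<noteq> 0" "P (\<lambda>w. \<Sum>j<t. c j * \<omega> j (U, \<phi>) w)"
        by (elim exE conjE) (rule that; assumption?; blast)
      show "\<exists>\<eta>\<in>H_space \<Gamma> l. \<eta> \<noteq> 0 \<and> P (\<eta> (U, \<phi>))"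
      proof (intro bexI conjI)
        show "(\<Sum>j<t. dscale (c j) (\<omega> j)) \<in> H_space \<Gamma> l"
          unfolding span[symmetric] lin mem_Collect_eq by (rule exI) (rule refl)
        show "(\<Sum>j<t. dscale (c j) (\<omega> j)) \<noteq> 0" using zero[of c] c(1) by blast
        show "P ((\<Sum>j<t. dscale (c j) (\<omega> j)) (U, \<phi>))" unfolding val by (rule c(2))
      qed
    qed
    then show ?thesis .
  qed
  also have "\<dots> \<longleftrightarrow> local_wronskian t (\<lambda>j. \<omega> j (U, \<phi>)) (\<phi> a) = 0"
    by (rule local_wronskian_eq_0_iff[symmetric, OF open_chart_image[OF A(1)] au H_space_holomorphic[OF \<omega> A(1)]])
  also have "\<dots> \<longleftrightarrow> ?\<Omega> (U, \<phi>) (\<phi> a) = 0" using A au by (simp add: differential_wronskian_def)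
  also have "\<dots> \<longleftrightarrow> ?\<Omega> (U0, \<phi>0) (\<phi>0 a) = 0"
  proof -
    have u: "\<phi> a \<in> \<phi> ` (U \<inter> U0)" using A(2) a(2) by blast
    note T = transition_props[OF A(1) a(1)]
    show ?thesis
      using H_space_mem(4)[OF differential_wronskian_H[OF \<omega>] A(1) a(1) u] T(3)[OF u] T(4)[OF A(2)] by simp
  qed
  finally show ?thesis .
qed

end

section \<open>The Wronskian of a basis and Weierstrass points at cusps\<close>

theorem theorem4p16:
  fixes \<Gamma> :: "mat22 set" and m t :: nat and f :: "nat \<Rightarrow> complex \<Rightarrow> complex"
  assumes "even m" and "m \<ge> 2"
    and "fuchsian_first_kind \<Gamma>" and "genus \<Gamma> \<ge> 1"
    and "t = fspace.dim (SH_forms \<Gamma> m)"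
    and "fspace.indexed_basis t f (SH_forms \<Gamma> m)"
  shows "let W = modular_wronskian t f; w = t * (m + t - 1);
             \<omega> = (\<lambda>i. form_differential \<Gamma> m (f i));
             \<Omega> = differential_wronskian (atlas \<Gamma>) t \<omega>
         in dspace.dim (H_space \<Gamma> (m div 2)) = t \<and>
            dspace.indexed_basis t \<omega> (H_space \<Gamma> (m div 2)) \<and>
            \<Omega> \<in> H_space \<Gamma> (w div 2) \<and>
            W \<in> cusp_forms \<Gamma> w \<and> W \<noteq> 0 \<and>
            form_differential \<Gamma> w W = \<Omega> \<and>
            W \<in> SH_forms \<Gamma> w \<and>
            (Infty \<in> cusps \<Gamma> \<longrightarrow>
               (weierstrass_point (atlas \<Gamma>) (m div 2) (orbit \<Gamma> Infty) \<longleftrightarrow>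
                  c'_divisor \<Gamma> w W (orbit \<Gamma> Infty) \<ge> 1 + of_nat t / 2 * (of_nat m - 1 + of_nat t)) \<and>
               (weierstrass_point (atlas \<Gamma>) (m div 2) (orbit \<Gamma> Infty) \<longleftrightarrow>
                  c_divisor \<Gamma> w W (orbit \<Gamma> Infty) \<ge> of_nat t / 2 * (of_nat m - 1 + of_nat t)))"
proof -
  interpret discrete_group \<Gamma>
    by (rule discrete_group.intro) (use assms(3) in \<open>simp_all add: fuchsian_first_kind_def\<close>)
  define l where "l = m div 2"
  have m: "m = 2 * l" and l: "l \<ge> 1" using assms(1,2) by (auto simp: l_def)
  define \<omega> where "\<omega> = (\<lambda>i. form_differential \<Gamma> m (f i))"
  define \<Omega> where "\<Omega> = differential_wronskian (atlas \<Gamma>) t \<omega>"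
  define W where "W = modular_wronskian t f"
  define k where "k = l * t + t * (t - 1) div 2"
  have finj: "inj_on f {..<t}" and find: "fspace.independent (f ` {..<t})"
    and fspan: "fspace.span (f ` {..<t}) = SH_forms \<Gamma> m"
    using assms(6) unfolding fspace.indexed_basis_def by auto
  have fin: "finite (f ` {..<t})" by simp
  have fSH: "f i \<in> SH_forms \<Gamma> (2 * l)" if "i < t" for i
    unfolding m[symmetric] fspan[symmetric] using that by (intro fspace.span_base) auto
  have \<omega>: "\<omega> i \<in> H_space \<Gamma> l" "pullback l (\<omega> i) = f i" if i: "i < t" for i
  proof -
    obtain \<eta> where \<eta>: "\<eta> \<in> H_space \<Gamma> l" "pullback l \<eta> = f i" using SH_is_pullback[OF fSH[OF i]] .
    have "\<omega> i = \<eta>" unfolding \<omega>_def m \<eta>(2)[symmetric] by (rule form_differential_pullback[OF H_space_mero[OF \<eta>(1)]])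
    then show "\<omega> i \<in> H_space \<Gamma> l" "pullback l (\<omega> i) = f i" using \<eta> by simp_all
  qed
  have sum_f: "(\<Sum>v\<in>f ` {..<t}. fscale (b v) v) = (\<Sum>i<t. fscale (b (f i)) (f i))" for b
    by (rule sum.reindex_cong[OF finj refl refl])
  have pull: "pullback l (\<Sum>i<t. dscale (c i) (\<omega> i)) = (\<Sum>i<t. fscale (c i) (f i))" for c
    unfolding pullback_sum by (rule sum.cong) (use \<omega>(2) in auto)
  have f_indep: "c i = 0" if c: "(\<Sum>i<t. fscale (c i) (f i)) = 0" and i: "i < t" for c i
  proof -
    let ?b = "\<lambda>v. c (the_inv_into {..<t} f v)"
    have "(\<Sum>v\<in>f ` {..<t}. fscale (?b v) v) = (\<Sum>i<t. fscale (c i) (f i))"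
      unfolding sum_f by (rule sum.cong) (use the_inv_into_f_f[OF finj] in auto)
    then have s0: "(\<Sum>v\<in>f ` {..<t}. fscale (?b v) v) = 0" using c by simp
    have "f i \<in> f ` {..<t}" using i by simp
    then have "?b (f i) = 0" by (rule fspace.independentD[where u = ?b, OF find fin subset_refl s0])
    then show ?thesis using the_inv_into_f_f[OF finj, of i] i by simp
  qed
  have inj\<omega>: "inj_on \<omega> {..<t}"
    using \<omega>(2) finj by (intro inj_onI) (metis inj_onD lessThan_iff)
  have sum_\<omega>: "(\<Sum>v\<in>\<omega> ` {..<t}. dscale (b v) v) = (\<Sum>i<t. dscale (b (\<omega> i)) (\<omega> i))" for b
    by (rule sum.reindex_cong[OF inj\<omega> refl refl])
  have \<omega>_indep: "b v = 0" if 0: "(\<Sum>v\<in>\<omega> ` {..<t}. dscale (b v) v) = 0" and v: "v \<in> \<omega> ` {..<t}" for b v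
  proof -
    have "(\<Sum>i<t. fscale (b (\<omega> i)) (f i)) = pullback l (\<Sum>i<t. dscale (b (\<omega> i)) (\<omega> i))"
      by (rule pull[symmetric])
    also have "\<dots> = 0" unfolding sum_\<omega>[symmetric] 0 by (rule pullback_zero)
    finally have z: "(\<Sum>i<t. fscale (b (\<omega> i)) (f i)) = 0" .
    obtain i where i: "i < t" "v = \<omega> i" using v by auto
    show "b v = 0" unfolding i(2) by (rule f_indep[where c = "\<lambda>i. b (\<omega> i)", OF z i(1)])
  qed
  have ind\<omega>: "dspace.independent (\<omega> ` {..<t})"
    unfolding dspace.dependent_finite[OF finite_imageI[OF finite_lessThan]]
  proof
    assume "\<exists>b. (\<exists>v\<in>\<omega> ` {..<t}. b v \<noteq> 0) \<and> (\<Sum>v\<in>\<omega> ` {..<t}. dscale (b v) v) = 0"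
    then obtain b v where "v \<in> \<omega> ` {..<t}" "b v \<noteq> 0" "(\<Sum>v\<in>\<omega> ` {..<t}. dscale (b v) v) = 0"
      by (elim exE conjE bexE) (rule that)
    then show False using \<omega>_indep[of b v] by (elim notE)
  qed
  have span\<omega>: "dspace.span (\<omega> ` {..<t}) = H_space \<Gamma> l"
  proof (intro equalityI subsetI)
    fix \<eta> assume "\<eta> \<in> dspace.span (\<omega> ` {..<t})"
    moreover have "dspace.span (\<omega> ` {..<t}) \<subseteq> H_space \<Gamma> l"
      by (rule dspace.span_minimal[OF _ H_space_subspace]) (use \<omega>(1) in auto)
    ultimately show "\<eta> \<in> H_space \<Gamma> l" by blast
  next
    fix \<eta> assume \<eta>: "\<eta> \<in> H_space \<Gamma> l"
    have "pullback l \<eta> \<in> fspace.span (f ` {..<t})"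
      unfolding fspan m by (rule pullback_SH[OF \<eta> l])
    then have "pullback l \<eta> \<in> range (\<lambda>b. \<Sum>v\<in>f ` {..<t}. fscale (b v) v)"
      by (simp only: fspace.span_finite[OF fin])
    then obtain b where b: "pullback l \<eta> = (\<Sum>v\<in>f ` {..<t}. fscale (b v) v)" by (rule rangeE)
    let ?\<eta> = "\<Sum>i<t. dscale (b (f i)) (\<omega> i)"
    have s: "?\<eta> \<in> dspace.span (\<omega> ` {..<t})"
      by (intro dspace.span_sum dspace.span_scale dspace.span_base) auto
    moreover have "dspace.span (\<omega> ` {..<t}) \<subseteq> H_space \<Gamma> l"
      by (rule dspace.span_minimal[OF _ H_space_subspace]) (use \<omega>(1) in auto)
    ultimately have "?\<eta> \<in> H_space \<Gamma> l" by blast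
    moreover have "pullback l ?\<eta> = pullback l \<eta>" unfolding b sum_f by (rule pull)
    ultimately have "\<eta> = ?\<eta>" by (intro pullback_inj[OF \<eta>]) simp_all
    then show "\<eta> \<in> dspace.span (\<omega> ` {..<t})" using s by simp
  qed
  have basis: "dspace.indexed_basis t \<omega> (H_space \<Gamma> l)"
    unfolding dspace.indexed_basis_def using inj\<omega> ind\<omega> span\<omega> by blast
  have dim: "dspace.dim (H_space \<Gamma> l) = t"
    unfolding span\<omega>[symmetric] dspace.dim_span dspace.dim_eq_card_independent[OF ind\<omega>]
    using card_image[OF inj\<omega>] by simp
  \<comment> \<open>A non-zero differential of degree 1 exists, and its powers are non-zero, so that \<open>t > 0\<close>.\<close>
  have t: "t \<ge> 1"
  proof -
    have "\<not> H_space \<Gamma> 1 \<subseteq> {0}"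
    proof
      assume "H_space \<Gamma> 1 \<subseteq> {0}"
      then have "dspace.span {} = dspace.span (H_space \<Gamma> 1)"
        using dspace.span_empty dspace.span_mono[of "H_space \<Gamma> 1" "{0}"] dspace.span_zero by (auto simp: dspace.span_singleton)
      then have "genus \<Gamma> = card ({} :: point differential set)"
        unfolding genus_def using dspace.dim_eq_card[of "{}" "H_space \<Gamma> 1"] dspace.independent_empty by simp
      then show False using assms(4) by simp
    qed
    then obtain \<alpha> where \<alpha>: "\<alpha> \<in> H_space \<Gamma> 1" "\<alpha> \<noteq> 0" by blast
    then obtain c z where "\<alpha> c z \<noteq> 0" by (auto simp: fun_eq_iff)
    have "(\<lambda>c z. \<alpha> c z ^ l) \<noteq> 0"
    proof
      assume "(\<lambda>c z. \<alpha> c z ^ l) = 0"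
      from fun_cong[OF fun_cong[OF this, of c], of z] show False using \<open>\<alpha> c z \<noteq> 0\<close> by simp
    qed
    moreover have "(\<lambda>c z. \<alpha> c z ^ l) \<in> dspace.span (\<omega> ` {..<t})"
      unfolding span\<omega> by (rule H_space_power[OF \<alpha>(1) l])
    ultimately have "\<omega> ` {..<t} \<noteq> {}" by (metis dspace.span_empty singletonD)
    then show ?thesis by auto
  qed
  have w: "t * (m + t - 1) = 2 * k" unfolding m k_def by (rule wronskian_weight[OF t])
  have \<Omega>H: "\<Omega> \<in> H_space \<Gamma> k" unfolding \<Omega>_def k_def by (rule differential_wronskian_H[OF \<omega>(1)])
  have W_eq: "pullback k \<Omega> = W"
  proof -
    have "pullback k \<Omega> = modular_wronskian t (\<lambda>j. pullback l (\<omega> j))"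
      unfolding \<Omega>_def k_def by (rule pullback_differential_wronskian[OF \<omega>(1)])
    also have "\<dots> = W" unfolding W_def modular_wronskian_def
      using local_wronskian_cong[of \<H> _ t "\<lambda>j. pullback l (\<omega> j)" f] \<omega>(2) by (auto simp: fun_eq_iff)
    finally show ?thesis .
  qed
  have fhol: "f j holomorphic_on \<H>" "\<And>z. z \<notin> \<H> \<Longrightarrow> f j z = 0" if "j < t" for j
    using pullback_holomorphic[OF \<omega>(1)[OF that]] pullback_off_H[of _ l "\<omega> j"] unfolding \<omega>(2)[OF that] by blast+
  have W0: "W \<noteq> 0"
  proof
    assume W0: "W = 0"
    have Wz: "local_wronskian t f z = 0" if "z \<in> \<H>" for z
      using fun_cong[OF W0, of z] that by (simp add: W_def modular_wronskian_def)
    have "\<i> \<in> \<H>" by (simp add: upper_half_plane_iff)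
    then have "\<H> \<noteq> {}" by blast
    then obtain c where c: "\<exists>j<t. c j \<noteq> 0" "\<forall>z\<in>\<H>. (\<Sum>j<t. c j * f j z) = 0"
      using local_wronskian_zero_imp_dependent[OF open_upper_half_plane connected_upper_half_plane _ fhol(1) Wz] by blast
    have val: "(\<Sum>j<n. fscale (c j) (f j)) z = (\<Sum>j<n. c j * f j z)" for n z
      by (induction n) (auto simp: fscale_def)
    have "(\<Sum>j<t. fscale (c j) (f j)) z = 0" for z
      unfolding val using c(2) fhol(2) by (cases "z \<in> \<H>") auto
    then have "(\<Sum>j<t. fscale (c j) (f j)) = 0" by (auto simp: fun_eq_iff)
    then show False using f_indep[of c] c(1) by blast
  qed
  have "0 < l * t" using l t by simp
  then have k: "k \<ge> 1" unfolding k_def by linarith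
  have WSH: "W \<in> SH_forms \<Gamma> (2 * k)" using pullback_SH[OF \<Omega>H k] unfolding W_eq .
  then have Wcf: "W \<in> cusp_forms \<Gamma> (2 * k)" unfolding SH_forms_def by blast
  have form: "form_differential \<Gamma> (2 * k) W = \<Omega>"
    using form_differential_pullback[OF H_space_mero[OF \<Omega>H]] unfolding W_eq .
  have \<Omega>0: "\<Omega> \<noteq> 0" using W0 W_eq pullback_zero by metis
  have kt: "(of_nat t / 2 * (of_nat m - 1 + of_nat t) :: rat) = of_nat k"
  proof -
    have "(of_nat (2 * k) :: rat) = of_nat t * (of_nat m - 1 + of_nat t)"
      unfolding w[symmetric] using t by (simp add: of_nat_diff)
    then show ?thesis by simp
  qed
  have wp: "(weierstrass_point (atlas \<Gamma>) l b \<longleftrightarrow> c'_divisor \<Gamma> (2 * k) W b \<ge> 1 + of_nat k) \<and>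
      (weierstrass_point (atlas \<Gamma>) l b \<longleftrightarrow> c_divisor \<Gamma> (2 * k) W b \<ge> of_nat k)" if b: "b \<in> cusp_points \<Gamma>" for b
  proof -
    have c': "c'_divisor \<Gamma> (2 * k) W b = of_nat (cusp_order \<Gamma> (2 * k) W b)"
      using b cusp_point_not_elliptic[OF b] by (simp add: c'_divisor_def div_form_def)
    have c: "c_divisor \<Gamma> (2 * k) W b = of_nat (cusp_order \<Gamma> (2 * k) W b) - 1"
      using b c' by (simp add: c_divisor_def)
    obtain U \<phi> where U: "(U, \<phi>) \<in> atlas \<Gamma>" "b \<in> U" "cusp_order \<Gamma> (2 * k) W b > k \<longleftrightarrow> \<Omega> (U, \<phi>) (\<phi> b) = 0"
      using cusp_order_pullback(2)[OF \<Omega>H \<Omega>0 k b] unfolding W_eq by blast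
    have wk: "weierstrass_point (atlas \<Gamma>) l b \<longleftrightarrow> cusp_order \<Gamma> (2 * k) W b \<ge> Suc k"
      using weierstrass_iff_wronskian[OF basis dim U(1,2)] U(3) unfolding \<Omega>_def by (simp add: Suc_le_eq)
    also have "\<dots> \<longleftrightarrow> (of_nat (Suc k) :: rat) \<le> of_nat (cusp_order \<Gamma> (2 * k) W b)" by (simp only: of_nat_le_iff)
    finally show ?thesis unfolding c c' by (auto simp: algebra_simps)
  qed
  have wpI: "Infty \<in> cusps \<Gamma> \<longrightarrow>
      (weierstrass_point (atlas \<Gamma>) l (orbit \<Gamma> Infty) \<longleftrightarrow> c'_divisor \<Gamma> (2 * k) W (orbit \<Gamma> Infty) \<ge> 1 + of_nat k) \<and>
      (weierstrass_point (atlas \<Gamma>) l (orbit \<Gamma> Infty) \<longleftrightarrow> c_divisor \<Gamma> (2 * k) W (orbit \<Gamma> Infty) \<ge> of_nat k)"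
    by (rule impI, rule wp) (simp add: cusp_points_def)
  have k2: "2 * k div 2 = k" by simp
  show ?thesis
    unfolding Let_def W_def[symmetric] \<omega>_def[symmetric] \<Omega>_def[symmetric] w l_def[symmetric] kt k2
    by (intro conjI dim basis \<Omega>H Wcf W0 form WSH wpI)
qed

end
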